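(* Let $0<\beta_1\le\beta_2$, $L>0$, $\Theta=\bigcup_{\beta\in[\beta_1,\beta_2]}\mathcal H(\beta,L)=\mathcal H(\beta_1,L)$, $\ell=\ell_\infty$ and $d=\ell_2$, with $\mathcal D_n$ the grid defined in the context. (a) Assume that $\theta_0\in\Theta$ and consider the partition $(\mathcal J_r,r\ge0)$ of $\mathcal D_n$ (depending on $\theta_0$) defined in the context. Then this partition is $\theta_0$-admissible, that is, $\mathcal J_0=\{\theta\in\mathcal D_n:\ell_\infty(\theta_0,\theta)\le A\,\epsilon_n(\theta_0)\}$ for a constant $A>0$ and $|\mathcal J_r|\le|\mathcal J_0|$ for all $r\ge1$. Moreover it satisfies the following condition: there exist constants $C_0,K_0,K_1>0$ (not depending on $\theta_0$) and injective maps $j_r:\mathcal J_r\to\mathcal J_0$, $r\ge1$, such that $$\sum_{r\ge1}e^{-K_0nu_r^2}\le C_0\,e^{-K_1n\,\Omega(\epsilon_n(\cdot),\theta_0,\ell_\infty)^2},\qquad u_r=\min\{\ell_2(\theta,j_r(\theta)):\theta\in\mathcal J_r\}.$$ (b) Let $\pi_n$ be the sieve prior given by the uniform distribution on $\mathcal D_n$. If $Y^n$ is drawn from the Gaussian white noise sequence model, then for every $0<\beta_1\le\beta_2$ and $L>0$ there exist $M,B>0$ such that $$\sup_{\theta_0\in\mathcal H(\beta,L)}E^n_{\theta_0}\big[P^{\pi_n}\big(\theta:\ell_\infty(\theta,\theta_0)\ge M(n/\log n)^{-\beta/(2\beta+1)}\mid Y^n\big)\big]\le n^{-B}$$ uniformly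 in $\beta\in[\beta_1,\beta_2]$.
   Context: Index set: $\Lambda=\{(j,k): j\in\mathbb N=\{0,1,2,\dots\},\ k\in I_j\}$, where the $I_j$ are finite sets with $|I_j|$ of order $2^j$, indexing a compactly supported orthonormal wavelet basis of $L^2([0,1])$. Gaussian white noise sequence model: under $P^n_{\theta}$, $\theta\in\ell^2(\Lambda)$, one observes $Y_{j,k}=\theta_{j,k}+n^{-1/2}\epsilon_{j,k}$, $(j,k)\in\Lambda$, with $\epsilon_{j,k}$ i.i.d. $\mathcal N(0,1)$; $E^n_\theta$ is the corresponding expectation and $P^{\pi_n}(\cdot\mid Y^n)$ is the posterior distribution for the prior $\pi_n$. Losses: $\ell_2(\theta,\theta')=\big(\sum_{(j,k)\in\Lambda}(\theta_{j,k}-\theta'_{j,k})^2\big)^{1/2}$ and $\ell_\infty(\theta,\theta')=\sum_{j\in\mathbb N}2^{j/2}\max_{k\in I_j}|\theta_{j,k}-\theta'_{j,k}|$. Hölder balls: $\mathcal H(\beta,L)=\{\theta:|\theta_{j,k}|\le L2^{-j(\beta+1/2)}\ \text{for all }(j,k)\in\Lambda\}$. Rates: $\epsilon_n(\beta)=(n/\log n)^{-\beta/(2\beta+1)}$. The family $(\epsilon_n(\theta),\theta\in\Theta)$ is the target concentration rate: each $\theta\in\Theta$ is regarded as an element of $\mathcal H(\beta,L)$ for an index $\beta\in[\beta_1,\beta_2]$ (depending on $\theta$), and $\epsilon_n(\theta)=\epsilon_n(\beta)$ for that index. Modulus: $\Omega(\epsilon_n(\cdot),\theta_0,\ell_\infty)=\inf\{\ell_2(\theta_0,\theta'):\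 \ell_\infty(\theta_0,\theta')\ge\epsilon_n(\theta_0)+\epsilon_n(\theta'),\ \theta'\in\Theta\}$. Grid: let $J_n$ be the integer with $n<2^{J_n}\le2n$, let $\phi_n=\phi_0(\log n/n)^{1/2}$ where $\phi_0>0$ is a fixed constant, and let $\mathcal D_n$ be the set of all $\theta=(\theta_{j,k})_{(j,k)\in\Lambda}$ with $\theta_{j,k}=a_{j,k}\phi_n$, $a_{j,k}\in\mathbb Z$, $a_{j,k}\phi_n\in[-L-1,L+1]$ for $j\le J_n$, $k\in I_j$, and $\theta_{j,k}=0$ for $j>J_n$. Partition (depending on $\theta_0=(\theta^0_{j,k})\in\mathcal H(\beta,L)$, $\beta\in[\beta_1,\beta_2]$ being the index attached to $\theta_0$): there are an integer $J_n(\beta)$ and a constant $b_0$ with $\sup_{j>J_n(\beta)}\max_{k\in I_j}|\theta^0_{j,k}|\le\phi_n/4$, $\sum_{j>J_n(\beta)}2^{j/2}\max_{k\in I_j}|\theta^0_{j,k}|\le\epsilon_n(\beta)$ and $2^{J_n(\beta)}\le b_0(n/\log n)^{1/(2\beta+1)}$. Pick $\theta^*\in\mathcal D_n$ with $|\theta^0_{j,k}-\theta^*_{j,k}|\le\phi_n/2$ for all $(j,k)\in\Lambda$. Let $\mathcal U=\{(j,k)\in\Lambda:\ j\le J_n,\ \min_{t\in\mathbb Z}|\theta^0_{j,k}-t\phi_n|\le\phi_n/4\}$ and, for $\theta,\theta'\in\mathcal D_n$, $$d_1(\theta,\theta')^2=\sum_{j\le J_n,\,k\in I_j}\Big((\theta_{j,k}-\theta'_{j,k})^2-\phi_n^2\,\mathbf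 1\{(j,k)\in\mathcal U^c,\ \theta_{j,k}\wedge\theta'_{j,k}<\theta^0_{j,k}<\theta_{j,k}\vee\theta'_{j,k}\}\Big).$$ The relation $d_1(\theta,\theta')=0$ is an equivalence relation on $\mathcal D_n$; let $\mathcal I_0$ be the class of $\theta^*$ and $\mathcal I_r$, $r\ge1$, the other classes. Fix a constant $A\ge4(3\phi_0b_0^{1/2}+1)$ and set $$\mathcal J_0=\{\theta\in\mathcal D_n:\ell_\infty(\theta,\theta_0)\le A\,\epsilon_n(\beta)\},\qquad \mathcal J_r=\mathcal I_r\cap\mathcal J_0^c\quad(r\ge1),$$ empty $\mathcal J_r$ being discarded.
   Formalization: Part (b) is stated for φ_0 > 2√2, as it fails for smaller φ_0 (take θ_0 = 0); part (a) holds for every φ_0 > 0, for all n ≥ 2 for which θ* exists and, for the sum bound, the set defining Ω is nonempty (both hold for all large n, uniformly in θ_0). *)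

theory Defs
  imports "HOL-Probability.Probability"
begin

text \<open>
  Sequences indexed by \<open>\<Lambda>\<close> are total functions on \<open>nat \<times> 'k\<close>; the parameters (elements of Hoelder
  balls and of the grid) are required to vanish off \<open>\<Lambda>\<close>, so that they correspond one-to-one to
  families indexed by \<open>\<Lambda>\<close>.
\<close>

definition Lam :: "(nat \<Rightarrow> 'k set) \<Rightarrow> (nat \<times> 'k) set"
  where "Lam I = (SIGMA j:UNIV. I j)"

definition ell2 :: "(nat \<Rightarrow> 'k set) \<Rightarrow> (nat \<times> 'k \<Rightarrow> real) \<Rightarrow> (nat \<times> 'k \<Rightarrow> real) \<Rightarrow> real"
  where "ell2 I \<theta> \<theta>' = sqrt (\<Sum>\<^sub>\<infinity>p\<in>Lam I. (\<theta> p - \<theta>' p)\<^sup>2)"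

definition ell_inf :: "(nat \<Rightarrow> 'k set) \<Rightarrow> (nat \<times> 'k \<Rightarrow> real) \<Rightarrow> (nat \<times> 'k \<Rightarrow> real) \<Rightarrow> real"
  where "ell_inf I \<theta> \<theta>' = (\<Sum>j. 2 powr (real j / 2) * (MAX k\<in>I j. \<bar>\<theta> (j, k) - \<theta>' (j, k)\<bar>))"

text \<open>
  Both series converge whenever the two arguments lie in Hoelder balls (of positive index) or in the
  grid, which are the only arguments used below.
\<close>

definition hoelder :: "(nat \<Rightarrow> 'k set) \<Rightarrow> real \<Rightarrow> real \<Rightarrow> (nat \<times> 'k \<Rightarrow> real) set"
  where "hoelder I \<beta> L =
    {\<theta>. (\<forall>p. p \<notin> Lam I \<longrightarrow> \<theta> p = 0) \<and>
        (\<forall>(j, k)\<in>Lam I. \<bar>\<theta> (j, k)\<bar> \<le> L * 2 powr (- (real j * (\<beta> + 1/2))))}"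

definition hoelder_union :: "(nat \<Rightarrow> 'k set) \<Rightarrow> real \<Rightarrow> real \<Rightarrow> real \<Rightarrow> (nat \<times> 'k \<Rightarrow> real) set"
  where "hoelder_union I \<beta>1 \<beta>2 L = (\<Union>\<beta>\<in>{\<beta>1..\<beta>2}. hoelder I \<beta> L)"

definition rate :: "real \<Rightarrow> nat \<Rightarrow> real"
  where "rate \<beta> n = (real n / ln (real n)) powr (- \<beta> / (2 * \<beta> + 1))"

text \<open>
  The argument \<open>e\<close> is the family of target rates \<open>\<theta> \<mapsto> \<epsilon>\<^sub>n(\<theta>)\<close>. The real infimum is only meaningful
  if \<open>separated I T e \<theta>0\<close> is nonempty.
\<close>

definition separated :: "(nat \<Rightarrow> 'k set) \<Rightarrow> (nat \<times> 'k \<Rightarrow> real) set \<Rightarrow>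
    ((nat \<times> 'k \<Rightarrow> real) \<Rightarrow> real) \<Rightarrow> (nat \<times> 'k \<Rightarrow> real) \<Rightarrow> (nat \<times> 'k \<Rightarrow> real) set"
  where "separated I T e \<theta>0 = {\<theta>'\<in>T. ell_inf I \<theta>0 \<theta>' \<ge> e \<theta>0 + e \<theta>'}"

definition modulus :: "(nat \<Rightarrow> 'k set) \<Rightarrow> (nat \<times> 'k \<Rightarrow> real) set \<Rightarrow>
    ((nat \<times> 'k \<Rightarrow> real) \<Rightarrow> real) \<Rightarrow> (nat \<times> 'k \<Rightarrow> real) \<Rightarrow> real"
  where "modulus I T e \<theta>0 = (INF \<theta>'\<in>separated I T e \<theta>0. ell2 I \<theta>0 \<theta>')"


section \<open>The grid\<close>

definition Jmax :: "nat \<Rightarrow> nat"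
  where "Jmax n = (THE J. n < 2 ^ J \<and> 2 ^ J \<le> 2 * n)"

definition phi :: "real \<Rightarrow> nat \<Rightarrow> real"
  where "phi \<phi>0 n = \<phi>0 * sqrt (ln (real n) / real n)"

definition grid :: "(nat \<Rightarrow> 'k set) \<Rightarrow> real \<Rightarrow> real \<Rightarrow> nat \<Rightarrow> (nat \<times> 'k \<Rightarrow> real) set"
  where "grid I \<phi>0 L n =
    {\<theta>. (\<forall>p. p \<notin> Lam I \<or> fst p > Jmax n \<longrightarrow> \<theta> p = 0) \<and>
        (\<forall>p\<in>Lam I. fst p \<le> Jmax n \<longrightarrow>
           (\<exists>a::int. \<theta> p = of_int a * phi \<phi>0 n) \<and> \<theta> p \<in> {- L - 1..L + 1})}"


section \<open>The partition of the grid\<close>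

text \<open>
  \<open>b0\<close> is the constant and \<open>J n \<beta>\<close> the (possibly negative) cut-off level, which serve all parameters
  of the Hoelder balls simultaneously.
\<close>

definition tail_cutoff :: "(nat \<Rightarrow> 'k set) \<Rightarrow> real \<Rightarrow> real \<Rightarrow> real \<Rightarrow> real \<Rightarrow> real \<Rightarrow>
    (nat \<Rightarrow> real \<Rightarrow> int) \<Rightarrow> bool"
  where "tail_cutoff I \<phi>0 \<beta>1 \<beta>2 L b0 J \<longleftrightarrow>
    (\<forall>n\<ge>2. \<forall>\<beta>\<in>{\<beta>1..\<beta>2}.
       2 powr (of_int (J n \<beta>)) \<le> b0 * (real n / ln (real n)) powr (1 / (2 * \<beta> + 1)) \<and>
       (\<forall>\<theta>\<in>hoelder I \<beta> L.
          (\<forall>(j, k)\<in>Lam I. int j > J n \<beta> \<longrightarrow> \<bar>\<theta> (j, k)\<bar> \<le> phi \<phi>0 n / 4) \<and>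
          (\<Sum>j. if int j > J n \<beta> then 2 powr (real j / 2) * (MAX k\<in>I j. \<bar>\<theta> (j, k)\<bar>) else 0)
            \<le> rate \<beta> n))"

definition near_grid_point :: "(nat \<Rightarrow> 'k set) \<Rightarrow> real \<Rightarrow> real \<Rightarrow> nat \<Rightarrow> (nat \<times> 'k \<Rightarrow> real) \<Rightarrow>
    (nat \<times> 'k \<Rightarrow> real) \<Rightarrow> bool"
  where "near_grid_point I \<phi>0 L n \<theta>0 \<theta>s \<longleftrightarrow>
    \<theta>s \<in> grid I \<phi>0 L n \<and> (\<forall>p\<in>Lam I. \<bar>\<theta>0 p - \<theta>s p\<bar> \<le> phi \<phi>0 n / 2)"

definition near_set :: "(nat \<Rightarrow> 'k set) \<Rightarrow> real \<Rightarrow> nat \<Rightarrow> (nat \<times> 'k \<Rightarrow> real) \<Rightarrow> (nat \<times> 'k) set"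
  where "near_set I \<phi>0 n \<theta>0 =
    {p\<in>Lam I. fst p \<le> Jmax n \<and> (\<exists>t::int. \<bar>\<theta>0 p - of_int t * phi \<phi>0 n\<bar> \<le> phi \<phi>0 n / 4)}"

definition d1 :: "(nat \<Rightarrow> 'k set) \<Rightarrow> real \<Rightarrow> nat \<Rightarrow> (nat \<times> 'k \<Rightarrow> real) \<Rightarrow>
    (nat \<times> 'k \<Rightarrow> real) \<Rightarrow> (nat \<times> 'k \<Rightarrow> real) \<Rightarrow> real"
  where "d1 I \<phi>0 n \<theta>0 \<theta> \<theta>' = sqrt (\<Sum>p\<in>{p\<in>Lam I. fst p \<le> Jmax n}.
    (\<theta> p - \<theta>' p)\<^sup>2 - (phi \<phi>0 n)\<^sup>2 *
      of_bool (p \<notin> near_set I \<phi>0 n \<theta>0 \<and> min (\<theta> p) (\<theta>' p) < \<theta>0 p \<and> \<theta>0 p < max (\<theta> p) (\<theta>' p)))"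

definition d1_rel :: "(nat \<Rightarrow> 'k set) \<Rightarrow> real \<Rightarrow> real \<Rightarrow> nat \<Rightarrow> (nat \<times> 'k \<Rightarrow> real) \<Rightarrow>
    ((nat \<times> 'k \<Rightarrow> real) \<times> (nat \<times> 'k \<Rightarrow> real)) set"
  where "d1_rel I \<phi>0 L n \<theta>0 =
    {(\<theta>, \<theta>'). \<theta> \<in> grid I \<phi>0 L n \<and> \<theta>' \<in> grid I \<phi>0 L n \<and> d1 I \<phi>0 n \<theta>0 \<theta> \<theta>' = 0}"

definition block0 :: "(nat \<Rightarrow> 'k set) \<Rightarrow> real \<Rightarrow> real \<Rightarrow> nat \<Rightarrow> (nat \<times> 'k \<Rightarrow> real) \<Rightarrow> real \<Rightarrow>
    (nat \<times> 'k \<Rightarrow> real) set"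
  where "block0 I \<phi>0 L n \<theta>0 r = {\<theta>\<in>grid I \<phi>0 L n. ell_inf I \<theta> \<theta>0 \<le> r}"

text \<open>
  The blocks with index \<open>r \<ge> 1\<close>. Being nonempty and pairwise disjoint, they are represented by the
  set of all of them rather than by a numbering.
\<close>

definition blocks :: "(nat \<Rightarrow> 'k set) \<Rightarrow> real \<Rightarrow> real \<Rightarrow> nat \<Rightarrow> (nat \<times> 'k \<Rightarrow> real) \<Rightarrow>
    (nat \<times> 'k \<Rightarrow> real) \<Rightarrow> real \<Rightarrow> (nat \<times> 'k \<Rightarrow> real) set set"
  where "blocks I \<phi>0 L n \<theta>0 \<theta>s r =
    {C - block0 I \<phi>0 L n \<theta>0 r | C.
       C \<in> grid I \<phi>0 L n // d1_rel I \<phi>0 L n \<theta>0 \<and> C \<noteq> d1_rel I \<phi>0 L n \<theta>0 `` {\<theta>s}} - {{}}"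

definition admissible :: "(nat \<Rightarrow> 'k set) \<Rightarrow> (nat \<times> 'k \<Rightarrow> real) set \<Rightarrow> (nat \<times> 'k \<Rightarrow> real) \<Rightarrow> real \<Rightarrow>
    real \<Rightarrow> (nat \<times> 'k \<Rightarrow> real) set \<Rightarrow> (nat \<times> 'k \<Rightarrow> real) set set \<Rightarrow> bool"
  where "admissible I D \<theta>0 A \<epsilon> B0 \<B> \<longleftrightarrow>
    partition_on D (insert B0 \<B>) \<and> B0 \<notin> \<B> \<and>
    A > 0 \<and> B0 = {\<theta>\<in>D. ell_inf I \<theta>0 \<theta> \<le> A * \<epsilon>} \<and>
    (\<forall>S\<in>\<B>. card S \<le> card B0)"


section \<open>White noise model and posterior distribution\<close>

definition white_noise :: "(nat \<Rightarrow> 'k set) \<Rightarrow> nat \<Rightarrow> (nat \<times> 'k \<Rightarrow> real) \<Rightarrow> (nat \<times> 'k \<Rightarrow> real) measure"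
  where "white_noise I n \<theta> =
    distr (\<Pi>\<^sub>M p\<in>Lam I. density lborel std_normal_density) (\<Pi>\<^sub>M p\<in>Lam I. borel)
      (\<lambda>\<epsilon>. \<lambda>p\<in>Lam I. \<theta> p + \<epsilon> p / sqrt (real n))"

text \<open>
  The density of \<open>white_noise I n \<theta>\<close> with respect to \<open>white_noise I n (\<lambda>_. 0)\<close>, for \<open>\<theta>\<close> of finite
  support; see \<open>density_likelihood\<close> below.
\<close>

definition likelihood :: "(nat \<Rightarrow> 'k set) \<Rightarrow> nat \<Rightarrow> (nat \<times> 'k \<Rightarrow> real) \<Rightarrow> (nat \<times> 'k \<Rightarrow> real) \<Rightarrow> real"
  where "likelihood I n \<theta> y = (\<Prod>p\<in>{p\<in>Lam I. \<theta> p \<noteq> 0}.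
    normal_density (\<theta> p) (1 / sqrt (real n)) (y p) / normal_density 0 (1 / sqrt (real n)) (y p))"

text \<open>
  Bayes' formula for a prior on finitely supported parameters. By \<open>posterior_disintegration\<close> below
  it is a version of the conditional distribution of \<open>\<theta>\<close> given the observation \<open>y\<close>.
\<close>

definition posterior :: "(nat \<Rightarrow> 'k set) \<Rightarrow> nat \<Rightarrow> (nat \<times> 'k \<Rightarrow> real) pmf \<Rightarrow> (nat \<times> 'k \<Rightarrow> real) \<Rightarrow>
    (nat \<times> 'k \<Rightarrow> real) set \<Rightarrow> real"
  where "posterior I n \<pi> y B =
    measure_pmf.expectation \<pi> (\<lambda>\<theta>. indicator B \<theta> * likelihood I n \<theta> y) /
    measure_pmf.expectation \<pi> (\<lambda>\<theta>. likelihood I n \<theta> y)"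

definition sieve_prior :: "(nat \<Rightarrow> 'k set) \<Rightarrow> real \<Rightarrow> real \<Rightarrow> nat \<Rightarrow> (nat \<times> 'k \<Rightarrow> real) pmf"
  where "sieve_prior I \<phi>0 L n = pmf_of_set (grid I \<phi>0 L n)"


lemma likelihood_nonneg: "0 \<le> likelihood I n \<theta> y"
  unfolding likelihood_def by (intro prod_nonneg) auto

lemma white_noise_eq_PiM:
  fixes I :: "nat \<Rightarrow> 'k set"
  assumes "n > 0"
  shows "white_noise I n \<theta> =
    (\<Pi>\<^sub>M p\<in>Lam I. density lborel (normal_density (\<theta> p) (1 / sqrt (real n))))"
proof -
  let ?s = "1 / sqrt (real n)"
  let ?S = "\<lambda>p::nat \<times> 'k. density lborel (\<lambda>x. ennreal (std_normal_density x))"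
  let ?N = "\<lambda>p. density lborel (\<lambda>x. ennreal (normal_density (\<theta> p) ?s x))"
  let ?f = "\<lambda>\<epsilon>. \<lambda>p\<in>Lam I. \<theta> p + \<epsilon> p / sqrt (real n)"
  have s: "?s > 0" using assms by simp
  interpret S: product_prob_space ?S "Lam I"
    by (intro product_prob_spaceI prob_space_normal_density) simp
  interpret N: product_prob_space ?N "Lam I"
    by (intro product_prob_spaceI prob_space_normal_density s)
  have meas: "?f \<in> measurable (PiM (Lam I) ?S) (PiM (Lam I) (\<lambda>_. borel))"
  proof (intro measurable_restrict)
    fix p assume p: "p \<in> Lam I"
    show "(\<lambda>\<epsilon>. \<theta> p + \<epsilon> p / sqrt (real n)) \<in> measurable (PiM (Lam I) ?S) borel"
      by (rule measurable_compose[of "\<lambda>y. y p" _ "?S p" "\<lambda>x. \<theta> p + x / sqrt (real n)"])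
        (use p in \<open>auto intro!: measurable_component_singleton\<close>)
  qed
  have sets_eq: "sets (PiM (Lam I) ?N) = sets (PiM (Lam I) (\<lambda>_. borel :: real measure))"
    by (intro sets_PiM_cong) auto
  show ?thesis
  proof (rule measure_eqI_PiM_infinite[symmetric, where M = ?N and I = "Lam I"])
    show "sets (white_noise I n \<theta>) = sets (PiM (Lam I) ?N)"
      unfolding white_noise_def using sets_eq by simp
    show "finite_measure (PiM (Lam I) ?N)" by unfold_locales
  next
    fix A J assume J: "finite J" "J \<subseteq> Lam I" and A: "\<And>p. p \<in> J \<Longrightarrow> A p \<in> sets (?N p)"
    have A': "A p \<in> sets borel" if "p \<in> J" for p using A[OF that] by simp
    let ?X = "prod_emb (Lam I) ?N J (Pi\<^sub>E J A)"
    let ?A' = "\<lambda>p. (\<lambda>x. \<theta> p + x / sqrt (real n)) -` A p"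
    have X: "?X \<in> sets (PiM (Lam I) (\<lambda>_. borel))"
      unfolding sets_eq[symmetric] using J A by (intro sets_PiM_I) auto
    have affine: "distr (?S p) borel (\<lambda>x. \<theta> p + x / sqrt (real n)) = ?N p" for p
    proof -
      have "distributed (?S p) lborel (\<lambda>x. x) (normal_density 0 1)"
        by (auto simp: distributed_def distr_id2)
      from prob_space.normal_density_affine[OF prob_space_normal_density this _, of ?s "\<theta> p"] s
      have "distributed (?S p) lborel (\<lambda>x. \<theta> p + ?s * x) (normal_density (\<theta> p) ?s)" by simp
      then have "distr (?S p) lborel (\<lambda>x. \<theta> p + ?s * x) = ?N p"
        by (simp add: distributed_def)
      moreover have "distr (?S p) lborel (\<lambda>x. \<theta> p + ?s * x) =
          distr (?S p) borel (\<lambda>x. \<theta> p + x / sqrt (real n))"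
        by (intro distr_cong) auto
      ultimately show ?thesis by simp
    qed
    have m: "(\<lambda>x. \<theta> p + x / sqrt (real n)) \<in> borel_measurable borel" for p by measurable
    have A'': "?A' p \<in> sets borel" if "p \<in> J" for p
      using measurable_sets[OF m A'[OF that]] by simp
    have "emeasure (white_noise I n \<theta>) ?X = emeasure (PiM (Lam I) ?S) (?f -` ?X \<inter> space (PiM (Lam I) ?S))"
      unfolding white_noise_def by (intro emeasure_distr meas X)
    also have "?f -` ?X \<inter> space (PiM (Lam I) ?S) = prod_emb (Lam I) ?S J (Pi\<^sub>E J ?A')"
      using J(2) by (auto simp: prod_emb_def space_PiM PiE_iff subset_eq)
    also have "emeasure (PiM (Lam I) ?S) \<dots> = (\<Prod>p\<in>J. emeasure (?S p) (?A' p))"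
      using J A'' by (intro S.emeasure_PiM_emb) auto
    also have "\<dots> = (\<Prod>p\<in>J. emeasure (?N p) (A p))"
    proof (intro prod.cong refl)
      fix p assume p: "p \<in> J"
      show "emeasure (?S p) (?A' p) = emeasure (?N p) (A p)"
        unfolding affine[symmetric] using A'[OF p] by (subst emeasure_distr) auto
    qed
    also have "\<dots> = emeasure (PiM (Lam I) ?N) ?X"
      using J A by (intro N.emeasure_PiM_emb[symmetric]) auto
    finally show "emeasure (PiM (Lam I) ?N) ?X = emeasure (white_noise I n \<theta>) ?X" by simp
  qed simp
qed

lemma sets_white_noise [measurable_cong]:
  "sets (white_noise I n \<theta>) = sets (\<Pi>\<^sub>M p\<in>Lam I. borel)"
  by (simp add: white_noise_def)

lemma likelihood_measurable [measurable]:
  "likelihood I n \<theta> \<in> borel_measurable (\<Pi>\<^sub>M p\<in>Lam I. borel)"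
  unfolding likelihood_def[abs_def]
  by (intro borel_measurable_prod borel_measurable_divide
      measurable_compose[OF measurable_component_singleton]) auto

lemma density_likelihood:
  fixes I :: "nat \<Rightarrow> 'k set"
  assumes n: "n > 0" and fin: "finite {p\<in>Lam I. \<theta> p \<noteq> 0}"
  shows "density (white_noise I n (\<lambda>_. 0)) (likelihood I n \<theta>) = white_noise I n \<theta>"
proof -
  let ?s = "1 / sqrt (real n)"
  let ?Z = "\<lambda>p::nat \<times> 'k. density lborel (\<lambda>x. ennreal (normal_density 0 ?s x))"
  let ?N = "\<lambda>p. density lborel (\<lambda>x. ennreal (normal_density (\<theta> p) ?s x))"
  let ?r = "\<lambda>p x. normal_density (\<theta> p) ?s x / normal_density 0 ?s x"
  let ?S = "{p\<in>Lam I. \<theta> p \<noteq> 0}"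
  have s: "?s > 0" using n by simp
  interpret Z: product_prob_space ?Z "Lam I"
    by (intro product_prob_spaceI prob_space_normal_density s)
  interpret N: product_prob_space ?N "Lam I"
    by (intro product_prob_spaceI prob_space_normal_density s)
  have pos: "normal_density \<mu> ?s x > 0" for \<mu> x using s by (rule normal_density_pos)
  have setsZ: "sets (PiM K ?Z) = sets (PiM K (\<lambda>_. borel :: real measure))" for K
    by (intro sets_PiM_cong) auto
  have setsN: "sets (PiM K ?N) = sets (PiM K (\<lambda>_. borel :: real measure))" for K
    by (intro sets_PiM_cong) auto
  have W0: "white_noise I n (\<lambda>_. 0) = PiM (Lam I) ?Z" using white_noise_eq_PiM[OF n] .
  have W: "white_noise I n \<theta> = PiM (Lam I) ?N" using white_noise_eq_PiM[OF n] .
  have lm: "likelihood I n \<theta> \<in> borel_measurable (PiM (Lam I) ?Z)"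
    using likelihood_measurable by (simp cong: measurable_cong_sets add: setsZ)
  show ?thesis unfolding W0 W
  proof (rule measure_eqI_PiM_infinite[symmetric, where M = ?N and I = "Lam I"])
    show "sets (density (PiM (Lam I) ?Z) (\<lambda>x. ennreal (likelihood I n \<theta> x))) = sets (PiM (Lam I) ?N)"
      by (simp add: setsZ setsN)
    show "finite_measure (PiM (Lam I) ?N)" by unfold_locales
  next
    fix A J assume J: "finite J" "J \<subseteq> Lam I" and A: "\<And>p. p \<in> J \<Longrightarrow> A p \<in> sets (?N p)"
    have A': "A p \<in> sets borel" if "p \<in> J" for p using A[OF that] by simp
    let ?X = "prod_emb (Lam I) ?N J (Pi\<^sub>E J A)"
    define K where "K = J \<union> ?S"
    have K: "finite K" "K \<subseteq> Lam I" using J fin by (auto simp: K_def)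
    define A1 where "A1 = (\<lambda>p. if p \<in> J then A p else UNIV)"
    have A1[measurable]: "A1 p \<in> sets borel" for p using A' by (auto simp: A1_def)
    define g where "g = (\<lambda>p x. ennreal (?r p x) * indicator (A1 p) x)"
    have g: "g p \<in> borel_measurable borel" for p unfolding g_def by measurable
    have gm: "(\<lambda>y. g p (y p)) \<in> borel_measurable (PiM K ?Z)" if "p \<in> K" for p
      by (rule measurable_compose[of "\<lambda>y. y p" _ "?Z p"])
        (use that g in \<open>auto intro!: measurable_component_singleton\<close>)
    have X: "?X \<in> sets (PiM (Lam I) ?Z)"
      unfolding setsZ setsN[symmetric] using J A by (intro sets_PiM_I) auto
    have lik: "ennreal (likelihood I n \<theta> y) = (\<Prod>p\<in>K. ennreal (?r p (y p)))" for y
    proof -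
      have "likelihood I n \<theta> y = (\<Prod>p\<in>K. ?r p (y p))"
        unfolding likelihood_def
      proof (intro prod.mono_neutral_left K ballI)
        fix p assume "p \<in> K - ?S"
        then have "\<theta> p = 0" using K by auto
        then show "?r p (y p) = 1" using pos[of 0 "y p"] by simp
      qed (auto simp: K_def)
      then show ?thesis by (simp add: prod_ennreal)
    qed
    have ind: "indicator ?X y = (\<Prod>p\<in>K. indicator (A1 p) (y p) :: ennreal)"
      if y: "y \<in> space (PiM (Lam I) ?Z)" for y
    proof -
      have "y \<in> ?X \<longleftrightarrow> (\<forall>p\<in>K. y p \<in> A1 p)"
        using y J(2) K(2) by (auto simp: prod_emb_def space_PiM PiE_iff A1_def K_def)
      then show ?thesis using K(1) by (auto simp: indicator_def prod_zero_iff split: if_splits)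
    qed
    have "emeasure (density (PiM (Lam I) ?Z) (\<lambda>x. ennreal (likelihood I n \<theta> x))) ?X =
        (\<integral>\<^sup>+y. ennreal (likelihood I n \<theta> y) * indicator ?X y \<partial>PiM (Lam I) ?Z)"
      using lm X by (intro emeasure_density) auto
    also have "\<dots> = (\<integral>\<^sup>+y. (\<Prod>p\<in>K. g p (restrict y K p)) \<partial>PiM (Lam I) ?Z)"
      by (intro nn_integral_cong) (simp add: lik ind g_def prod.distrib)
    also have "\<dots> = (\<integral>\<^sup>+y. (\<Prod>p\<in>K. g p (y p)) \<partial>distr (PiM (Lam I) ?Z) (PiM K ?Z) (\<lambda>x. restrict x K))"
      using K by (subst nn_integral_distr) (auto intro!: measurable_restrict_subset
          borel_measurable_prod_ennreal gm)
    also have "distr (PiM (Lam I) ?Z) (PiM K ?Z) (\<lambda>x. restrict x K) = PiM K ?Z"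
      using K by (intro Z.distr_PiM_restrict_finite) auto
    also have "(\<integral>\<^sup>+y. (\<Prod>p\<in>K. g p (y p)) \<partial>PiM K ?Z) = (\<Prod>p\<in>K. integral\<^sup>N (?Z p) (g p))"
      using K g by (intro Z.product_nn_integral_prod) auto
    also have "\<dots> = (\<Prod>p\<in>K. emeasure (?N p) (A1 p))"
    proof (intro prod.cong refl)
      fix p
      have "integral\<^sup>N (?Z p) (g p) = (\<integral>\<^sup>+x. ennreal (normal_density 0 ?s x) * g p x \<partial>lborel)"
        using g[of p] by (intro nn_integral_density) auto
      also have "\<dots> = (\<integral>\<^sup>+x. ennreal (normal_density (\<theta> p) ?s x) * indicator (A1 p) x \<partial>lborel)"
      proof (intro nn_integral_cong)
        fix x
        have "ennreal (normal_density 0 ?s x) * ennreal (?r p x) = ennreal (normal_density (\<theta> p) ?s x)"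
          using pos[of 0 x] by (subst ennreal_mult[symmetric]) auto
        then show "ennreal (normal_density 0 ?s x) * g p x =
            ennreal (normal_density (\<theta> p) ?s x) * indicator (A1 p) x"
          by (simp add: g_def mult.assoc[symmetric])
      qed
      also have "\<dots> = emeasure (?N p) (A1 p)" by (simp add: emeasure_density)
      finally show "integral\<^sup>N (?Z p) (g p) = emeasure (?N p) (A1 p)" .
    qed
    also have "\<dots> = (\<Prod>p\<in>J. emeasure (?N p) (A p))"
    proof (intro prod.mono_neutral_cong_right K ballI)
      fix p assume "p \<in> K - J"
      then have "A1 p = space (?N p)" by (simp add: A1_def)
      then show "emeasure (?N p) (A1 p) = 1"
        by (metis prob_space.emeasure_space_1 prob_space_normal_density s)
    qed (auto simp: K_def A1_def)
    also have "\<dots> = emeasure (PiM (Lam I) ?N) ?X"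
      using J A by (intro N.emeasure_PiM_emb[symmetric]) auto
    finally show "emeasure (PiM (Lam I) ?N) ?X =
        emeasure (density (PiM (Lam I) ?Z) (\<lambda>x. ennreal (likelihood I n \<theta> x))) ?X" by simp
  qed simp
qed

lemma prob_space_white_noise:
  assumes "n > 0"
  shows "prob_space (white_noise I n \<theta>)"
  unfolding white_noise_eq_PiM[OF assms]
  by (intro prob_space_PiM prob_space_normal_density) (use assms in simp)

lemma likelihood_pos: "n > 0 \<Longrightarrow> 0 < likelihood I n \<theta> y"
  unfolding likelihood_def by (intro prod_pos divide_pos_pos normal_density_pos ballI) auto

lemma posterior_eq_sum:
  assumes "finite (set_pmf \<pi>)"
  shows "posterior I n \<pi> y B =
    (\<Sum>\<theta>\<in>set_pmf \<pi>. pmf \<pi> \<theta> * (indicator B \<theta> * likelihood I n \<theta> y)) /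
    (\<Sum>\<theta>\<in>set_pmf \<pi>. pmf \<pi> \<theta> * likelihood I n \<theta> y)"
  unfolding posterior_def by (simp add: integral_measure_pmf[OF assms])

text \<open>
  Joint law of parameter and observation, evaluated at \<open>B \<times> E\<close>: the left-hand side integrates the
  posterior probability of \<open>B\<close> over \<open>E\<close> with respect to the marginal law of the observation.
\<close>

lemma posterior_disintegration:
  fixes I :: "nat \<Rightarrow> 'k set"
  assumes n: "n > 0" and fin: "finite (set_pmf \<pi>)"
    and supp: "\<And>\<theta>. \<theta> \<in> set_pmf \<pi> \<Longrightarrow> finite {p\<in>Lam I. \<theta> p \<noteq> 0}"
    and E: "E \<in> sets (\<Pi>\<^sub>M p\<in>Lam I. borel)"
  shows "(\<Sum>\<theta>\<in>set_pmf \<pi>. pmf \<pi> \<theta> * (\<integral>y. indicator E y * posterior I n \<pi> y B \<partial>white_noise I n \<theta>)) =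
    (\<Sum>\<theta>\<in>set_pmf \<pi> \<inter> B. pmf \<pi> \<theta> * measure (white_noise I n \<theta>) E)"
proof -
  let ?l = "likelihood I n" and ?P0 = "white_noise I n (\<lambda>_. 0)" and ?post = "\<lambda>y. posterior I n \<pi> y B"
  let ?m = "\<lambda>y. \<Sum>\<theta>\<in>set_pmf \<pi>. pmf \<pi> \<theta> * ?l \<theta> y"
  have m_pos: "?m y > 0" for y
    using fin by (intro sum_pos mult_pos_pos likelihood_pos n set_pmf_not_empty) (auto simp: pmf_positive)
  have post: "?post y = (\<Sum>\<theta>\<in>set_pmf \<pi>. pmf \<pi> \<theta> * (indicator B \<theta> * ?l \<theta> y)) / ?m y" for y
    by (rule posterior_eq_sum[OF fin])
  have post_m: "?post y * ?m y = (\<Sum>\<theta>\<in>set_pmf \<pi>. pmf \<pi> \<theta> * (indicator B \<theta> * ?l \<theta> y))" for y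
    using m_pos[of y] by (simp add: post)
  have le: "(\<Sum>\<theta>\<in>set_pmf \<pi>. pmf \<pi> \<theta> * (indicator B \<theta> * ?l \<theta> y)) \<le> ?m y" for y
    by (intro sum_mono mult_left_mono) (auto simp: indicator_def likelihood_nonneg)
  have post_nonneg: "0 \<le> ?post y" for y
    unfolding post using m_pos[of y]
    by (intro divide_nonneg_pos sum_nonneg mult_nonneg_nonneg) (auto simp: likelihood_nonneg)
  have post_le: "?post y \<le> 1" for y
    unfolding post using m_pos[of y] le[of y] by simp
  have [measurable]: "E \<in> sets ?P0" using E by (simp add: sets_white_noise)
  have lm[measurable]: "?l \<theta> \<in> borel_measurable ?P0" for \<theta>
    using likelihood_measurable by (simp cong: measurable_cong_sets add: sets_white_noise)
  have pm[measurable]: "?post \<in> borel_measurable ?P0" unfolding post by measurable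
  have change: "(\<integral>y. f y \<partial>white_noise I n \<theta>) = (\<integral>y. ?l \<theta> y * f y \<partial>?P0)"
    if "\<theta> \<in> set_pmf \<pi>" and [measurable]: "f \<in> borel_measurable ?P0" for \<theta> and f :: "_ \<Rightarrow> real"
    unfolding density_likelihood[OF n supp[OF that(1)], symmetric]
    by (subst integral_density) (auto simp: likelihood_nonneg)
  have int_l: "integrable ?P0 (?l \<theta>)" if "\<theta> \<in> set_pmf \<pi>" for \<theta>
  proof -
    have "(\<integral>\<^sup>+y. ennreal (?l \<theta> y) \<partial>?P0) = emeasure (white_noise I n \<theta>) (space ?P0)"
      unfolding density_likelihood[OF n supp[OF that], symmetric]
      by (simp add: emeasure_density cong: nn_integral_cong)
    also have "\<dots> \<le> 1"
      by (rule prob_space.measure_le_1[OF prob_space_white_noise[OF n]])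
    finally show ?thesis
      by (intro integrableI_nonneg) (auto simp: likelihood_nonneg intro: le_less_trans)
  qed
  have int: "integrable ?P0 (\<lambda>y. ?l \<theta> y * (indicator E y * ?post y))" if "\<theta> \<in> set_pmf \<pi>" for \<theta>
  proof (rule Bochner_Integration.integrable_bound[OF int_l[OF that]])
    show "AE y in ?P0. norm (?l \<theta> y * (indicator E y * ?post y)) \<le> norm (?l \<theta> y)"
      using post_nonneg post_le
      by (intro AE_I2) (auto simp: abs_mult indicator_def likelihood_nonneg mult_left_le)
  qed measurable
  have int2: "integrable ?P0 (\<lambda>y. ?l \<theta> y * indicator E y)" if "\<theta> \<in> set_pmf \<pi>" for \<theta>
    by (intro integrable_real_mult_indicator int_l that) auto
  have "(\<Sum>\<theta>\<in>set_pmf \<pi>. pmf \<pi> \<theta> * (\<integral>y. indicator E y * ?post y \<partial>white_noise I n \<theta>)) =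
      (\<Sum>\<theta>\<in>set_pmf \<pi>. pmf \<pi> \<theta> * (\<integral>y. ?l \<theta> y * (indicator E y * ?post y) \<partial>?P0))"
    by (intro sum.cong refl) (subst change, auto)
  also have "\<dots> = (\<integral>y. (\<Sum>\<theta>\<in>set_pmf \<pi>. pmf \<pi> \<theta> * (?l \<theta> y * (indicator E y * ?post y))) \<partial>?P0)"
    using int by (subst Bochner_Integration.integral_sum) auto
  also have "\<dots> = (\<integral>y. indicator E y * (?post y * ?m y) \<partial>?P0)"
    by (intro Bochner_Integration.integral_cong refl) (simp add: sum_distrib_left mult_ac)
  also have "\<dots> = (\<integral>y. (\<Sum>\<theta>\<in>set_pmf \<pi>. pmf \<pi> \<theta> * indicator B \<theta> * (?l \<theta> y * indicator E y)) \<partial>?P0)"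
    unfolding post_m by (intro Bochner_Integration.integral_cong refl) (simp add: sum_distrib_left mult_ac)
  also have "\<dots> = (\<Sum>\<theta>\<in>set_pmf \<pi>. pmf \<pi> \<theta> * indicator B \<theta> * (\<integral>y. ?l \<theta> y * indicator E y \<partial>?P0))"
    using int2 by (subst Bochner_Integration.integral_sum) auto
  also have "\<dots> = (\<Sum>\<theta>\<in>set_pmf \<pi>. pmf \<pi> \<theta> * indicator B \<theta> * measure (white_noise I n \<theta>) E)"
  proof (intro sum.cong refl arg_cong2[where f = "(*)"])
    fix \<theta> assume \<theta>: "\<theta> \<in> set_pmf \<pi>"
    have "(\<integral>y. ?l \<theta> y * indicator E y \<partial>?P0) = (\<integral>y. indicator E y \<partial>white_noise I n \<theta>)"
      by (rule change[OF \<theta>, symmetric]) measurable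
    also have "\<dots> = measure (white_noise I n \<theta>) (E \<inter> space (white_noise I n \<theta>))" by simp
    also have "E \<inter> space (white_noise I n \<theta>) = E"
      using sets.sets_into_space[of E "white_noise I n \<theta>"] E by (auto simp: sets_white_noise)
    finally show "(\<integral>y. ?l \<theta> y * indicator E y \<partial>?P0) = measure (white_noise I n \<theta>) E" .
  qed
  also have "\<dots> = (\<Sum>\<theta>\<in>set_pmf \<pi> \<inter> B. pmf \<pi> \<theta> * measure (white_noise I n \<theta>) E)"
    using fin by (simp add: sum.inter_restrict indicator_def if_distrib if_distribR cong: if_cong)
      (auto intro!: sum.cong)
  finally show ?thesis .
qed

end

theory Submission
  imports Defs "HOL-Real_Asymp.Real_Asymp"
begin

text \<open>
  Everything follows from one calibration. The grid has step \<open>\<phi>\<^sub>n\<close> with \<open>n \<phi>\<^sub>n\<^sup>2 = \<phi>0\<^sup>2 log n\<close> and only \<open>O(n)\<close>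
  free coordinates. Displacing a coordinate by \<open>m\<close> grid steps therefore has a Gaussian cost of \<open>n\<close> to the
  power \<open>-c m\<^sup>2\<close>, and a sum over all displacements of all coordinates stays bounded once \<open>c\<close> is large enough.

  Distances in the two losses are compared level by level. If a grid point is within a few \<open>\<phi>\<^sub>n\<close> of the truth at all
  coordinates up to the cut-off level and vanishes beyond it, then its sup-type distance to the truth is of the
  order of the rate, since the weights \<open>2\<^bsup>j/2\<^esup>\<close> grow geometrically (\<open>ell_inf_le_rate\<close>). In the opposite direction, a
  single extreme coefficient at a suitable level separates two parameters by the worst rate at a quadratic distance of
  order \<open>\<phi>\<^sub>n\<close>, so the modulus never exceeds a multiple of one grid step (\<open>modulus_le_phi\<close>).

  For the partition, \<open>d1 = 0\<close> means that the two grid points agree coordinate by coordinate, except that the two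
  neighbours of a coordinate of the truth lying well inside a grid cell are identified. The map into the ball
  replaces the coordinates of a grid point that are not identified with those of \<open>\<theta>s\<close> by the coordinates of
  \<open>\<theta>s\<close>. It is injective on every class, because the coordinates that it overwrites are constant on the class, and
  its image lies in the class of \<open>\<theta>s\<close>, all of whose members are as close to the truth as the first comparison
  requires. A block other than the ball is determined by the integer vector of the displacements undone, which is not
  zero. Half of the exponent \<open>K0 n u\<^sup>2\<close> makes the sum over these vectors converge (\<open>sum_blocks_le\<close>); the other half,
  which is at least a multiple of \<open>n \<phi>\<^sub>n\<^sup>2\<close>, dominates the square of the modulus.

  For the posterior, moving one coordinate of all grid points from a wrong value to that of \<open>\<theta>s\<close> multiplies all
  likelihoods by the same likelihood ratio, which bounds the posterior probability of the wrong value. The expectation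
  of the square root of that ratio is the Hellinger-type bound \<open>expected_post_coordinate_le\<close>. At fine levels,
  where the truth is much smaller than \<open>\<phi>\<^sub>n\<close>, its exponent is nearly \<open>\<phi>0\<^sup>2 m\<^sup>2 / 8\<close>; this exceeds 1 precisely because
  \<open>\<phi>0 > 2 sqrt 2\<close>, and so survives the union bound over \<open>O(n)\<close> coordinates. At coarse levels the truth may be
  halfway between grid points, but there displacements of up to three steps are harmless.
\<close>


section \<open>The scales of the problem\<close>

lemma n_div_ln_gt_1:
  fixes n :: nat
  assumes "2 \<le> n"
  shows "1 < real n / ln (real n)"
proof -
  have "0 < ln (real n)" using assms by simp
  moreover have "ln (real n) < real n"
    using ln_le_minus_one[of "real n"] assms by simp
  ultimately show ?thesis by simp
qed

lemma phi_eq_powr: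
  assumes "2 \<le> n"
  shows "phi \<phi>0 n = \<phi>0 * (real n / ln (real n)) powr (- 1 / 2)"
proof -
  have pos: "0 < real n / ln (real n)" using n_div_ln_gt_1[OF assms] by simp
  have "sqrt (ln (real n) / real n) = sqrt (inverse (real n / ln (real n)))" by simp
  also have "\<dots> = inverse (sqrt (real n / ln (real n)))" by (rule real_sqrt_inverse)
  also have "\<dots> = (real n / ln (real n)) powr (- 1 / 2)"
    using pos by (simp add: powr_half_sqrt powr_minus)
  finally show ?thesis by (simp add: phi_def)
qed

lemma phi_pos: "2 \<le> n \<Longrightarrow> 0 < \<phi>0 \<Longrightarrow> 0 < phi \<phi>0 n"
  using n_div_ln_gt_1[of n] by (simp add: phi_eq_powr)

lemma n_phi_square:
  assumes "2 \<le> n"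
  shows "real n * (phi \<phi>0 n)\<^sup>2 = \<phi>0\<^sup>2 * ln (real n)"
  using assms by (simp add: phi_def power_mult_distrib)

lemma phi_tendsto_0: "(\<lambda>n. phi \<phi>0 n) \<longlonglongrightarrow> 0"
  unfolding phi_def by real_asymp

lemma rate_pos: "2 \<le> n \<Longrightarrow> 0 < rate \<beta> n"
  using n_div_ln_gt_1[of n] by (simp add: rate_def)

lemma rate_antimono:
  assumes "2 \<le> n" "0 < \<beta>1" "\<beta>1 \<le> \<beta>"
  shows "rate \<beta> n \<le> rate \<beta>1 n"
proof -
  have "- \<beta> / (2 * \<beta> + 1) \<le> - \<beta>1 / (2 * \<beta>1 + 1)"
    using assms by (simp add: field_simps)
  then show ?thesis unfolding rate_def using n_div_ln_gt_1[OF assms(1)] by (intro powr_mono) auto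
qed

lemma rate_lower:
  assumes "2 \<le> n" "0 < \<beta>"
  shows "(real n / ln (real n)) powr (- 1 / 2) \<le> rate \<beta> n"
proof -
  have "- 1 / 2 \<le> - \<beta> / (2 * \<beta> + 1)" using assms by (simp add: field_simps)
  then show ?thesis unfolding rate_def using n_div_ln_gt_1[OF assms(1)] by (intro powr_mono) auto
qed

lemma rate_tendsto_0:
  assumes "0 < \<beta>"
  shows "(\<lambda>n. rate \<beta> n) \<longlonglongrightarrow> 0"
proof -
  have "filterlim (\<lambda>n::nat. real n / ln (real n)) at_top sequentially" by real_asymp
  moreover have "- \<beta> / (2 * \<beta> + 1) < 0" using assms by (simp add: field_simps)
  ultimately show ?thesis unfolding rate_def by (rule tendsto_neg_powr[rotated])
qed

lemma Jmax_bounds: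
  assumes "1 \<le> n"
  shows "n < 2 ^ Jmax n" "2 ^ Jmax n \<le> 2 * n"
proof -
  obtain i where i: "(2::nat) ^ i \<le> n" "n < 2 ^ (i + 1)"
    using ex_power_ivl1[of 2 n] assms by auto
  have "\<exists>!J. n < 2 ^ J \<and> 2 ^ J \<le> 2 * n"
  proof (rule ex1I[of _ "i + 1"])
    fix J assume J: "n < 2 ^ J \<and> 2 ^ J \<le> 2 * n"
    have "(2::nat) ^ J < 2 ^ (i + 2)" using J i by simp
    then have "J < i + 2" by (rule power_less_imp_less_exp[rotated]) simp
    moreover have "(2::nat) ^ i < 2 ^ J" using J i by linarith
    then have "i < J" by (rule power_less_imp_less_exp[rotated]) simp
    ultimately show "J = i + 1" by simp
  qed (use i in simp)
  then have "n < 2 ^ Jmax n \<and> 2 ^ Jmax n \<le> 2 * n"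
    unfolding Jmax_def by (rule theI')
  then show "n < 2 ^ Jmax n" "2 ^ Jmax n \<le> 2 * n" by auto
qed

lemma summable_restricted:
  fixes g :: "nat \<Rightarrow> real"
  assumes "summable g" "\<And>j. 0 \<le> g j"
  shows "summable (\<lambda>j. if P j then g j else 0)"
  by (rule summable_comparison_test[OF _ assms(1)]) (use assms(2) in \<open>auto intro!: exI[of _ 0]\<close>)

lemma geometric_tail_sums:
  fixes r :: real
  assumes "\<bar>r\<bar> < 1"
  shows "(\<lambda>j. if j < K then 0 else r ^ j) sums (r ^ K / (1 - r))"
proof -
  have "(\<lambda>i. r ^ K * r ^ i) sums (r ^ K * (1 / (1 - r)))"
    by (intro sums_mult geometric_sums) (use assms in simp)
  then have "(\<lambda>i. if i + K < K then 0 else r ^ (i + K)) sums (r ^ K / (1 - r))"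
    by (simp add: power_add mult_ac)
  from this[unfolded sums_iff_shift[of "\<lambda>j. if j < K then 0 else r ^ j"]]
  show ?thesis by simp
qed

text \<open>
  A geometric sum with ratio \<open>sqrt 2\<close>, dominated by its last term; 4 is an upper bound for
  \<open>sqrt 2 / (sqrt 2 - 1)\<close>.
\<close>

lemma sum_sqrt2_powers_le:
  "(\<Sum>j<nat (J + 1). 2 powr (real j / 2)) \<le> 4 * sqrt (2 powr real_of_int J)"
proof (cases "0 \<le> J")
  case True
  define m where "m = nat J"
  have J: "J = int m" using True by (simp add: m_def)
  have sq: "2 powr (real j / 2) = sqrt 2 ^ j" for j
  proof -
    have "2 powr (real j / 2) = (2 powr (1/2)) powr real j" by (simp add: powr_powr)
    then show ?thesis by (simp add: powr_half_sqrt powr_realpow)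
  qed
  have s: "4/3 < sqrt (2::real)" by (rule real_less_rsqrt) (simp add: power2_eq_square)
  have "(\<Sum>j<nat (J + 1). 2 powr (real j / 2)) = (\<Sum>j<Suc m. sqrt 2 ^ j)"
    unfolding sq J by (simp add: nat_add_distrib)
  also have "\<dots> = (sqrt 2 ^ Suc m - 1) / (sqrt 2 - 1)"
    by (rule geometric_sum) (use s in simp)
  also have "\<dots> \<le> 4 * sqrt 2 ^ m"
  proof -
    have "sqrt 2 ^ m * sqrt 2 \<le> sqrt 2 ^ m * (4 * (sqrt 2 - 1))"
      using s by (intro mult_left_mono) auto
    moreover have "sqrt 2 ^ Suc m = sqrt 2 ^ m * sqrt 2" by simp
    moreover have "sqrt 2 ^ m * (4 * (sqrt 2 - 1)) = 4 * sqrt 2 ^ m * (sqrt 2 - 1)" by simp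
    ultimately have "sqrt 2 ^ Suc m - 1 \<le> 4 * sqrt 2 ^ m * (sqrt 2 - 1)" by linarith
    then show ?thesis using s by (simp add: divide_le_eq)
  qed
  also have "sqrt 2 ^ m = sqrt (2 powr real_of_int J)"
    by (simp add: J powr_realpow real_sqrt_power)
  finally show ?thesis by simp
qed simp

text \<open>
  The cut-off balances the two terms of the error: \<open>2\<^bsup>J/2\<^esup> \<phi>\<^sub>n\<close> is at most of the order of the rate.
\<close>

lemma cutoff_scale:
  assumes n: "2 \<le> n" and "0 < \<beta>" "0 \<le> \<phi>0"
    and J: "2 powr real_of_int J \<le> b0 * (real n / ln (real n)) powr (1 / (2 * \<beta> + 1))"
  shows "sqrt (2 powr real_of_int J) * phi \<phi>0 n \<le> \<phi>0 * sqrt b0 * rate \<beta> n"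
proof -
  let ?X = "real n / ln (real n)"
  have X: "1 < ?X" by (rule n_div_ln_gt_1[OF n])
  have "sqrt (2 powr real_of_int J) \<le> sqrt (b0 * ?X powr (1 / (2 * \<beta> + 1)))"
    using J by simp
  also have "\<dots> = sqrt b0 * ?X powr (1 / (2 * \<beta> + 1) / 2)"
    using X by (simp add: real_sqrt_mult powr_half_sqrt[symmetric] powr_powr del: powr_half_sqrt)
  finally have "sqrt (2 powr real_of_int J) * phi \<phi>0 n
      \<le> sqrt b0 * ?X powr (1 / (2 * \<beta> + 1) / 2) * (\<phi>0 * ?X powr (- 1 / 2))"
    unfolding phi_eq_powr[OF n] using assms by (intro mult_right_mono) auto
  also have "\<dots> = \<phi>0 * sqrt b0 * ?X powr (1 / (2 * \<beta> + 1) / 2 + (- 1 / 2))"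
    by (simp only: powr_add) simp
  also have "1 / (2 * \<beta> + 1) / 2 + (- 1 / 2) = - \<beta> / (2 * \<beta> + 1)"
    using assms by (simp add: field_simps)
  finally show ?thesis by (simp add: rate_def)
qed

section \<open>Levelwise bounds\<close>

lemma two_powr_minus_less_1: "0 < \<beta> \<Longrightarrow> 2 powr - \<beta> < (1::real)"
  using powr_less_mono[of "- \<beta>" 0 2] by simp

locale dyadic_index =
  fixes I :: "nat \<Rightarrow> 'k set" and c1 c2 :: real
  assumes finite_level [simp]: "finite (I j)"
    and c1_pos: "0 < c1" and c2_pos: "0 < c2"
    and card_lower: "c1 * 2 ^ j \<le> real (card (I j))"
    and card_upper: "real (card (I j)) \<le> c2 * 2 ^ j"
begin

lemma level_nonempty [simp]: "I j \<noteq> {}"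
proof
  assume "I j = {}"
  then have "c1 * 2 ^ j \<le> 0" using card_lower[of j] by simp
  moreover have "0 < c1 * 2 ^ j" using c1_pos by simp
  ultimately show False by simp
qed

lemma Max_level_le: "(MAX k\<in>I j. h k) \<le> (c::real)" if "\<And>k. k \<in> I j \<Longrightarrow> h k \<le> c"
  using that by (intro Max.boundedI) auto

lemma Max_level_ge: "h k \<le> (MAX k\<in>I j. h k :: real)" if "k \<in> I j"
  using that by (intro Max_ge) auto

lemma Max_level_nonneg: "0 \<le> (MAX k\<in>I j. \<bar>h k\<bar> :: real)"
proof -
  obtain k where "k \<in> I j" using level_nonempty[of j] by blast
  then show ?thesis by (intro order_trans[OF abs_ge_zero Max_level_ge])
qed

lemma hoelder_powr_power: "2 powr (real j / 2) * (L * 2 powr (- (real j * (\<beta> + 1/2)))) = L * (2 powr - \<beta>) ^ j"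
proof -
  have "2 powr (real j / 2) * 2 powr (- (real j * (\<beta> + 1/2))) = (2::real) powr (- \<beta> * real j)"
    unfolding powr_add[symmetric] by (simp add: algebra_simps)
  also have "\<dots> = (2 powr - \<beta>) ^ j"
    unfolding powr_powr[symmetric] by (rule powr_realpow) simp
  finally show ?thesis by (simp add: mult.left_commute)
qed

lemma hoelder_coeff_le:
  assumes "\<theta> \<in> hoelder I \<beta> L" "k \<in> I j"
  shows "\<bar>\<theta> (j, k)\<bar> \<le> L * 2 powr (- (real j * (\<beta> + 1/2)))"
  using assms by (auto simp: hoelder_def Lam_def)

lemma hoelder_level_le:
  assumes "\<theta> \<in> hoelder I \<beta> L"
  shows "2 powr (real j / 2) * (MAX k\<in>I j. \<bar>\<theta> (j, k)\<bar>) \<le> L * (2 powr - \<beta>) ^ j"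
  unfolding hoelder_powr_power[symmetric]
  using hoelder_coeff_le[OF assms] by (intro mult_left_mono Max_level_le) auto

lemma hoelder_levels_summable:
  assumes "\<theta> \<in> hoelder I \<beta> L" "0 < \<beta>"
  shows "summable (\<lambda>j. 2 powr (real j / 2) * (MAX k\<in>I j. \<bar>\<theta> (j, k)\<bar>))"
proof (rule summable_comparison_test)
  show "summable (\<lambda>j. L * (2 powr - \<beta>) ^ j)"
    using assms(2) by (intro summable_mult summable_geometric) (simp add: two_powr_minus_less_1)
qed (use hoelder_level_le[OF assms(1)] in \<open>auto simp: Max_level_nonneg abs_mult intro!: exI[of _ 0]\<close>)

lemma hoelder_antimono:
  assumes "\<beta>1 \<le> \<beta>" "0 \<le> L"
  shows "hoelder I \<beta> L \<subseteq> hoelder I \<beta>1 L"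
proof -
  have "L * 2 powr (- (real j * (\<beta> + 1/2))) \<le> L * 2 powr (- (real j * (\<beta>1 + 1/2)))" for j
    using assms by (intro mult_left_mono powr_mono) (auto intro!: mult_left_mono)
  then show ?thesis unfolding hoelder_def by (fastforce intro: order_trans)
qed

lemma hoelder_union_eq:
  assumes "\<beta>1 \<le> \<beta>2" "0 \<le> L"
  shows "hoelder_union I \<beta>1 \<beta>2 L = hoelder I \<beta>1 L"
  unfolding hoelder_union_def using hoelder_antimono assms by fastforce

lemma hoelder_coeff_le_radius:
  assumes "\<theta> \<in> hoelder I \<beta> L" "0 \<le> \<beta>" "0 \<le> L" "p \<in> Lam I"
  shows "\<bar>\<theta> p\<bar> \<le> L"
proof -
  obtain j k where p: "p = (j, k)" "k \<in> I j" using assms(4) by (auto simp: Lam_def)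
  have "\<bar>\<theta> p\<bar> \<le> L * 2 powr (- (real j * (\<beta> + 1/2)))"
    using hoelder_coeff_le assms p by blast
  also have "\<dots> \<le> L * 2 powr 0"
    using assms by (intro mult_left_mono powr_mono) (auto intro!: mult_nonneg_nonneg)
  finally show ?thesis by simp
qed

lemma ell_inf_commute: "ell_inf I \<theta> \<theta>' = ell_inf I \<theta>' \<theta>"
  by (simp add: ell_inf_def abs_minus_commute)

lemma ell_inf_le_suminf:
  assumes le: "\<And>j k. k \<in> I j \<Longrightarrow> 2 powr (real j / 2) * \<bar>\<theta> (j, k) - \<theta>' (j, k)\<bar> \<le> g j"
    and g: "summable g"
  shows "ell_inf I \<theta> \<theta>' \<le> suminf g"
    and "summable (\<lambda>j. 2 powr (real j / 2) * (MAX k\<in>I j. \<bar>\<theta> (j, k) - \<theta>' (j, k)\<bar>))"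
proof -
  have b: "2 powr (real j / 2) * (MAX k\<in>I j. \<bar>\<theta> (j, k) - \<theta>' (j, k)\<bar>) \<le> g j" for j
  proof -
    have "(MAX k\<in>I j. \<bar>\<theta> (j, k) - \<theta>' (j, k)\<bar>) \<le> g j / 2 powr (real j / 2)"
      using le[of _ j] by (intro Max_level_le) (simp add: field_simps)
    then show ?thesis by (simp add: field_simps)
  qed
  show s: "summable (\<lambda>j. 2 powr (real j / 2) * (MAX k\<in>I j. \<bar>\<theta> (j, k) - \<theta>' (j, k)\<bar>))"
    by (rule summable_comparison_test[OF _ g])
      (use b in \<open>auto simp: Max_level_nonneg abs_mult intro!: exI[of _ 0]\<close>)
  show "ell_inf I \<theta> \<theta>' \<le> suminf g"
    unfolding ell_inf_def using b by (intro suminf_le s g) auto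
qed

lemma ell_inf_ge_coeff:
  assumes "\<theta> \<in> hoelder I \<beta> L" "\<theta>' \<in> hoelder I \<beta> L" "0 < \<beta>" "k \<in> I j"
  shows "2 powr (real j / 2) * \<bar>\<theta> (j, k) - \<theta>' (j, k)\<bar> \<le> ell_inf I \<theta> \<theta>'"
proof -
  let ?t = "\<lambda>j. 2 powr (real j / 2) * (MAX k\<in>I j. \<bar>\<theta> (j, k) - \<theta>' (j, k)\<bar>)"
  have "summable ?t"
  proof (rule ell_inf_le_suminf)
    show "summable (\<lambda>j. 2 * L * (2 powr - \<beta>) ^ j)"
      using assms(3) by (intro summable_mult summable_geometric) (simp add: two_powr_minus_less_1)
  next
    fix j k assume k: "k \<in> I j"
    have "\<bar>\<theta> (j, k) - \<theta>' (j, k)\<bar> \<le> 2 * (L * 2 powr (- (real j * (\<beta> + 1/2))))"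
      using hoelder_coeff_le[OF assms(1) k] hoelder_coeff_le[OF assms(2) k] by simp
    then have "2 powr (real j / 2) * \<bar>\<theta> (j, k) - \<theta>' (j, k)\<bar>
        \<le> 2 powr (real j / 2) * (2 * (L * 2 powr (- (real j * (\<beta> + 1/2)))))"
      by (intro mult_left_mono) auto
    also have "\<dots> = 2 * L * (2 powr - \<beta>) ^ j"
      unfolding mult.assoc hoelder_powr_power[symmetric] by (simp only: mult_ac)
    finally show "2 powr (real j / 2) * \<bar>\<theta> (j, k) - \<theta>' (j, k)\<bar> \<le> 2 * L * (2 powr - \<beta>) ^ j" .
  qed
  then have "(\<Sum>i\<in>{j}. ?t i) \<le> suminf ?t"
    by (intro sum_le_suminf) (auto simp: Max_level_nonneg)
  then have "?t j \<le> ell_inf I \<theta> \<theta>'" by (simp add: ell_inf_def)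
  moreover have "2 powr (real j / 2) * \<bar>\<theta> (j, k) - \<theta>' (j, k)\<bar> \<le> ?t j"
    using assms(4) by (intro mult_left_mono Max_level_ge) auto
  ultimately show ?thesis by linarith
qed

text \<open>
  A distance of order \<open>\<phi>\<^sub>n\<close> at every coarse coordinate costs only \<open>\<epsilon>\<^sub>n(\<beta>)\<close> in total, since the levels up to
  the cut-off contribute a geometric sum dominated by its last term \<open>2\<^bsup>J/2\<^esup> \<phi>\<^sub>n\<close>; beyond the
  cut-off only the tail of the truth matters.
\<close>

lemma ell_inf_le_rate:
  assumes n: "2 \<le> n" and \<beta>: "0 < \<beta>" and \<theta>0: "\<theta>0 \<in> hoelder I \<beta> L" and pos: "0 \<le> \<phi>0" "0 \<le> c"
    and J: "2 powr real_of_int J \<le> b0 * (real n / ln (real n)) powr (1 / (2 * \<beta> + 1))"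
    and tail: "(\<Sum>j. if int j > J then 2 powr (real j / 2) * (MAX k\<in>I j. \<bar>\<theta>0 (j, k)\<bar>) else 0) \<le> rate \<beta> n"
    and coarse: "\<And>j k. k \<in> I j \<Longrightarrow> int j \<le> J \<Longrightarrow> \<bar>\<theta> (j, k) - \<theta>0 (j, k)\<bar> \<le> c * phi \<phi>0 n"
    and fine: "\<And>j k. k \<in> I j \<Longrightarrow> int j > J \<Longrightarrow> \<theta> (j, k) = 0"
  shows "ell_inf I \<theta> \<theta>0 \<le> (4 * c * \<phi>0 * sqrt b0 + 1) * rate \<beta> n"
proof -
  let ?t = "\<lambda>j. 2 powr (real j / 2) * (MAX k\<in>I j. \<bar>\<theta>0 (j, k)\<bar>)"
  let ?a = "\<lambda>j. if j < nat (J + 1) then 2 powr (real j / 2) * (c * phi \<phi>0 n) else 0"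
  let ?b = "\<lambda>j. if int j > J then ?t j else 0"
  have sum_a: "?a sums (\<Sum>j<nat (J + 1). 2 powr (real j / 2) * (c * phi \<phi>0 n))"
    using sums_If_finite_set[of "{..<nat (J + 1)}" "\<lambda>j. 2 powr (real j / 2) * (c * phi \<phi>0 n)"] by simp
  have sum_b: "summable ?b"
    using hoelder_levels_summable[OF \<theta>0 \<beta>] by (rule summable_restricted) (simp add: Max_level_nonneg)
  have "ell_inf I \<theta> \<theta>0 \<le> (\<Sum>j. ?a j + ?b j)"
  proof (rule ell_inf_le_suminf)
    fix j k assume k: "k \<in> I j"
    show "2 powr (real j / 2) * \<bar>\<theta> (j, k) - \<theta>0 (j, k)\<bar> \<le> ?a j + ?b j"
    proof (cases "int j \<le> J")
      case True
      then show ?thesis using coarse[OF k True] by auto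
    next
      case False
      then show ?thesis using fine[OF k] Max_level_ge[OF k, of "\<lambda>k. \<bar>\<theta>0 (j, k)\<bar>"] by auto
    qed
  qed (intro summable_add sums_summable[OF sum_a] sum_b)
  also have "\<dots> = suminf ?a + suminf ?b"
    by (rule suminf_add[OF sums_summable[OF sum_a] sum_b, symmetric])
  also have "suminf ?a = (\<Sum>j<nat (J + 1). 2 powr (real j / 2)) * (c * phi \<phi>0 n)"
    using sum_a by (simp add: sums_iff sum_distrib_right)
  also have "\<dots> \<le> 4 * sqrt (2 powr real_of_int J) * (c * phi \<phi>0 n)"
    using pos n by (intro mult_right_mono sum_sqrt2_powers_le) (auto simp: phi_def)
  also have "\<dots> = 4 * c * (sqrt (2 powr real_of_int J) * phi \<phi>0 n)" by simp
  also have "\<dots> \<le> 4 * c * (\<phi>0 * sqrt b0 * rate \<beta> n)"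
    using pos by (intro mult_left_mono cutoff_scale n \<beta> J) auto
  finally show ?thesis using tail by (simp add: algebra_simps)
qed

text \<open>
  The cut-off is the level at which \<open>2\<^sup>j\<close> reaches \<open>b0 (n / log n)\<^bsup>1/(2\<beta>+1)\<^esup>\<close>. A large \<open>b0\<close> makes both the
  coefficients and the tail beyond it as small as needed, uniformly in \<open>\<beta> \<ge> \<beta>1\<close>.
\<close>

lemma tail_cutoff_exists:
  assumes pos: "0 < \<phi>0" "0 < \<beta>1" "0 < L"
  shows "\<exists>b0>0. \<exists>J. tail_cutoff I \<phi>0 \<beta>1 \<beta>2 L b0 J"
proof -
  define r where "r = 2 powr - \<beta>1"
  have r: "0 < r" "r < 1" using pos by (auto simp: r_def two_powr_minus_less_1)
  define b0 where "b0 = 1 + (4 * L / \<phi>0)\<^sup>2 + (L / (1 - r)) powr (1 / \<beta>1)"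
  have b01: "1 \<le> b0" by (simp add: b0_def)
  have b0_half: "4 * L / \<phi>0 \<le> b0 powr (1/2)"
  proof -
    have "4 * L / \<phi>0 = sqrt ((4 * L / \<phi>0)\<^sup>2)" using pos by simp
    also have "\<dots> \<le> sqrt b0" unfolding b0_def by (intro real_sqrt_le_mono) simp
    finally show ?thesis using b01 by (simp add: powr_half_sqrt)
  qed
  have b0_beta: "L / (1 - r) \<le> b0 powr \<beta>1"
  proof -
    have "L / (1 - r) = ((L / (1 - r)) powr (1 / \<beta>1)) powr \<beta>1"
      using pos r by (simp add: powr_powr)
    also have "\<dots> \<le> b0 powr \<beta>1" unfolding b0_def using pos by (intro powr_mono2) auto
    finally show ?thesis .
  qed
  let ?y = "\<lambda>n \<beta>. b0 * (real n / ln (real n)) powr (1 / (2 * \<beta> + 1))"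
  define J where "J = (\<lambda>n \<beta>. \<lfloor>log 2 (?y n \<beta>)\<rfloor>)"
  have "tail_cutoff I \<phi>0 \<beta>1 \<beta>2 L b0 J"
    unfolding tail_cutoff_def
  proof (intro allI impI ballI)
    fix n :: nat and \<beta> assume n: "2 \<le> n" and "\<beta> \<in> {\<beta>1..\<beta>2}"
    then have \<beta>: "\<beta>1 \<le> \<beta>" "0 < \<beta>" using pos by auto
    let ?X = "real n / ln (real n)" and ?Y = "?y n \<beta>"
    have X: "1 < ?X" by (rule n_div_ln_gt_1[OF n])
    have "1 \<le> ?X powr (1 / (2 * \<beta> + 1))" using X \<beta> by (intro ge_one_powr_ge_zero) auto
    then have Y: "1 \<le> ?Y" using b01 mult_mono[of 1 b0 1 "?X powr (1 / (2 * \<beta> + 1))"] by simp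
    have J0: "0 \<le> J n \<beta>" unfolding J_def using Y by (simp add: zero_le_floor)
    have beyond: "?Y \<le> 2 powr real j" if "J n \<beta> < int j" for j
    proof -
      have "log 2 ?Y < real j" using that unfolding J_def by (simp add: floor_less_iff)
      then have "2 powr log 2 ?Y \<le> 2 powr real j" by (intro powr_mono) auto
      then show ?thesis using Y by simp
    qed
    have "2 powr real_of_int (J n \<beta>) \<le> 2 powr log 2 ?Y"
      unfolding J_def by (intro powr_mono) auto
    then have first: "2 powr real_of_int (J n \<beta>) \<le> ?Y" using Y by simp
    have coeff: "L * 2 powr (- (real j * (\<beta> + 1/2))) \<le> phi \<phi>0 n / 4" if "J n \<beta> < int j" for j
    proof -
      have "2 powr (- (real j * (\<beta> + 1/2))) = (2 powr real j) powr - (\<beta> + 1/2)"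
        unfolding powr_powr by (simp add: algebra_simps)
      also have "\<dots> \<le> ?Y powr - (\<beta> + 1/2)"
        using beyond[OF that] Y \<beta> by (intro powr_mono2') auto
      also have "\<dots> = b0 powr - (\<beta> + 1/2) * ?X powr (1 / (2 * \<beta> + 1) * - (\<beta> + 1/2))"
        using b01 X by (simp only: powr_mult powr_powr)
      also have "1 / (2 * \<beta> + 1) * - (\<beta> + 1/2) = - 1 / 2" using \<beta> by (simp add: field_simps)
      also have "b0 powr - (\<beta> + 1/2) * ?X powr (- 1 / 2) \<le> \<phi>0 / (4 * L) * ?X powr (- 1 / 2)"
      proof (intro mult_right_mono)
        have "b0 powr - (\<beta> + 1/2) \<le> b0 powr - (1/2)" using b01 \<beta> by (intro powr_mono) auto
        also have "\<dots> \<le> \<phi>0 / (4 * L)"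
          using b0_half b01 pos by (simp add: powr_minus field_simps)
        finally show "b0 powr - (\<beta> + 1/2) \<le> \<phi>0 / (4 * L)" .
      qed simp
      finally have "2 powr (- (real j * (\<beta> + 1/2))) \<le> \<phi>0 / (4 * L) * ?X powr (- 1 / 2)" .
      then have "L * 2 powr (- (real j * (\<beta> + 1/2))) \<le> L * (\<phi>0 / (4 * L) * ?X powr (- 1 / 2))"
        using pos by (intro mult_left_mono) auto
      then show ?thesis using pos by (simp add: phi_eq_powr[OF n])
    qed
    have tail: "(\<Sum>j. if int j > J n \<beta> then 2 powr (real j / 2) * (MAX k\<in>I j. \<bar>\<theta> (j, k)\<bar>) else 0) \<le> rate \<beta> n"
      if \<theta>: "\<theta> \<in> hoelder I \<beta> L" for \<theta>
    proof -
      define K where "K = nat (J n \<beta> + 1)"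
      have K: "int K = J n \<beta> + 1" using J0 by (simp add: K_def)
      let ?q = "2 powr - \<beta>"
      have q: "0 < ?q" "?q < 1" "?q \<le> r" using \<beta> by (auto simp: r_def two_powr_minus_less_1)
      have sums: "(\<lambda>j. L * (if j < K then 0 else ?q ^ j)) sums (L * (?q ^ K / (1 - ?q)))"
        using q by (intro sums_mult geometric_tail_sums) simp
      have "(\<Sum>j. if int j > J n \<beta> then 2 powr (real j / 2) * (MAX k\<in>I j. \<bar>\<theta> (j, k)\<bar>) else 0)
          \<le> (\<Sum>j. L * (if j < K then 0 else ?q ^ j))"
      proof (intro suminf_le)
        show "(if int j > J n \<beta> then 2 powr (real j / 2) * (MAX k\<in>I j. \<bar>\<theta> (j, k)\<bar>) else 0)
            \<le> L * (if j < K then 0 else ?q ^ j)" for j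
          using hoelder_level_le[OF \<theta>, of j] K pos by auto
        show "summable (\<lambda>j. if int j > J n \<beta> then 2 powr (real j / 2) * (MAX k\<in>I j. \<bar>\<theta> (j, k)\<bar>) else 0)"
          using hoelder_levels_summable[OF \<theta> \<beta>(2)]
          by (rule summable_restricted) (simp add: Max_level_nonneg)
      qed (rule sums_summable[OF sums])
      also have "\<dots> = L * (?q ^ K / (1 - ?q))" using sums by (simp add: sums_iff)
      also have "\<dots> \<le> L * (?Y powr - \<beta> / (1 - r))"
      proof (intro mult_left_mono frac_le)
        have "?q ^ K = (2 powr real K) powr - \<beta>"
          by (simp add: powr_realpow[symmetric] powr_powr mult.commute)
        also have "\<dots> \<le> ?Y powr - \<beta>" using beyond[of K] K Y \<beta> by (intro powr_mono2') auto
        finally show "?q ^ K \<le> ?Y powr - \<beta>" .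
      qed (use q r pos in auto)
      also have "?Y powr - \<beta> = b0 powr - \<beta> * ?X powr (1 / (2 * \<beta> + 1) * - \<beta>)"
        using b01 X by (simp only: powr_mult powr_powr)
      also have "?X powr (1 / (2 * \<beta> + 1) * - \<beta>) = rate \<beta> n" by (simp add: rate_def)
      also have "L * (b0 powr - \<beta> * rate \<beta> n / (1 - r)) = (L / (1 - r) * b0 powr - \<beta>) * rate \<beta> n"
        by simp
      also have "\<dots> \<le> (b0 powr \<beta> * b0 powr - \<beta>) * rate \<beta> n"
      proof (intro mult_right_mono order_trans[OF b0_beta])
        show "b0 powr \<beta>1 \<le> b0 powr \<beta>" using b01 \<beta> by (intro powr_mono) auto
      qed (use rate_pos[OF n, of \<beta>] in auto)
      also have "\<dots> = rate \<beta> n" using b01 by (simp add: powr_add[symmetric])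
      finally show ?thesis .
    qed
    show "2 powr real_of_int (J n \<beta>) \<le> ?Y \<and>
       (\<forall>\<theta>\<in>hoelder I \<beta> L.
          (\<forall>(j, k)\<in>Lam I. int j > J n \<beta> \<longrightarrow> \<bar>\<theta> (j, k)\<bar> \<le> phi \<phi>0 n / 4) \<and>
          (\<Sum>j. if int j > J n \<beta> then 2 powr (real j / 2) * (MAX k\<in>I j. \<bar>\<theta> (j, k)\<bar>) else 0)
            \<le> rate \<beta> n)"
      using first tail order_trans[OF hoelder_coeff_le coeff] unfolding Lam_def by blast
  qed
  then show ?thesis using b01 by (intro exI[of _ b0]) auto
qed

end

section \<open>The grid\<close>

definition cells :: "(nat \<Rightarrow> 'k set) \<Rightarrow> nat \<Rightarrow> (nat \<times> 'k) set"
  where "cells I n = {p\<in>Lam I. fst p \<le> Jmax n}"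

context dyadic_index
begin

lemma cells_eq_Sigma: "cells I n = (SIGMA j:{..Jmax n}. I j)"
  by (auto simp: cells_def Lam_def)

lemma finite_cells [simp]: "finite (cells I n)"
  by (simp add: cells_eq_Sigma)

lemma card_cells_le:
  assumes "1 \<le> n"
  shows "real (card (cells I n)) \<le> 4 * c2 * real n"
proof -
  have "real (card (cells I n)) = (\<Sum>j\<le>Jmax n. real (card (I j)))"
    by (simp add: cells_eq_Sigma)
  also have "\<dots> \<le> (\<Sum>j\<le>Jmax n. c2 * 2 ^ j)" by (intro sum_mono card_upper)
  also have "\<dots> = c2 * (\<Sum>j<Suc (Jmax n). 2 ^ j)" by (simp only: sum_distrib_left lessThan_Suc_atMost)
  also have "(\<Sum>j<Suc (Jmax n). 2 ^ j) = (2 ^ Suc (Jmax n) - 1 :: real)"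
    by (subst geometric_sum) auto
  also have "c2 * (2 ^ Suc (Jmax n) - 1) \<le> c2 * (4 * real n)"
  proof (intro mult_left_mono)
    have "real (2 ^ Jmax n) \<le> real (2 * n)" using Jmax_bounds(2)[OF assms] by (rule of_nat_mono)
    then show "2 ^ Suc (Jmax n) - 1 \<le> 4 * real n" by simp
  qed (use c2_pos in simp)
  finally show ?thesis by simp
qed

lemma mem_grid_iff:
  "\<theta> \<in> grid I \<phi>0 L n \<longleftrightarrow>
    (\<forall>p. p \<notin> cells I n \<longrightarrow> \<theta> p = 0) \<and>
    (\<forall>p\<in>cells I n. (\<exists>a::int. \<theta> p = of_int a * phi \<phi>0 n) \<and> \<bar>\<theta> p\<bar> \<le> L + 1)"
  unfolding grid_def cells_def abs_le_iff atLeastAtMost_iff by force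

lemma grid_outside: "\<theta> \<in> grid I \<phi>0 L n \<Longrightarrow> p \<notin> cells I n \<Longrightarrow> \<theta> p = 0"
  using mem_grid_iff by blast

lemma grid_cell:
  assumes "\<theta> \<in> grid I \<phi>0 L n" "p \<in> cells I n"
  obtains a :: int where "\<theta> p = of_int a * phi \<phi>0 n" "\<bar>\<theta> p\<bar> \<le> L + 1"
  using assms mem_grid_iff[of \<theta> \<phi>0 L n] by blast

lemma grid_multiple:
  assumes "\<theta> \<in> grid I \<phi>0 L n"
  obtains a :: int where "\<theta> p = of_int a * phi \<phi>0 n"
proof (cases "p \<in> cells I n")
  case True
  then show ?thesis using grid_cell[OF assms] that by metis
next
  case False
  then show ?thesis using grid_outside[OF assms] that[of 0] by simp
qed

lemma grid_abs_le: "\<theta> \<in> grid I \<phi>0 L n \<Longrightarrow> 0 \<le> L \<Longrightarrow> \<bar>\<theta> p\<bar> \<le> L + 1"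
  by (cases "p \<in> cells I n") (auto simp: grid_outside elim: grid_cell)

lemma grid_mix:
  assumes "\<theta> \<in> grid I \<phi>0 L n" "\<theta>' \<in> grid I \<phi>0 L n" "\<And>p. \<eta> p = \<theta> p \<or> \<eta> p = \<theta>' p"
  shows "\<eta> \<in> grid I \<phi>0 L n"
  using assms unfolding mem_grid_iff by metis

lemma zero_mem_grid: "0 \<le> L \<Longrightarrow> (\<lambda>_. 0) \<in> grid I \<phi>0 L n"
  by (auto simp: mem_grid_iff intro!: exI[of _ 0])

lemma finite_grid:
  assumes "2 \<le> n" "0 < \<phi>0"
  shows "finite (grid I \<phi>0 L n)"
proof -
  let ?\<phi> = "phi \<phi>0 n"
  have \<phi>: "0 < ?\<phi>" using assms by (rule phi_pos)
  let ?V = "(\<lambda>a. of_int a * ?\<phi>) ` {- \<lceil>(L + 1) / ?\<phi>\<rceil> .. \<lceil>(L + 1) / ?\<phi>\<rceil>}"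
  have "\<theta> p \<in> ?V" if "\<theta> \<in> grid I \<phi>0 L n" "p \<in> cells I n" for \<theta> p
  proof -
    from that obtain a :: int where a: "\<theta> p = of_int a * ?\<phi>" "\<bar>\<theta> p\<bar> \<le> L + 1"
      by (rule grid_cell)
    then have "\<bar>of_int a\<bar> \<le> (L + 1) / ?\<phi>" using \<phi> by (simp add: abs_mult field_simps)
    then have "\<bar>a\<bar> \<le> \<lceil>(L + 1) / ?\<phi>\<rceil>"
      by (metis ceiling_mono ceiling_of_int of_int_abs)
    then have "a \<in> {- \<lceil>(L + 1) / ?\<phi>\<rceil> .. \<lceil>(L + 1) / ?\<phi>\<rceil>}"
      unfolding atLeastAtMost_iff abs_le_iff by linarith
    then show ?thesis unfolding a(1) by (rule imageI)
  qed
  then have "grid I \<phi>0 L n \<subseteq> {\<theta>. \<forall>p. (p \<in> cells I n \<longrightarrow> \<theta> p \<in> ?V) \<and> (p \<notin> cells I n \<longrightarrow> \<theta> p = 0)}"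
    by (auto simp: grid_outside)
  then show ?thesis by (rule finite_subset) (intro finite_set_of_finite_funs finite_cells finite_imageI, simp)
qed

lemma ell2_square_eq_sum:
  assumes "\<And>p. p \<notin> A \<Longrightarrow> \<theta> p = \<theta>' p" "finite A" "A \<subseteq> Lam I"
  shows "(ell2 I \<theta> \<theta>')\<^sup>2 = (\<Sum>p\<in>A. (\<theta> p - \<theta>' p)\<^sup>2)"
proof -
  have "(\<Sum>\<^sub>\<infinity>p\<in>Lam I. (\<theta> p - \<theta>' p)\<^sup>2) = (\<Sum>\<^sub>\<infinity>p\<in>A. (\<theta> p - \<theta>' p)\<^sup>2)"
    using assms by (intro infsum_cong_neutral) auto
  also have "\<dots> = (\<Sum>p\<in>A. (\<theta> p - \<theta>' p)\<^sup>2)" using assms by simp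
  finally show ?thesis unfolding ell2_def by (simp add: sum_nonneg)
qed

lemma ell2_nonneg: "0 \<le> ell2 I \<theta> \<theta>'"
  unfolding ell2_def by (auto intro!: infsum_nonneg)

lemma coefficient_beyond_resolution:
  assumes "0 < n" "real n \<le> 2 ^ j" "0 < \<beta>" "0 < L"
  shows "L * 2 powr (- (real j * (\<beta> + 1/2))) \<le> L / sqrt (real n)"
proof -
  have "2 powr (- (real j * (\<beta> + 1/2))) \<le> (2::real) powr (- (real j / 2))"
    using assms(3) by (intro powr_mono) (auto simp: distrib_left)
  also have "\<dots> = (2 powr real j) powr - (1/2)" unfolding powr_powr by simp
  also have "\<dots> \<le> real n powr - (1/2)"
    using assms(1,2) by (intro powr_mono2') (auto simp: powr_realpow)
  also have "\<dots> = inverse (real n powr (1/2))" by (rule powr_minus)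
  also have "real n powr (1/2) = sqrt (real n)" by (rule powr_half_sqrt) simp
  finally have "L * 2 powr (- (real j * (\<beta> + 1/2))) \<le> L * inverse (sqrt (real n))"
    by (rule mult_left_mono) (use assms(4) in simp)
  then show ?thesis by (simp only: divide_inverse)
qed

text \<open>
  Rounding each coordinate to the nearest multiple of \<open>\<phi>\<^sub>n\<close> stays inside the grid as soon as \<open>\<phi>\<^sub>n \<le> 2\<close>; beyond
  \<open>J\<^sub>n\<close> the coefficients are at most \<open>L n\<^bsup>-1/2\<^esup>\<close>, which is eventually below \<open>\<phi>\<^sub>n / 2\<close>.
\<close>

lemma eventually_near_grid_point:
  assumes "0 < \<phi>0" "0 < \<beta>" "0 < L"
  shows "\<forall>\<^sub>F n in sequentially. \<forall>\<theta>0\<in>hoelder I \<beta> L. \<exists>\<theta>s. near_grid_point I \<phi>0 L n \<theta>0 \<theta>s"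
proof -
  have e1: "\<forall>\<^sub>F n in sequentially. phi \<phi>0 n < 2"
    by (rule order_tendstoD(2)[OF phi_tendsto_0]) simp
  have "filterlim (\<lambda>n::nat. sqrt (ln (real n))) at_top sequentially" by real_asymp
  then have e2: "\<forall>\<^sub>F n in sequentially. 2 * L / \<phi>0 \<le> sqrt (ln (real n))"
    by (simp add: filterlim_at_top)
  show ?thesis using e1 e2 eventually_ge_at_top[of 2]
  proof eventually_elim
    case (elim n)
    let ?\<phi> = "phi \<phi>0 n"
    have \<phi>: "0 < ?\<phi>" using elim assms by (intro phi_pos) auto
    show ?case
    proof
      fix \<theta>0 assume \<theta>0: "\<theta>0 \<in> hoelder I \<beta> L"
      define \<theta>s where "\<theta>s = (\<lambda>p. if p \<in> cells I n then of_int (round (\<theta>0 p / ?\<phi>)) * ?\<phi> else 0)"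
      have close: "\<bar>\<theta>0 p - of_int (round (\<theta>0 p / ?\<phi>)) * ?\<phi>\<bar> \<le> ?\<phi> / 2" for p
      proof -
        have "\<bar>of_int (round (\<theta>0 p / ?\<phi>)) - \<theta>0 p / ?\<phi>\<bar> * ?\<phi> \<le> 1 / 2 * ?\<phi>"
          using \<phi> of_int_round_abs_le[of "\<theta>0 p / ?\<phi>"] by (intro mult_right_mono) auto
        also have "\<bar>of_int (round (\<theta>0 p / ?\<phi>)) - \<theta>0 p / ?\<phi>\<bar> * ?\<phi>
            = \<bar>(of_int (round (\<theta>0 p / ?\<phi>)) - \<theta>0 p / ?\<phi>) * ?\<phi>\<bar>"
          using \<phi> by (simp add: abs_mult)
        also have "(of_int (round (\<theta>0 p / ?\<phi>)) - \<theta>0 p / ?\<phi>) * ?\<phi> = of_int (round (\<theta>0 p / ?\<phi>)) * ?\<phi> - \<theta>0 p"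
          using \<phi> by (simp add: left_diff_distrib)
        finally show ?thesis by (simp add: abs_minus_commute)
      qed
      have "\<theta>s \<in> grid I \<phi>0 L n"
      proof -
        have "\<bar>\<theta>s p\<bar> \<le> L + 1" if "p \<in> cells I n" for p
        proof -
          have "\<bar>\<theta>0 p\<bar> \<le> L"
            using hoelder_coeff_le_radius[OF \<theta>0, of p] that assms by (auto simp: cells_def)
          moreover have "\<theta>s p = of_int (round (\<theta>0 p / ?\<phi>)) * ?\<phi>" using that by (simp add: \<theta>s_def)
          ultimately show ?thesis using close[of p] elim(1) by linarith
        qed
        then show ?thesis unfolding mem_grid_iff by (auto simp: \<theta>s_def)
      qed
      moreover have "\<bar>\<theta>0 p - \<theta>s p\<bar> \<le> ?\<phi> / 2" if p: "p \<in> Lam I" for p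
      proof (cases "p \<in> cells I n")
        case True
        then show ?thesis using close by (simp add: \<theta>s_def)
      next
        case False
        obtain j k where jk: "p = (j, k)" "k \<in> I j" "Jmax n < j"
          using p False by (auto simp: Lam_def cells_def)
        have n_le: "real n \<le> 2 ^ j"
        proof -
          have "real n \<le> real (2 ^ Jmax n)"
            using Jmax_bounds(1)[of n] elim by (intro of_nat_mono) auto
          also have "\<dots> \<le> 2 ^ j" using jk by simp
          finally show ?thesis .
        qed
        have "\<bar>\<theta>0 p\<bar> \<le> L * 2 powr (- (real j * (\<beta> + 1/2)))"
          using hoelder_coeff_le[OF \<theta>0] jk by simp
        also have "\<dots> \<le> L / sqrt (real n)"
          using n_le elim(3) assms(2,3) by (intro coefficient_beyond_resolution) auto
        also have "\<dots> \<le> (\<phi>0 * sqrt (ln (real n)) / 2) / sqrt (real n)"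
        proof (rule divide_right_mono)
          show "L \<le> \<phi>0 * sqrt (ln (real n)) / 2"
            using elim(2) assms(1) by (simp add: divide_le_eq mult.commute)
        qed simp
        also have "\<dots> = ?\<phi> / 2" by (simp add: phi_def real_sqrt_divide)
        finally show ?thesis using False by (simp add: \<theta>s_def)
      qed
      ultimately show "\<exists>\<theta>s. near_grid_point I \<phi>0 L n \<theta>0 \<theta>s"
        by (auto simp: near_grid_point_def)
    qed
  qed
qed

section \<open>The modulus\<close>

lemma modulus_le_ell2:
  assumes "\<theta>' \<in> separated I T e \<theta>0"
  shows "modulus I T e \<theta>0 \<le> ell2 I \<theta>0 \<theta>'"
  unfolding modulus_def
  by (rule cINF_lower[OF bdd_belowI[of _ 0] assms]) (auto simp: ell2_nonneg)

lemma modulus_nonneg: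
  assumes "separated I T e \<theta>0 \<noteq> {}"
  shows "0 \<le> modulus I T e \<theta>0"
  unfolding modulus_def using assms by (intro cINF_greatest ell2_nonneg)

lemma hoelder_ell2_bounded:
  assumes "0 < \<beta>" "0 \<le> L"
  shows "\<exists>R. \<forall>\<theta>\<in>hoelder I \<beta> L. \<forall>\<theta>'\<in>hoelder I \<beta> L. ell2 I \<theta> \<theta>' \<le> R"
proof -
  let ?q = "2 powr - (2 * \<beta>)"
  define R where "R = 4 * L\<^sup>2 * c2 * (1 / (1 - ?q))"
  have q: "0 < ?q" "?q < 1" using two_powr_minus_less_1[of "2 * \<beta>"] assms by auto
  have R: "0 \<le> R" unfolding R_def using q c2_pos by simp
  have sum_le: "sum (\<lambda>p. (\<theta> p - \<theta>' p)\<^sup>2) F \<le> R"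
    if \<theta>: "\<theta> \<in> hoelder I \<beta> L" "\<theta>' \<in> hoelder I \<beta> L" and F: "finite F" "F \<subseteq> Lam I" for \<theta> \<theta>' F
  proof -
    obtain N where N: "\<forall>j\<in>fst ` F. j \<le> N"
      using F(1) finite_nat_set_iff_bounded_le[of "fst ` F"] by blast
    have sub: "F \<subseteq> (SIGMA j:{..N}. I j)"
      using F(2) N by (force simp: Lam_def)
    have coeff: "(\<theta> (j, k) - \<theta>' (j, k))\<^sup>2 \<le> 4 * L\<^sup>2 * (2 powr (- (real j * (\<beta> + 1/2))))\<^sup>2"
      if "k \<in> I j" for j k
    proof -
      have "\<bar>\<theta> (j, k) - \<theta>' (j, k)\<bar> \<le> 2 * (L * 2 powr (- (real j * (\<beta> + 1/2))))"
        using hoelder_coeff_le[OF \<theta>(1) that] hoelder_coeff_le[OF \<theta>(2) that] by simp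
      then have "\<bar>\<theta> (j, k) - \<theta>' (j, k)\<bar>\<^sup>2 \<le> (2 * (L * 2 powr (- (real j * (\<beta> + 1/2)))))\<^sup>2"
        by (rule power_mono) simp
      then show ?thesis by (simp add: power_mult_distrib)
    qed
    have level: "real (card (I j)) * (4 * L\<^sup>2 * (2 powr (- (real j * (\<beta> + 1/2))))\<^sup>2) \<le> 4 * L\<^sup>2 * c2 * ?q ^ j" for j
    proof -
      have "(2 powr (- (real j * (\<beta> + 1/2))))\<^sup>2 = 2 powr (- (real j * (\<beta> + 1/2)) + - (real j * (\<beta> + 1/2)))"
        unfolding powr_add power2_eq_square ..
      also have "- (real j * (\<beta> + 1/2)) + - (real j * (\<beta> + 1/2)) = - (2 * \<beta>) * real j + - real j"
        by (simp add: algebra_simps)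
      also have "2 powr \<dots> = ?q ^ j * 2 powr - real j"
        unfolding powr_add powr_powr[symmetric] by (simp add: powr_realpow)
      finally have sq: "(2 powr (- (real j * (\<beta> + 1/2))))\<^sup>2 = ?q ^ j * 2 powr - real j" .
      have "real (card (I j)) * (4 * L\<^sup>2 * (?q ^ j * 2 powr - real j))
          \<le> c2 * 2 ^ j * (4 * L\<^sup>2 * (?q ^ j * 2 powr - real j))"
        by (intro mult_right_mono card_upper) auto
      also have "\<dots> = 4 * L\<^sup>2 * c2 * ?q ^ j" by (simp add: powr_minus powr_realpow)
      finally show ?thesis unfolding sq .
    qed
    have "sum (\<lambda>p. (\<theta> p - \<theta>' p)\<^sup>2) F \<le> sum (\<lambda>p. (\<theta> p - \<theta>' p)\<^sup>2) (SIGMA j:{..N}. I j)"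
      by (intro sum_mono2 sub finite_SigmaI) auto
    also have "\<dots> = (\<Sum>j\<le>N. \<Sum>k\<in>I j. (\<theta> (j, k) - \<theta>' (j, k))\<^sup>2)"
      by (subst sum.Sigma) (auto simp: case_prod_unfold)
    also have "\<dots> \<le> (\<Sum>j\<le>N. \<Sum>k\<in>I j. 4 * L\<^sup>2 * (2 powr (- (real j * (\<beta> + 1/2))))\<^sup>2)"
      by (intro sum_mono coeff)
    also have "\<dots> \<le> (\<Sum>j\<le>N. 4 * L\<^sup>2 * c2 * ?q ^ j)"
      using level by (intro sum_mono) simp
    also have "\<dots> \<le> (\<Sum>j. 4 * L\<^sup>2 * c2 * ?q ^ j)"
      using q c2_pos by (intro sum_le_suminf summable_mult summable_geometric) auto
    also have "\<dots> = R"
      unfolding R_def using q by (subst suminf_mult) (auto intro!: summable_geometric simp: suminf_geometric)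
    finally show ?thesis .
  qed
  have "ell2 I \<theta> \<theta>' \<le> sqrt R" if "\<theta> \<in> hoelder I \<beta> L" "\<theta>' \<in> hoelder I \<beta> L" for \<theta> \<theta>'
  proof -
    have "(\<Sum>\<^sub>\<infinity>p\<in>Lam I. (\<theta> p - \<theta>' p)\<^sup>2) \<le> R"
    proof (cases "(\<lambda>p. (\<theta> p - \<theta>' p)\<^sup>2) summable_on Lam I")
      case True
      then show ?thesis by (rule infsum_le_finite_sums) (use sum_le[OF that] in auto)
    qed (simp add: infsum_not_exists R)
    then show ?thesis by (simp add: ell2_def)
  qed
  then show ?thesis by blast
qed

text \<open>
  Replacing one coefficient at level \<open>j\<close> by the extreme value of the opposite sign moves the parameter by at least
  \<open>L 2\<^bsup>-j\<beta>\<^esup>\<close> in the sup-type loss, but only by \<open>2 L 2\<^bsup>-j(\<beta>+1/2)\<^esup>\<close> in the quadratic one.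
\<close>

lemma single_coefficient_perturbation:
  assumes \<theta>0: "\<theta>0 \<in> hoelder I \<beta> L" and pos: "0 < \<beta>" "0 < L"
  obtains \<theta>' where "\<theta>' \<in> hoelder I \<beta> L" "L * (2 powr - \<beta>) ^ j \<le> ell_inf I \<theta>0 \<theta>'"
    "ell2 I \<theta>0 \<theta>' \<le> 2 * L * 2 powr (- (real j * (\<beta> + 1/2)))"
proof -
  obtain k where k: "k \<in> I j" using level_nonempty by blast
  define h where "h = L * 2 powr (- (real j * (\<beta> + 1/2)))"
  have h: "0 \<le> h" using pos by (simp add: h_def)
  have bound: "\<bar>\<theta>0 (j, k)\<bar> \<le> h" unfolding h_def by (rule hoelder_coeff_le[OF \<theta>0 k])
  define \<theta>' where "\<theta>' = \<theta>0((j, k) := if 0 \<le> \<theta>0 (j, k) then - h else h)"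
  have diff: "h \<le> \<bar>\<theta>0 (j, k) - \<theta>' (j, k)\<bar>" "\<bar>\<theta>0 (j, k) - \<theta>' (j, k)\<bar> \<le> 2 * h"
    using bound h by (auto simp: \<theta>'_def)
  have mem: "\<theta>' \<in> hoelder I \<beta> L"
    using \<theta>0 k h by (auto simp: hoelder_def \<theta>'_def Lam_def h_def)
  have "L * (2 powr - \<beta>) ^ j = 2 powr (real j / 2) * h"
    unfolding h_def by (rule hoelder_powr_power[symmetric])
  also have "\<dots> \<le> 2 powr (real j / 2) * \<bar>\<theta>0 (j, k) - \<theta>' (j, k)\<bar>"
    using diff by (intro mult_left_mono) auto
  also have "\<dots> \<le> ell_inf I \<theta>0 \<theta>'" by (rule ell_inf_ge_coeff[OF \<theta>0 mem pos(1) k])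
  finally have far: "L * (2 powr - \<beta>) ^ j \<le> ell_inf I \<theta>0 \<theta>'" .
  have "(ell2 I \<theta>0 \<theta>')\<^sup>2 = (\<theta>0 (j, k) - \<theta>' (j, k))\<^sup>2"
    using k by (subst ell2_square_eq_sum[of "{(j, k)}"]) (auto simp: \<theta>'_def Lam_def)
  also have "\<dots> \<le> (2 * h)\<^sup>2" using diff(2) h by (subst abs_le_square_iff[symmetric]) simp
  finally have "ell2 I \<theta>0 \<theta>' \<le> 2 * h" by (rule power2_le_imp_le) (use h in simp)
  then show ?thesis using that mem far by (simp add: h_def)
qed

lemma eventually_separated:
  assumes "0 < \<beta>1" "0 < L" and index: "\<And>\<theta>. \<theta> \<in> hoelder I \<beta>1 L \<Longrightarrow> \<beta>1 \<le> index \<theta>"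
  shows "\<forall>\<^sub>F n in sequentially. \<forall>\<theta>0\<in>hoelder I \<beta>1 L.
    separated I (hoelder I \<beta>1 L) (\<lambda>\<theta>. rate (index \<theta>) n) \<theta>0 \<noteq> {}"
proof -
  have "\<forall>\<^sub>F n in sequentially. rate \<beta>1 n < L / 2"
    using assms by (intro order_tendstoD(2)[OF rate_tendsto_0]) auto
  then show ?thesis using eventually_ge_at_top[of 2]
  proof eventually_elim
    case (elim n)
    show ?case
    proof
      fix \<theta>0 assume \<theta>0: "\<theta>0 \<in> hoelder I \<beta>1 L"
      obtain \<theta>' where \<theta>': "\<theta>' \<in> hoelder I \<beta>1 L" "L * (2 powr - \<beta>1) ^ 0 \<le> ell_inf I \<theta>0 \<theta>'"
        using single_coefficient_perturbation[OF \<theta>0 assms(1,2)] by metis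
      have "rate (index \<theta>0) n \<le> rate \<beta>1 n" "rate (index \<theta>') n \<le> rate \<beta>1 n"
        using index \<theta>0 \<theta>' elim assms by (auto intro!: rate_antimono)
      then have "\<theta>' \<in> separated I (hoelder I \<beta>1 L) (\<lambda>\<theta>. rate (index \<theta>) n) \<theta>0"
        using \<theta>' elim by (auto simp: separated_def)
      then show "separated I (hoelder I \<beta>1 L) (\<lambda>\<theta>. rate (index \<theta>) n) \<theta>0 \<noteq> {}" by blast
    qed
  qed
qed

text \<open>
  At the level \<open>2\<^sup>j\<close> of order \<open>(n / log n)\<^bsup>1/(2\<beta>1+1)\<^esup>\<close> a single extreme coefficient separates by the worst rate
  \<open>2 \<epsilon>\<^sub>n(\<beta>1)\<close>, at a quadratic cost of order \<open>\<phi>\<^sub>n\<close>. If that level does not exist, \<open>n\<close> is bounded, and the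
  quadratic diameter of the ball is comparable with \<open>\<phi>\<^sub>n\<close>.
\<close>

lemma modulus_le_phi:
  assumes pos: "0 < \<phi>0" "0 < \<beta>1" "0 < L"
    and index: "\<And>\<theta>. \<theta> \<in> hoelder I \<beta>1 L \<Longrightarrow> \<beta>1 \<le> index \<theta>"
  shows "\<exists>C>0. \<forall>n\<ge>2. \<forall>\<theta>0\<in>hoelder I \<beta>1 L.
    separated I (hoelder I \<beta>1 L) (\<lambda>\<theta>. rate (index \<theta>) n) \<theta>0 \<noteq> {} \<longrightarrow>
    modulus I (hoelder I \<beta>1 L) (\<lambda>\<theta>. rate (index \<theta>) n) \<theta>0 \<le> C * phi \<phi>0 n"
proof -
  let ?H = "hoelder I \<beta>1 L"
  obtain R where R: "\<And>\<theta> \<theta>'. \<theta> \<in> ?H \<Longrightarrow> \<theta>' \<in> ?H \<Longrightarrow> ell2 I \<theta> \<theta>' \<le> R"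
    using hoelder_ell2_bounded[of \<beta>1 L] pos by auto
  define w where "w = (L / 2) powr (1 / \<beta>1)"
  define s where "s = \<beta>1 + 1/2"
  define C1 where "C1 = 2 * L * (w / 2) powr - s / \<phi>0"
  define C2 where "C2 = \<bar>R\<bar> * w powr - s / \<phi>0"
  define C where "C = C1 + C2"
  have w: "0 < w" using pos by (simp add: w_def)
  have s: "0 < s" using pos by (simp add: s_def)
  have C12: "0 < C1" "0 \<le> C2" using pos w by (auto simp: C1_def C2_def)
  have C: "0 < C" "C1 \<le> C" "C2 \<le> C" using C12 by (auto simp: C_def)
  have main: "modulus I ?H (\<lambda>\<theta>. rate (index \<theta>) n) \<theta>0 \<le> C * phi \<phi>0 n"
    if n: "2 \<le> n" and \<theta>0: "\<theta>0 \<in> ?H" and sep: "separated I ?H (\<lambda>\<theta>. rate (index \<theta>) n) \<theta>0 \<noteq> {}" for n \<theta>0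
  proof -
    let ?X = "real n / ln (real n)"
    have X: "1 < ?X" by (rule n_div_ln_gt_1[OF n])
    define x where "x = ?X powr (1 / (2 * \<beta>1 + 1))"
    have x: "0 < x" using X unfolding x_def by (subst powr_gt_zero) linarith
    have "x powr - s = ?X powr (1 / (2 * \<beta>1 + 1) * - s)" unfolding x_def by (rule powr_powr)
    also have "1 / (2 * \<beta>1 + 1) * - s = - 1 / 2" using pos by (simp add: s_def field_simps)
    finally have phi_x: "phi \<phi>0 n = \<phi>0 * x powr - s" by (simp add: phi_eq_powr[OF n])
    have rate_x: "rate \<beta>1 n = x powr - \<beta>1" unfolding x_def powr_powr by (simp add: rate_def)
    have \<phi>: "0 < phi \<phi>0 n" using phi_pos[OF n] pos by simp
    show ?thesis
    proof (cases "1 \<le> w * x")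
      case True
      define j where "j = nat \<lfloor>log 2 (w * x)\<rfloor>"
      have "0 \<le> log 2 (w * x)" using True by simp
      then have j: "real j \<le> log 2 (w * x)" "log 2 (w * x) < real j + 1"
        unfolding j_def by auto
      have j_upper: "2 powr real j \<le> w * x"
        using powr_mono[OF j(1), of 2] True by simp
      have "2 powr log 2 (w * x) \<le> 2 powr (real j + 1)" using j(2) by (intro powr_mono) auto
      then have j_lower: "w / 2 * x \<le> 2 powr real j" using True by (simp add: powr_add)
      obtain \<theta>' where \<theta>': "\<theta>' \<in> ?H" "L * (2 powr - \<beta>1) ^ j \<le> ell_inf I \<theta>0 \<theta>'"
          "ell2 I \<theta>0 \<theta>' \<le> 2 * L * 2 powr (- (real j * (\<beta>1 + 1/2)))"
        using single_coefficient_perturbation[OF \<theta>0 pos(2,3)] by metis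
      have "2 * rate \<beta>1 n = L * (w * x) powr - \<beta>1"
      proof -
        have "w powr - \<beta>1 = 2 / L" unfolding w_def powr_powr using pos by (simp add: powr_minus)
        then show ?thesis using w x pos by (simp add: powr_mult rate_x)
      qed
      also have "\<dots> \<le> L * (2 powr real j) powr - \<beta>1"
        using j_upper pos by (intro mult_left_mono powr_mono2') auto
      also have "\<dots> = L * (2 powr - \<beta>1) ^ j"
        by (simp add: powr_realpow[symmetric] powr_powr mult.commute)
      finally have "2 * rate \<beta>1 n \<le> ell_inf I \<theta>0 \<theta>'" using \<theta>' by simp
      moreover have "rate (index \<theta>0) n \<le> rate \<beta>1 n" "rate (index \<theta>') n \<le> rate \<beta>1 n"
        using index \<theta>0 \<theta>' n pos by (auto intro!: rate_antimono)
      ultimately have "\<theta>' \<in> separated I ?H (\<lambda>\<theta>. rate (index \<theta>) n) \<theta>0"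
        using \<theta>' by (auto simp: separated_def)
      then have "modulus I ?H (\<lambda>\<theta>. rate (index \<theta>) n) \<theta>0 \<le> ell2 I \<theta>0 \<theta>'" by (rule modulus_le_ell2)
      also have "\<dots> \<le> 2 * L * (2 powr real j) powr - s"
        using \<theta>'(3) by (simp add: powr_powr s_def algebra_simps)
      also have "\<dots> \<le> 2 * L * (w / 2 * x) powr - s"
        using j_lower pos w x s by (intro mult_left_mono powr_mono2') auto
      also have "\<dots> = C1 * phi \<phi>0 n"
        unfolding powr_mult C1_def phi_x using pos by simp
      also have "\<dots> \<le> C * phi \<phi>0 n" by (rule mult_right_mono[OF C(2) less_imp_le[OF \<phi>]])
      finally show ?thesis .
    next
      case False
      obtain \<theta>' where \<theta>': "\<theta>' \<in> separated I ?H (\<lambda>\<theta>. rate (index \<theta>) n) \<theta>0" using sep by blast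
      have "modulus I ?H (\<lambda>\<theta>. rate (index \<theta>) n) \<theta>0 \<le> ell2 I \<theta>0 \<theta>'"
        by (rule modulus_le_ell2[OF \<theta>'])
      also have "\<dots> \<le> \<bar>R\<bar>" using R[OF \<theta>0, of \<theta>'] \<theta>' by (auto simp: separated_def)
      also have "\<dots> \<le> \<bar>R\<bar> * (w * x) powr - s"
      proof -
        have "1 powr - s \<le> (w * x) powr - s" using False w x s by (intro powr_mono2') auto
        then show ?thesis using mult_left_mono[of 1 "(w * x) powr - s" "\<bar>R\<bar>"] by simp
      qed
      also have "\<dots> = C2 * phi \<phi>0 n"
        unfolding powr_mult C2_def phi_x using pos by simp
      also have "\<dots> \<le> C * phi \<phi>0 n" by (rule mult_right_mono[OF C(3) less_imp_le[OF \<phi>]])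
      finally show ?thesis .
    qed
  qed
  then show ?thesis using C(1) by blast
qed

end

section \<open>Partition of the grid\<close>

text \<open>
  Equality of two grid values up to the one identification that \<open>d1\<close> makes: the two grid points bracketing a
  coordinate of the truth that stays away from the grid.
\<close>

definition identified :: "(nat \<Rightarrow> 'k set) \<Rightarrow> real \<Rightarrow> nat \<Rightarrow> (nat \<times> 'k \<Rightarrow> real) \<Rightarrow> nat \<times> 'k \<Rightarrow> real \<Rightarrow> real \<Rightarrow> bool"
  where "identified I \<phi>0 n \<theta>0 p a b \<longleftrightarrow> a = b \<or>
    (p \<notin> near_set I \<phi>0 n \<theta>0 \<and> min a b < \<theta>0 p \<and> \<theta>0 p < max a b \<and> \<bar>a - b\<bar> = phi \<phi>0 n)"

lemma identified_refl [simp]: "identified I \<phi>0 n \<theta>0 p a a"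
  by (simp add: identified_def)

lemma identified_sym: "identified I \<phi>0 n \<theta>0 p a b \<Longrightarrow> identified I \<phi>0 n \<theta>0 p b a"
  by (auto simp: identified_def min.commute max.commute abs_minus_commute)

text \<open>Two grid steps in opposite directions across the same value of the truth cancel.\<close>

lemma identified_trans:
  assumes "identified I \<phi>0 n \<theta>0 p a b" "identified I \<phi>0 n \<theta>0 p b c"
  shows "identified I \<phi>0 n \<theta>0 p a c"
proof (cases "a = b \<or> b = c")
  case False
  then have "a = c" using assms unfolding identified_def min_def max_def abs_if
    by (auto split: if_splits)
  then show ?thesis by simp
qed (use assms in auto)

text \<open>
  The map from every block into the ball. Overwriting only the coordinates that are not identified with those of
  \<open>\<theta>s\<close> makes it injective on each class, where the overwritten coordinates are constant.
\<close>

definition recenter :: "(nat \<Rightarrow> 'k set) \<Rightarrow> real \<Rightarrow> nat \<Rightarrow> (nat \<times> 'k \<Rightarrow> real) \<Rightarrow> (nat \<times> 'k \<Rightarrow> real) \<Rightarrow>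
    (nat \<times> 'k \<Rightarrow> real) \<Rightarrow> nat \<times> 'k \<Rightarrow> real"
  where "recenter I \<phi>0 n \<theta>0 \<theta>s \<theta> p = (if identified I \<phi>0 n \<theta>0 p (\<theta> p) (\<theta>s p) then \<theta> p else \<theta>s p)"

lemma int_multiple_abs_less:
  fixes a b :: int and h :: real
  assumes "\<bar>of_int a * h - of_int b * h\<bar> < h" "0 < h"
  shows "a = b"
proof -
  have "of_int a * h - of_int b * h = of_int (a - b) * h" by (simp add: left_diff_distrib)
  then have "\<bar>of_int (a - b)\<bar> * h < 1 * h" using assms by (simp add: abs_mult)
  then have "\<bar>of_int (a - b)\<bar> < (1::real)" using assms(2) by (simp only: mult_less_cancel_right_pos)
  then have "\<bar>a - b\<bar> < 1" by linarith
  then show ?thesis by simp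
qed

lemma nearest_multiple_in_bracket:
  fixes a b :: int and h x :: real
  assumes "0 < h" "of_int a * h < x" "x < of_int (a + 1) * h" "\<bar>x - of_int b * h\<bar> \<le> h / 2"
  shows "b = a \<or> b = a + 1"
proof -
  have "of_int (b - a) * h < 2 * h" "- 1 * h < of_int (b - a) * h"
    using assms(2-4) unfolding of_int_diff of_int_add of_int_1 left_diff_distrib distrib_right
    by linarith+
  then have "of_int (b - a) < (2::real)" "- 1 < (of_int (b - a) :: real)"
    using assms(1) by (simp_all only: mult_less_cancel_right_pos)
  then have "b - a < 2" "- 1 < b - a" by linarith+
  then show ?thesis by linarith
qed

text \<open>
  A two-sided geometric series. Because \<open>|m| \<le> m\<^sup>2\<close>, it also dominates the theta series with exponents \<open>m\<^sup>2\<close>.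
\<close>

lemma sum_power_abs_le:
  fixes q :: real and A :: "int set"
  assumes q: "0 \<le> q" "q \<le> 1/2" and A: "finite A" "0 \<notin> A"
  shows "(\<Sum>m\<in>A. q ^ nat \<bar>m\<bar>) \<le> 4 * q"
proof -
  have half: "(\<Sum>m\<in>B. q ^ nat \<bar>m\<bar>) \<le> 2 * q" if B: "B \<subseteq> A" "inj_on (\<lambda>m. nat \<bar>m\<bar> - 1) B" for B
  proof -
    let ?g = "\<lambda>m::int. nat \<bar>m\<bar> - 1"
    have fin: "finite B" using B A finite_subset by blast
    have "q ^ nat \<bar>m\<bar> = q * q ^ ?g m" if "m \<in> B" for m
    proof -
      have "m \<noteq> 0" using that B A by auto
      then have "nat \<bar>m\<bar> = Suc (?g m)" by simp
      then show ?thesis by (metis power_Suc)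
    qed
    then have "(\<Sum>m\<in>B. q ^ nat \<bar>m\<bar>) = (\<Sum>m\<in>B. q * q ^ ?g m)" by (intro sum.cong) auto
    also have "\<dots> = (\<Sum>i\<in>?g ` B. q * q ^ i)" using B(2) by (simp add: sum.reindex)
    also have "\<dots> \<le> (\<Sum>i. q * q ^ i)"
      using q fin by (intro sum_le_suminf summable_mult summable_geometric) auto
    also have "\<dots> = q * (1 / (1 - q))"
      using q by (subst suminf_mult) (auto intro!: summable_geometric simp: suminf_geometric)
    also have "\<dots> \<le> q * 2" using q by (intro mult_left_mono) (auto simp: field_simps)
    finally show ?thesis by simp
  qed
  have "A = (A \<inter> {0<..}) \<union> (A \<inter> {..<0})"
  proof (intro equalityI subsetI)
    fix m assume "m \<in> A"
    then have "0 < m \<or> m < 0" using A(2) by (metis linorder_neqE)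
    then show "m \<in> (A \<inter> {0<..}) \<union> (A \<inter> {..<0})" using \<open>m \<in> A\<close> by blast
  qed blast
  then have "(\<Sum>m\<in>A. q ^ nat \<bar>m\<bar>) = (\<Sum>m\<in>(A \<inter> {0<..}) \<union> (A \<inter> {..<0}). q ^ nat \<bar>m\<bar>)" by simp
  also have "\<dots> = (\<Sum>m\<in>A \<inter> {0<..}. q ^ nat \<bar>m\<bar>) + (\<Sum>m\<in>A \<inter> {..<0}. q ^ nat \<bar>m\<bar>)"
    using A by (intro sum.union_disjoint) auto
  also have "\<dots> \<le> 2 * q + 2 * q"
    by (intro add_mono half) (auto simp: inj_on_def)
  finally show ?thesis by simp
qed

locale grid_partition = dyadic_index I c1 c2 for I :: "nat \<Rightarrow> 'k set" and c1 c2 +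
  fixes \<phi>0 L :: real and n :: nat and \<theta>0 \<theta>s :: "nat \<times> 'k \<Rightarrow> real"
  assumes n_ge_2: "2 \<le> n" and \<phi>0_pos: "0 < \<phi>0"
    and near: "near_grid_point I \<phi>0 L n \<theta>0 \<theta>s"
begin

abbreviation "\<phi> \<equiv> phi \<phi>0 n"
abbreviation "D \<equiv> grid I \<phi>0 L n"
abbreviation "ident \<equiv> identified I \<phi>0 n \<theta>0"
abbreviation "rec \<equiv> recenter I \<phi>0 n \<theta>0 \<theta>s"
abbreviation "R \<equiv> d1_rel I \<phi>0 L n \<theta>0"

lemma \<phi>_pos: "0 < \<phi>"
  by (rule phi_pos[OF n_ge_2 \<phi>0_pos])

lemma \<theta>s_grid: "\<theta>s \<in> D"
  using near by (simp add: near_grid_point_def)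

lemma \<theta>s_near: "p \<in> Lam I \<Longrightarrow> \<bar>\<theta>0 p - \<theta>s p\<bar> \<le> \<phi> / 2"
  using near by (simp add: near_grid_point_def)

lemma finite_D: "finite D"
  by (rule finite_grid[OF n_ge_2 \<phi>0_pos])

lemma d1_eq_0_iff:
  assumes "\<theta> \<in> D" "\<theta>' \<in> D"
  shows "d1 I \<phi>0 n \<theta>0 \<theta> \<theta>' = 0 \<longleftrightarrow> (\<forall>p\<in>cells I n. ident p (\<theta> p) (\<theta>' p))"
proof -
  define b where "b = (\<lambda>p. p \<notin> near_set I \<phi>0 n \<theta>0 \<and> min (\<theta> p) (\<theta>' p) < \<theta>0 p \<and> \<theta>0 p < max (\<theta> p) (\<theta>' p))"
  let ?t = "\<lambda>p. (\<theta> p - \<theta>' p)\<^sup>2 - \<phi>\<^sup>2 * of_bool (b p)"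
  have b_ne: "\<theta> p \<noteq> \<theta>' p" if "b p" for p using that by (auto simp: b_def)
  have ident_iff: "ident p (\<theta> p) (\<theta>' p) \<longleftrightarrow> \<theta> p = \<theta>' p \<or> b p \<and> \<bar>\<theta> p - \<theta>' p\<bar> = \<phi>" for p
    unfolding identified_def b_def by blast
  have nonneg: "0 \<le> ?t p" for p
  proof (cases "b p")
    case True
    obtain i j where ij: "\<theta> p = of_int i * \<phi>" "\<theta>' p = of_int j * \<phi>"
      using grid_multiple assms by metis
    have "\<not> \<bar>\<theta> p - \<theta>' p\<bar> < \<phi>" using int_multiple_abs_less[of i \<phi> j] \<phi>_pos b_ne[OF True] ij by auto
    then have "\<phi>\<^sup>2 \<le> \<bar>\<theta> p - \<theta>' p\<bar>\<^sup>2" using \<phi>_pos by (intro power_mono) auto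
    then show ?thesis using True by simp
  qed simp
  have zero: "?t p = 0 \<longleftrightarrow> ident p (\<theta> p) (\<theta>' p)" for p
  proof (cases "b p")
    case True
    have "(\<theta> p - \<theta>' p)\<^sup>2 = \<phi>\<^sup>2 \<longleftrightarrow> \<bar>\<theta> p - \<theta>' p\<bar> = \<phi>"
      using \<phi>_pos power2_eq_iff_nonneg[of "\<bar>\<theta> p - \<theta>' p\<bar>" \<phi>] by simp
    then show ?thesis using True b_ne[OF True] by (simp add: ident_iff)
  qed (simp add: ident_iff)
  have "d1 I \<phi>0 n \<theta>0 \<theta> \<theta>' = 0 \<longleftrightarrow> (\<Sum>p\<in>cells I n. ?t p) = 0"
    by (simp add: d1_def cells_def b_def)
  also have "\<dots> \<longleftrightarrow> (\<forall>p\<in>cells I n. ?t p = 0)"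
    by (rule sum_nonneg_eq_0_iff[OF finite_cells nonneg])
  finally show ?thesis using zero by blast
qed

lemma mem_R_iff: "(\<theta>, \<theta>') \<in> R \<longleftrightarrow> \<theta> \<in> D \<and> \<theta>' \<in> D \<and> (\<forall>p. ident p (\<theta> p) (\<theta>' p))"
proof -
  have "ident p (\<theta> p) (\<theta>' p)" if "\<theta> \<in> D" "\<theta>' \<in> D" "p \<notin> cells I n" for p
    using that by (simp add: grid_outside)
  then show ?thesis unfolding d1_rel_def using d1_eq_0_iff by blast
qed

lemma R_D:
  assumes "(\<theta>, \<theta>') \<in> R"
  shows "\<theta> \<in> D" "\<theta>' \<in> D" "ident p (\<theta> p) (\<theta>' p)"
  using assms mem_R_iff by blast+

lemma R_I: "\<theta> \<in> D \<Longrightarrow> \<theta>' \<in> D \<Longrightarrow> (\<And>p. ident p (\<theta> p) (\<theta>' p)) \<Longrightarrow> (\<theta>, \<theta>') \<in> R"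
  using mem_R_iff by blast

lemma equiv_R: "equiv D R"
proof (rule equivI)
  show "R \<subseteq> D \<times> D" using R_D by auto
  show "refl_on D R" by (rule refl_onI) (intro R_I identified_refl)
  show "sym R"
  proof (rule symI)
    fix \<theta> \<theta>' assume R: "(\<theta>, \<theta>') \<in> R"
    show "(\<theta>', \<theta>) \<in> R" by (rule R_I[OF R_D(2,1)[OF R] identified_sym[OF R_D(3)[OF R]]])
  qed
  show "trans R"
  proof (rule transI)
    fix \<theta> \<theta>' \<theta>'' assume R: "(\<theta>, \<theta>') \<in> R" "(\<theta>', \<theta>'') \<in> R"
    show "(\<theta>, \<theta>'') \<in> R"
      by (rule R_I[OF R_D(1)[OF R(1)] R_D(2)[OF R(2)] identified_trans[OF R_D(3)[OF R(1)] R_D(3)[OF R(2)]]])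
  qed
qed

lemma rec_mem_class:
  assumes "\<theta> \<in> D"
  shows "(rec \<theta>, \<theta>s) \<in> R"
proof (rule R_I)
  show "rec \<theta> \<in> D" by (rule grid_mix[OF assms \<theta>s_grid]) (auto simp: recenter_def)
qed (auto simp: recenter_def \<theta>s_grid)

text \<open>
  A grid point other than the two bracketing the truth is more than a full step away from it, whereas \<open>\<theta>s p\<close> is within
  half a step.
\<close>

lemma \<theta>s_in_bracket:
  assumes "ident p (\<theta> p) (\<theta>' p)" "\<theta> p \<noteq> \<theta>' p" "\<theta> \<in> D" "p \<in> Lam I"
  shows "\<theta>s p = \<theta> p \<or> \<theta>s p = \<theta>' p"
proof -
  obtain a b where ab: "\<theta> p = of_int a * \<phi>" "\<theta>s p = of_int b * \<phi>"
    using grid_multiple assms(3) \<theta>s_grid by metis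
  have near: "\<bar>\<theta>0 p - \<theta>s p\<bar> \<le> \<phi> / 2" by (rule \<theta>s_near[OF assms(4)])
  have br: "min (\<theta> p) (\<theta>' p) < \<theta>0 p" "\<theta>0 p < max (\<theta> p) (\<theta>' p)" "\<bar>\<theta> p - \<theta>' p\<bar> = \<phi>"
    using assms(1,2) by (auto simp: identified_def)
  consider "\<theta>' p = \<theta> p + \<phi>" | "\<theta>' p = \<theta> p - \<phi>" using br(3) by linarith
  then show ?thesis
  proof cases
    case 1
    then have "b = a \<or> b = a + 1"
      using br near ab \<phi>_pos by (intro nearest_multiple_in_bracket[of \<phi> a "\<theta>0 p" b]) (auto simp: algebra_simps)
    then show ?thesis using 1 ab by (auto simp: algebra_simps)
  next
    case 2
    then have "b = (a - 1) \<or> b = (a - 1) + 1"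
      using br near ab \<phi>_pos by (intro nearest_multiple_in_bracket[of \<phi> "a - 1" "\<theta>0 p" b]) (auto simp: algebra_simps)
    then show ?thesis using 2 ab by (auto simp: algebra_simps)
  qed
qed

text \<open>
  Two members of a class that differ at \<open>p\<close> occupy both points bracketing the truth, and \<open>\<theta>s p\<close> is one of them; so
  both are identified with \<open>\<theta>s p\<close>, and neither is overwritten there.
\<close>

lemma rec_inj:
  assumes R: "(\<theta>, \<theta>') \<in> R" and eq: "rec \<theta> = rec \<theta>'"
  shows "\<theta> = \<theta>'"
proof
  fix p
  have D: "\<theta> \<in> D" "\<theta>' \<in> D" and ident: "ident p (\<theta> p) (\<theta>' p)" using R_D[OF R] by auto
  show "\<theta> p = \<theta>' p"
  proof (cases "p \<in> cells I n")
    case True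
    then have p: "p \<in> Lam I" by (simp add: cells_def)
    show ?thesis
    proof (rule ccontr)
      assume ne: "\<theta> p \<noteq> \<theta>' p"
      have "\<theta>s p = \<theta> p \<or> \<theta>s p = \<theta>' p" using ident ne D(1) p by (rule \<theta>s_in_bracket)
      then have "ident p (\<theta> p) (\<theta>s p)" "ident p (\<theta>' p) (\<theta>s p)"
        using ident identified_sym[OF ident] by auto
      then show False using ne fun_cong[OF eq, of p] by (simp add: recenter_def)
    qed
  qed (use D in \<open>simp add: grid_outside\<close>)
qed

text \<open>
  A coordinate of the truth at more than a quarter step from the grid is within three quarters of a step of both points
  bracketing it. At the other coordinates the class of \<open>\<theta>s\<close> contains only the value of \<open>\<theta>s\<close>, which is within half
  a step.
\<close>

lemma class_\<theta>s_near:
  assumes R: "(\<theta>, \<theta>s) \<in> R" and p: "p \<in> Lam I"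
  shows "\<bar>\<theta> p - \<theta>0 p\<bar> \<le> 3/4 * \<phi>"
proof (cases "\<theta> p = \<theta>s p")
  case True
  then show ?thesis using \<theta>s_near[OF p] \<phi>_pos by (simp add: abs_minus_commute)
next
  case False
  have D: "\<theta> \<in> D" and ident: "ident p (\<theta> p) (\<theta>s p)" using R_D[OF R] by auto
  have br: "p \<notin> near_set I \<phi>0 n \<theta>0" "min (\<theta> p) (\<theta>s p) < \<theta>0 p" "\<theta>0 p < max (\<theta> p) (\<theta>s p)" "\<bar>\<theta> p - \<theta>s p\<bar> = \<phi>"
    using ident False by (auto simp: identified_def)
  have "p \<in> cells I n" using False grid_outside D \<theta>s_grid by metis
  then have "\<not> \<bar>\<theta>0 p - of_int t * \<phi>\<bar> \<le> \<phi> / 4" for t :: int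
    using br(1) by (auto simp: near_set_def cells_def)
  moreover obtain b where "\<theta>s p = of_int b * \<phi>" using grid_multiple[OF \<theta>s_grid] by metis
  ultimately have "\<not> \<bar>\<theta>0 p - \<theta>s p\<bar> \<le> \<phi> / 4" by simp
  then show ?thesis using br(2-4) by (auto simp: min_def max_def split: if_splits)
qed

lemma class_\<theta>s_zero:
  assumes R: "(\<theta>, \<theta>s) \<in> R" and p: "p \<in> Lam I" and small: "\<bar>\<theta>0 p\<bar> \<le> \<phi> / 4"
  shows "\<theta> p = 0"
proof (cases "p \<in> cells I n")
  case True
  have D: "\<theta> \<in> D" and ident: "ident p (\<theta> p) (\<theta>s p)" using R_D[OF R] by auto
  have "\<exists>t::int. \<bar>\<theta>0 p - of_int t * \<phi>\<bar> \<le> \<phi> / 4" by (rule exI[of _ 0]) (use small in simp)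
  then have "p \<in> near_set I \<phi>0 n \<theta>0" using True by (auto simp: near_set_def cells_def)
  then have "\<theta> p = \<theta>s p" using ident by (auto simp: identified_def)
  moreover obtain b where b: "\<theta>s p = of_int b * \<phi>" using grid_multiple[OF \<theta>s_grid] by metis
  have "\<bar>of_int b * \<phi> - of_int 0 * \<phi>\<bar> < \<phi>" using \<theta>s_near[OF p] small \<phi>_pos unfolding b of_int_0 by linarith
  then have "b = 0" by (rule int_multiple_abs_less[OF _ \<phi>_pos])
  ultimately show ?thesis using b by simp
qed (use R_D(1)[OF R] in \<open>simp add: grid_outside\<close>)

text \<open>
  With the class of \<open>\<theta>s\<close> inside the ball, removing the ball from the other classes leaves a partition of its
  complement, and recentring maps every block of that partition into the ball.
\<close>

context
  fixes r :: real
  assumes class_le: "\<And>\<theta>. (\<theta>, \<theta>s) \<in> R \<Longrightarrow> ell_inf I \<theta> \<theta>0 \<le> r"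
begin

abbreviation "B0 \<equiv> block0 I \<phi>0 L n \<theta>0 r"
abbreviation "\<B> \<equiv> blocks I \<phi>0 L n \<theta>0 \<theta>s r"

lemma class_subset_B0: "R `` {\<theta>s} \<subseteq> B0"
proof
  fix \<theta> assume "\<theta> \<in> R `` {\<theta>s}"
  then have "(\<theta>, \<theta>s) \<in> R" using equiv_R by (auto elim: equivE dest: symD)
  then show "\<theta> \<in> B0" using class_le R_D(1) by (simp add: block0_def)
qed

lemma block_eq_diff:
  assumes "S \<in> \<B>"
  shows "\<exists>C\<in>D // R. S = C - B0"
  using assms by (auto simp: blocks_def)

lemma block_basic:
  assumes "S \<in> \<B>"
  shows "S \<subseteq> D" "finite S" "S \<noteq> {}" "S \<inter> B0 = {}"
proof -
  obtain C where C: "C \<in> D // R" "S = C - B0" using block_eq_diff[OF assms] by blast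
  have "C \<subseteq> D" using C(1) Union_quotient[OF equiv_R] by blast
  then show "S \<subseteq> D" using C(2) by blast
  then show "finite S" by (rule finite_subset[OF _ finite_D])
  show "S \<inter> B0 = {}" using C(2) by blast
qed (use assms in \<open>auto simp: blocks_def\<close>)

lemma block_related:
  assumes "S \<in> \<B>" "\<theta> \<in> S" "\<theta>' \<in> S"
  shows "(\<theta>, \<theta>') \<in> R"
proof -
  obtain C where "C \<in> D // R" "S = C - B0" using block_eq_diff[OF assms(1)] by blast
  then show ?thesis using quotient_eq_iff[OF equiv_R, of C C \<theta> \<theta>'] assms by auto
qed

lemma block_not_center:
  assumes "S \<in> \<B>" "\<theta> \<in> S"
  shows "(\<theta>, \<theta>s) \<notin> R"
proof
  assume "(\<theta>, \<theta>s) \<in> R"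
  then have "\<theta> \<in> B0" using class_le R_D(1) by (simp add: block0_def)
  then show False using assms block_basic(4) by blast
qed

lemma block_eqI:
  assumes "S \<in> \<B>" "S' \<in> \<B>" "\<theta> \<in> S" "\<theta>' \<in> S'" "(\<theta>, \<theta>') \<in> R"
  shows "S = S'"
proof -
  obtain C where C: "C \<in> D // R" "S = C - B0" using block_eq_diff[OF assms(1)] by blast
  obtain C' where C': "C' \<in> D // R" "S' = C' - B0" using block_eq_diff[OF assms(2)] by blast
  have "C = C'" using quotient_eqI[OF equiv_R C(1) C'(1), of \<theta> \<theta>'] C C' assms by auto
  then show ?thesis using C C' by simp
qed

lemma rec_inj_on_block: "S \<in> \<B> \<Longrightarrow> inj_on rec S"
  by (rule inj_onI) (use block_related rec_inj in blast)

lemma rec_image_subset: "S \<in> \<B> \<Longrightarrow> rec ` S \<subseteq> B0"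
proof
  fix \<eta> assume "S \<in> \<B>" "\<eta> \<in> rec ` S"
  then have "(\<eta>, \<theta>s) \<in> R" using block_basic(1) rec_mem_class by blast
  then show "\<eta> \<in> B0" using class_le R_D(1) by (simp add: block0_def)
qed

lemma partition_D: "partition_on D (insert B0 \<B>)"
proof (rule partition_onI)
  show "\<Union> (insert B0 \<B>) = D"
  proof
    have "B0 \<subseteq> D" by (auto simp: block0_def)
    then show "\<Union> (insert B0 \<B>) \<subseteq> D" using block_basic(1) by blast
    show "D \<subseteq> \<Union> (insert B0 \<B>)"
    proof
      fix \<theta> assume \<theta>: "\<theta> \<in> D"
      show "\<theta> \<in> \<Union> (insert B0 \<B>)"
      proof (cases "\<theta> \<in> B0")
        case False
        have self: "\<theta> \<in> R `` {\<theta>}" by (rule equiv_class_self[OF equiv_R \<theta>])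
        have "R `` {\<theta>} \<noteq> R `` {\<theta>s}" using self class_subset_B0 False by blast
        then have "R `` {\<theta>} - B0 \<in> \<B>"
          using quotientI[OF \<theta>, of R] self False unfolding blocks_def by blast
        then show ?thesis using self False by blast
      qed simp
    qed
  qed
  show "disjnt S S'" if "S \<in> insert B0 \<B>" "S' \<in> insert B0 \<B>" "S \<noteq> S'" for S S'
  proof -
    have "S \<inter> S' = {}" if "S \<in> \<B>" "S' \<in> \<B>" "S \<noteq> S'" for S S'
    proof (rule ccontr)
      assume "S \<inter> S' \<noteq> {}"
      then obtain \<theta> where \<theta>: "\<theta> \<in> S" "\<theta> \<in> S'" by blast
      then show False using block_eqI[OF that(1,2) \<theta> block_related[OF that(1) \<theta>(1,1)]] that(3) by blast
    qed
    then show ?thesis using that block_basic(4) unfolding disjnt_def by blast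
  qed
  show "{} \<notin> insert B0 \<B>"
    using class_subset_B0 equiv_class_self[OF equiv_R \<theta>s_grid] by (auto simp: blocks_def)
qed

lemma admissible_partition:
  assumes "r = A * \<epsilon>" "0 < A"
  shows "admissible I D \<theta>0 A \<epsilon> B0 \<B>"
  unfolding admissible_def
proof (intro conjI ballI)
  have B0: "B0 \<noteq> {}"
    using class_subset_B0 equiv_class_self[OF equiv_R \<theta>s_grid] by blast
  have fin: "finite B0" using finite_D by (auto simp: block0_def intro: finite_subset)
  show "B0 \<notin> \<B>" using B0 block_basic(4)[of B0] by blast
  show "B0 = {\<theta>\<in>D. ell_inf I \<theta>0 \<theta> \<le> A * \<epsilon>}"
    using assms(1) by (auto simp: block0_def ell_inf_commute)
  show "card S \<le> card B0" if "S \<in> \<B>" for S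
    by (rule card_inj_on_le[OF rec_inj_on_block[OF that] rec_image_subset[OF that] fin])
qed (use partition_D assms(2) in auto)

text \<open>
  A block is determined by the integer vector of displacements that recentring undoes, because these displacements
  are the same for all its members. The sum over blocks is therefore dominated by a product of one-dimensional theta
  series, one factor \<open>1 + O(1/n)\<close> for each of the \<open>O(n)\<close> coordinates.
\<close>

lemma sum_blocks_le:
  assumes C: "0 < C" and mod: "0 \<le> \<omega>" "\<omega> \<le> C * \<phi>"
  shows "(\<Sum>S\<in>\<B>. exp (- (2 / \<phi>0\<^sup>2) * real n * (MIN \<theta>\<in>S. ell2 I \<theta> (rec \<theta>))\<^sup>2))
    \<le> exp (16 * c2) * exp (- (1 / (\<phi>0\<^sup>2 * C\<^sup>2)) * real n * \<omega>\<^sup>2)"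
proof -
  \<comment> \<open>\<open>t S\<close> attains the minimum over \<open>S\<close>, and \<open>m S\<close> is its displacement vector in grid steps.\<close>
  define u where "u = (\<lambda>S. MIN \<theta>\<in>S. ell2 I \<theta> (rec \<theta>))"
  have "\<exists>\<theta>\<in>S. u S = ell2 I \<theta> (rec \<theta>)" if "S \<in> \<B>" for S
  proof -
    have "u S \<in> (\<lambda>\<theta>. ell2 I \<theta> (rec \<theta>)) ` S" 
      unfolding u_def using block_basic(2,3)[OF that] by (intro Min_in) auto
    then show ?thesis by blast
  qed
  then obtain t where t: "\<And>S. S \<in> \<B> \<Longrightarrow> t S \<in> S" "\<And>S. S \<in> \<B> \<Longrightarrow> u S = ell2 I (t S) (rec (t S))"
    by metis
  have tD: "t S \<in> D" if "S \<in> \<B>" for S using t(1)[OF that] block_basic(1)[OF that] by blast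
  have "\<exists>m::int. t S p - rec (t S) p = of_int m * \<phi>" if S: "S \<in> \<B>" for S p
  proof -
    have "rec (t S) \<in> D" by (rule R_D(1)[OF rec_mem_class[OF tD[OF S]]])
    then obtain b where "rec (t S) p = of_int b * \<phi>" using grid_multiple by metis
    moreover obtain a where "t S p = of_int a * \<phi>" using grid_multiple[OF tD[OF S]] by metis
    ultimately show ?thesis by (intro exI[of _ "a - b"]) (simp add: left_diff_distrib)
  qed
  then obtain m :: "_ \<Rightarrow> _ \<Rightarrow> int"
    where m: "\<And>S p. S \<in> \<B> \<Longrightarrow> t S p - rec (t S) p = of_int (m S p) * \<phi>" by metis
  have m_0_iff: "m S p = 0 \<longleftrightarrow> ident p (t S p) (\<theta>s p)" if "S \<in> \<B>" for S p
  proof -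
    have "m S p = 0 \<longleftrightarrow> t S p = rec (t S) p" using m[OF that, of p] \<phi>_pos by auto
    then show ?thesis by (auto simp: recenter_def)
  qed
  have fin\<B>: "finite \<B>"
    by (rule finite_subset[of _ "Pow D"]) (use finite_D block_basic(1) in auto)
  define V where "V = (\<Union>S\<in>\<B>. m S ` cells I n)"
  have finV: "finite V" unfolding V_def by (intro finite_UN_I finite_imageI finite_cells fin\<B>)
  define v where "v = (\<lambda>S. restrict (m S) (cells I n))"
  have v_inj: "inj_on v \<B>"
  proof (rule inj_onI)
    fix S S' assume S: "S \<in> \<B>" "S' \<in> \<B>" and eq: "v S = v S'"
    have "ident p (t S p) (t S' p)" for p
    proof (cases "p \<in> cells I n")
      case True
      then have mm: "m S p = m S' p" using fun_cong[OF eq, of p] by (simp add: v_def)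
      show ?thesis
      proof (cases "m S p = 0")
        case True
        have i: "ident p (t S p) (\<theta>s p)" "ident p (t S' p) (\<theta>s p)"
          using m_0_iff[OF S(1), of p] m_0_iff[OF S(2), of p] mm True by auto
        show ?thesis by (rule identified_trans[OF i(1) identified_sym[OF i(2)]])
      next
        case False
        then have "rec (t S) p = \<theta>s p" "rec (t S') p = \<theta>s p"
          using m_0_iff[OF S(1), of p] m_0_iff[OF S(2), of p] mm by (simp_all add: recenter_def)
        then have "t S p = t S' p"
          using m[OF S(1), of p] m[OF S(2), of p] unfolding mm by linarith
        then show ?thesis by (simp only: identified_refl)
      qed
    next
      case False
      show ?thesis
        unfolding grid_outside[OF tD[OF S(1)] False] grid_outside[OF tD[OF S(2)] False] by simp
    qed
    then have "(t S, t S') \<in> R" by (intro R_I tD S)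
    then show "S = S'" by (rule block_eqI[OF S t(1)[OF S(1)] t(1)[OF S(2)]])
  qed
  have v_PiE: "v ` \<B> \<subseteq> PiE (cells I n) (\<lambda>_. V)" by (auto simp: v_def V_def)
  have u_sq: "(u S)\<^sup>2 = (\<Sum>p\<in>cells I n. of_int ((m S p)\<^sup>2)) * \<phi>\<^sup>2" if S: "S \<in> \<B>" for S
  proof -
    have "(u S)\<^sup>2 = (\<Sum>p\<in>cells I n. (t S p - rec (t S) p)\<^sup>2)"
      unfolding t(2)[OF S]
    proof (rule ell2_square_eq_sum)
      fix p assume p: "p \<notin> cells I n"
      then have "ident p (t S p) (\<theta>s p)" using grid_outside[OF tD[OF S]] grid_outside[OF \<theta>s_grid] by simp
      then show "t S p = rec (t S) p" by (simp add: recenter_def)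
    qed (auto simp: cells_def[abs_def] finite_cells[unfolded cells_def])
    then show ?thesis by (simp add: m[OF S] power_mult_distrib sum_distrib_right)
  qed
  \<comment> \<open>A block outside the class of \<open>\<theta>s\<close> has at least one displaced coordinate, hence a full grid step.\<close>
  have u_ge: "\<phi>\<^sup>2 \<le> (u S)\<^sup>2" if S: "S \<in> \<B>" for S
  proof -
    have "\<exists>p\<in>cells I n. m S p \<noteq> 0"
    proof (rule ccontr)
      assume "\<not> ?thesis"
      then have "ident p (t S p) (\<theta>s p)" for p
        using m_0_iff[OF S] grid_outside[OF tD[OF S]] grid_outside[OF \<theta>s_grid] by (cases "p \<in> cells I n") auto
      then have "(t S, \<theta>s) \<in> R" by (intro R_I tD S \<theta>s_grid)
      then show False using block_not_center[OF S t(1)[OF S]] by blast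
    qed
    then obtain p where p: "p \<in> cells I n" "m S p \<noteq> 0" by blast
    have "1 \<le> (m S p)\<^sup>2" using p(2) by (simp add: int_one_le_iff_zero_less)
    then have "1 \<le> (of_int ((m S p)\<^sup>2) :: real)" by (simp only: of_int_1_le_iff)
    also have "\<dots> \<le> (\<Sum>p\<in>cells I n. of_int ((m S p)\<^sup>2))"
      by (rule member_le_sum[OF p(1)]) auto
    finally show ?thesis unfolding u_sq[OF S] using mult_right_mono[of 1 _ "\<phi>\<^sup>2"] by simp
  qed
  define q where "q = 1 / real n"
  have q: "0 < q" "q \<le> 1/2" using n_ge_2 by (auto simp: q_def)
  have exp_n: "exp (- (ln (real n) * x)) \<le> q ^ nat \<bar>k\<bar>" if "x = of_int (k\<^sup>2)" for x and k :: int
  proof -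
    have "\<bar>k\<bar> \<le> \<bar>k\<bar>\<^sup>2"
      using self_le_power[of "\<bar>k\<bar>" 2] by (cases "k = 0") auto
    then have "\<bar>k\<bar> \<le> k\<^sup>2" by simp
    then have "(of_int \<bar>k\<bar> :: real) \<le> x" unfolding that by (simp only: of_int_le_iff)
    moreover have "real (nat \<bar>k\<bar>) = of_int \<bar>k\<bar>" by simp
    ultimately have "real (nat \<bar>k\<bar>) \<le> x" by linarith
    then have "ln (real n) * real (nat \<bar>k\<bar>) \<le> ln (real n) * x"
      using n_ge_2 by (intro mult_left_mono) auto
    then have "exp (- (ln (real n) * x)) \<le> exp (real (nat \<bar>k\<bar>) * - ln (real n))" by (simp add: mult.commute)
    also have "\<dots> = q ^ nat \<bar>k\<bar>"
      unfolding exp_of_nat_mult q_def using n_ge_2 by (simp add: exp_minus field_simps)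
    finally show ?thesis .
  qed
  let ?W = "exp (- (1 / (\<phi>0\<^sup>2 * C\<^sup>2)) * real n * \<omega>\<^sup>2)"
  have term_le: "exp (- (2 / \<phi>0\<^sup>2) * real n * (u S)\<^sup>2) \<le> (\<Prod>p\<in>cells I n. q ^ nat \<bar>v S p\<bar>) * ?W"
    if S: "S \<in> \<B>" for S
  proof -
    have \<omega>: "\<omega>\<^sup>2 \<le> C\<^sup>2 * (u S)\<^sup>2"
    proof -
      have "\<omega>\<^sup>2 \<le> (C * \<phi>)\<^sup>2" using mod by (intro power_mono) auto
      also have "\<dots> \<le> C\<^sup>2 * (u S)\<^sup>2"
        unfolding power_mult_distrib by (intro mult_left_mono u_ge S) auto
      finally show ?thesis .
    qed
    \<comment> \<open>One half of the exponent pays for the summation over blocks, the other half for the modulus.\<close>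
    have half1: "real n / \<phi>0\<^sup>2 * (u S)\<^sup>2 = ln (real n) * (\<Sum>p\<in>cells I n. of_int ((m S p)\<^sup>2))"
    proof -
      have "real n / \<phi>0\<^sup>2 * (u S)\<^sup>2 = (real n * \<phi>\<^sup>2) / \<phi>0\<^sup>2 * (\<Sum>p\<in>cells I n. of_int ((m S p)\<^sup>2))"
        unfolding u_sq[OF S] by simp
      then show ?thesis unfolding n_phi_square[OF n_ge_2] using \<phi>0_pos by simp
    qed
    have half2: "1 / (\<phi>0\<^sup>2 * C\<^sup>2) * real n * \<omega>\<^sup>2 \<le> real n / \<phi>0\<^sup>2 * (u S)\<^sup>2"
    proof -
      have "1 / (\<phi>0\<^sup>2 * C\<^sup>2) * real n * \<omega>\<^sup>2 \<le> 1 / (\<phi>0\<^sup>2 * C\<^sup>2) * real n * (C\<^sup>2 * (u S)\<^sup>2)"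
        using \<omega> by (intro mult_left_mono) auto
      also have "\<dots> = real n / \<phi>0\<^sup>2 * (u S)\<^sup>2" using C by simp
      finally show ?thesis .
    qed
    have "- (2 / \<phi>0\<^sup>2) * real n * (u S)\<^sup>2 = - (real n / \<phi>0\<^sup>2 * (u S)\<^sup>2) + - (real n / \<phi>0\<^sup>2 * (u S)\<^sup>2)"
      by simp
    also have "\<dots> \<le> - (ln (real n) * (\<Sum>p\<in>cells I n. of_int ((m S p)\<^sup>2))) + - (1 / (\<phi>0\<^sup>2 * C\<^sup>2) * real n * \<omega>\<^sup>2)"
      using half1 half2 by linarith
    finally have "exp (- (2 / \<phi>0\<^sup>2) * real n * (u S)\<^sup>2)
        \<le> exp (- (ln (real n) * (\<Sum>p\<in>cells I n. of_int ((m S p)\<^sup>2)))) * ?W"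
      by (simp add: exp_add[symmetric])
    also have "exp (- (ln (real n) * (\<Sum>p\<in>cells I n. of_int ((m S p)\<^sup>2))))
        = (\<Prod>p\<in>cells I n. exp (- (ln (real n) * of_int ((m S p)\<^sup>2))))"
      by (simp only: sum_distrib_left sum_negf[symmetric] exp_sum[OF finite_cells])
    also have "\<dots> \<le> (\<Prod>p\<in>cells I n. q ^ nat \<bar>v S p\<bar>)"
    proof (intro prod_mono conjI)
      fix p assume "p \<in> cells I n"
      then have "v S p = m S p" by (simp add: v_def)
      then show "exp (- (ln (real n) * of_int ((m S p)\<^sup>2))) \<le> q ^ nat \<bar>v S p\<bar>" using exp_n[OF refl] by simp
    qed simp
    finally show ?thesis by (simp add: mult_right_mono)
  qed
  have "(\<Sum>S\<in>\<B>. exp (- (2 / \<phi>0\<^sup>2) * real n * (u S)\<^sup>2))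
      \<le> (\<Sum>S\<in>\<B>. (\<Prod>p\<in>cells I n. q ^ nat \<bar>v S p\<bar>) * ?W)"
    by (intro sum_mono term_le)
  also have "\<dots> = (\<Sum>g\<in>v ` \<B>. \<Prod>p\<in>cells I n. q ^ nat \<bar>g p\<bar>) * ?W"
    by (simp add: sum_distrib_right sum.reindex[OF v_inj])
  also have "\<dots> \<le> (\<Sum>g\<in>PiE (cells I n) (\<lambda>_. V). \<Prod>p\<in>cells I n. q ^ nat \<bar>g p\<bar>) * ?W"
    using q v_PiE finV by (intro mult_right_mono sum_mono2 finite_PiE finite_cells prod_nonneg) auto
  also have "(\<Sum>g\<in>PiE (cells I n) (\<lambda>_. V). \<Prod>p\<in>cells I n. q ^ nat \<bar>g p\<bar>)
      = (\<Prod>p\<in>cells I n. \<Sum>k\<in>V. q ^ nat \<bar>k\<bar>)"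
    by (rule prod_sum_PiE[symmetric]) (auto simp: finV)
  also have "\<dots> \<le> (\<Prod>p\<in>cells I n. exp (4 * q))"
  proof (intro prod_mono conjI)
    have "(\<Sum>k\<in>V. q ^ nat \<bar>k\<bar>) \<le> (\<Sum>k\<in>insert 0 (V - {0}). q ^ nat \<bar>k\<bar>)"
      using q finV by (intro sum_mono2) auto
    also have "\<dots> = 1 + (\<Sum>k\<in>V - {0}. q ^ nat \<bar>k\<bar>)" 
      by (subst sum.insert) (use finV in auto)
    also have "\<dots> \<le> 1 + 4 * q" using q finV by (intro add_left_mono sum_power_abs_le) auto
    also have "\<dots> \<le> exp (4 * q)" by (rule exp_ge_add_one_self)
    finally show "(\<Sum>k\<in>V. q ^ nat \<bar>k\<bar>) \<le> exp (4 * q)" .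
  qed (use q in \<open>auto intro: sum_nonneg\<close>)
  also have "(\<Prod>p\<in>cells I n. exp (4 * q)) = exp (real (card (cells I n)) * (4 * q))"
    by (simp add: exp_of_nat_mult)
  also have "\<dots> \<le> exp (4 * c2 * real n * (4 * q))"
    using card_cells_le[of n] n_ge_2 q by (simp add: mult_right_mono)
  also have "4 * c2 * real n * (4 * q) = 16 * c2" using n_ge_2 by (simp add: q_def)
  finally show ?thesis unfolding u_def by (simp add: mult_right_mono)
qed

end

end

context dyadic_index
begin

text \<open>
  The tail conditions make the class of \<open>\<theta>s\<close> lie in the ball, with three quarters of a grid step in the role of
  the per-coordinate error. The constants are \<open>K0 = 2 / \<phi>0\<^sup>2\<close>, for which each half of the exponent is an integer
  multiple of \<open>log n\<close>, and \<open>K1 = 1 / (\<phi>0\<^sup>2 C\<^sup>2)\<close>, where \<open>C \<phi>\<^sub>n\<close> bounds the modulus.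
\<close>

lemma partition_bound:
  assumes pos: "0 < \<phi>0" "0 < \<beta>1" "0 < L" "0 < b0"
    and index: "\<And>\<theta>. \<theta> \<in> hoelder I \<beta>1 L \<Longrightarrow> index \<theta> \<in> {\<beta>1..\<beta>2} \<and> \<theta> \<in> hoelder I (index \<theta>) L"
    and cutoff: "tail_cutoff I \<phi>0 \<beta>1 \<beta>2 L b0 J"
    and A: "4 * (3 * \<phi>0 * sqrt b0 + 1) \<le> A"
  shows "\<exists>C0>0. \<exists>K0>0. \<exists>K1>0. \<forall>n\<ge>2. \<forall>\<theta>0\<in>hoelder I \<beta>1 L. \<forall>\<theta>s. near_grid_point I \<phi>0 L n \<theta>0 \<theta>s \<longrightarrow>
    (let B0 = block0 I \<phi>0 L n \<theta>0 (A * rate (index \<theta>0) n);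
         \<B> = blocks I \<phi>0 L n \<theta>0 \<theta>s (A * rate (index \<theta>0) n) in
      equiv (grid I \<phi>0 L n) (d1_rel I \<phi>0 L n \<theta>0) \<and>
      admissible I (grid I \<phi>0 L n) \<theta>0 A (rate (index \<theta>0) n) B0 \<B> \<and>
      (separated I (hoelder I \<beta>1 L) (\<lambda>\<theta>. rate (index \<theta>) n) \<theta>0 \<noteq> {} \<longrightarrow>
        (\<exists>f. (\<forall>S\<in>\<B>. inj_on (f S) S \<and> f S ` S \<subseteq> B0) \<and>
          (\<Sum>S\<in>\<B>. exp (- K0 * real n * (MIN \<theta>\<in>S. ell2 I \<theta> (f S \<theta>))\<^sup>2))
            \<le> C0 * exp (- K1 * real n * (modulus I (hoelder I \<beta>1 L) (\<lambda>\<theta>. rate (index \<theta>) n) \<theta>0)\<^sup>2))))"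
proof -
  let ?H = "hoelder I \<beta>1 L"
  obtain C where C: "0 < C" and modulus: "\<And>n \<theta>0. 2 \<le> n \<Longrightarrow> \<theta>0 \<in> ?H \<Longrightarrow>
      separated I ?H (\<lambda>\<theta>. rate (index \<theta>) n) \<theta>0 \<noteq> {} \<Longrightarrow>
      modulus I ?H (\<lambda>\<theta>. rate (index \<theta>) n) \<theta>0 \<le> C * phi \<phi>0 n"
    using modulus_le_phi[OF pos(1-3), of index] index by (meson atLeastAtMost_iff)
  define K where "K = 1 / (\<phi>0\<^sup>2 * C\<^sup>2)"
  have K: "0 < K" using pos C by (simp add: K_def)
  have A_pos: "0 < A" "3 * \<phi>0 * sqrt b0 + 1 \<le> A"
  proof -
    have "0 \<le> 3 * \<phi>0 * sqrt b0" using pos by simp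
    with A show "0 < A" "3 * \<phi>0 * sqrt b0 + 1 \<le> A" unfolding distrib_left by linarith+
  qed
  have main: "equiv (grid I \<phi>0 L n) (d1_rel I \<phi>0 L n \<theta>0) \<and>
      admissible I (grid I \<phi>0 L n) \<theta>0 A (rate (index \<theta>0) n)
        (block0 I \<phi>0 L n \<theta>0 (A * rate (index \<theta>0) n)) (blocks I \<phi>0 L n \<theta>0 \<theta>s (A * rate (index \<theta>0) n)) \<and>
      (separated I ?H (\<lambda>\<theta>. rate (index \<theta>) n) \<theta>0 \<noteq> {} \<longrightarrow>
        (\<exists>f. (\<forall>S\<in>blocks I \<phi>0 L n \<theta>0 \<theta>s (A * rate (index \<theta>0) n).
              inj_on (f S) S \<and> f S ` S \<subseteq> block0 I \<phi>0 L n \<theta>0 (A * rate (index \<theta>0) n)) \<and>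
          (\<Sum>S\<in>blocks I \<phi>0 L n \<theta>0 \<theta>s (A * rate (index \<theta>0) n).
              exp (- (2 / \<phi>0\<^sup>2) * real n * (MIN \<theta>\<in>S. ell2 I \<theta> (f S \<theta>))\<^sup>2))
            \<le> exp (16 * c2) * exp (- K * real n * (modulus I ?H (\<lambda>\<theta>. rate (index \<theta>) n) \<theta>0)\<^sup>2)))"
    if n: "2 \<le> n" and \<theta>0: "\<theta>0 \<in> ?H" and near: "near_grid_point I \<phi>0 L n \<theta>0 \<theta>s" for n \<theta>0 \<theta>s
  proof -
    interpret grid_partition I c1 c2 \<phi>0 L n \<theta>0 \<theta>s
      by unfold_locales (use n pos near in auto)
    let ?\<beta> = "index \<theta>0"
    have \<beta>: "?\<beta> \<in> {\<beta>1..\<beta>2}" "\<theta>0 \<in> hoelder I ?\<beta> L" using index[OF \<theta>0] by auto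
    have \<beta>_pos: "0 < ?\<beta>" using \<beta>(1) pos by auto
    have cut: "2 powr real_of_int (J n ?\<beta>) \<le> b0 * (real n / ln (real n)) powr (1 / (2 * ?\<beta> + 1))"
      "\<And>j k. k \<in> I j \<Longrightarrow> int j > J n ?\<beta> \<Longrightarrow> \<bar>\<theta>0 (j, k)\<bar> \<le> \<phi> / 4"
      "(\<Sum>j. if int j > J n ?\<beta> then 2 powr (real j / 2) * (MAX k\<in>I j. \<bar>\<theta>0 (j, k)\<bar>) else 0) \<le> rate ?\<beta> n"
      using cutoff n \<beta> unfolding tail_cutoff_def Lam_def by blast+
    have class_le: "ell_inf I \<theta> \<theta>0 \<le> A * rate ?\<beta> n" if R: "(\<theta>, \<theta>s) \<in> R" for \<theta>
    proof -
      have "ell_inf I \<theta> \<theta>0 \<le> (4 * (3/4) * \<phi>0 * sqrt b0 + 1) * rate ?\<beta> n"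
      proof (rule ell_inf_le_rate[OF n \<beta>_pos \<beta>(2) _ _ cut(1) cut(3)])
        fix j k assume k: "k \<in> I j"
        then have p: "(j, k) \<in> Lam I" by (simp add: Lam_def)
        show "\<bar>\<theta> (j, k) - \<theta>0 (j, k)\<bar> \<le> 3/4 * \<phi>" by (rule class_\<theta>s_near[OF R p])
        show "\<theta> (j, k) = 0" if "int j > J n ?\<beta>" by (rule class_\<theta>s_zero[OF R p cut(2)[OF k that]])
      qed (use pos in auto)
      also have "\<dots> \<le> A * rate ?\<beta> n"
        using A_pos rate_pos[OF n, of ?\<beta>] by (intro mult_right_mono) auto
      finally show ?thesis .
    qed
    note part = equiv_R admissible_partition[OF class_le refl A_pos(1)]
      rec_inj_on_block[OF class_le] rec_image_subset[OF class_le]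
    have sum: "(\<Sum>S\<in>blocks I \<phi>0 L n \<theta>0 \<theta>s (A * rate (index \<theta>0) n).
        exp (- (2 / \<phi>0\<^sup>2) * real n * (MIN \<theta>\<in>S. ell2 I \<theta> (rec \<theta>))\<^sup>2))
      \<le> exp (16 * c2) * exp (- K * real n * (modulus I ?H (\<lambda>\<theta>. rate (index \<theta>) n) \<theta>0)\<^sup>2)"
      if "separated I ?H (\<lambda>\<theta>. rate (index \<theta>) n) \<theta>0 \<noteq> {}"
      unfolding K_def
      by (rule sum_blocks_le[OF class_le C modulus_nonneg[OF that] modulus[OF n \<theta>0 that]])
    show ?thesis
      using part sum by (intro conjI impI exI[of _ "\<lambda>_. rec"] ballI) blast+
  qed
  have "0 < exp (16 * c2)" "0 < 2 / \<phi>0\<^sup>2" using pos by auto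
  then show ?thesis using main K unfolding Let_def by blast
qed

end

section \<open>The sieve posterior\<close>

text \<open>Completing the square: exponential tilting shifts the mean of a normal density.\<close>

lemma normal_exp_moment:
  assumes \<sigma>: "0 < \<sigma>"
  shows "has_bochner_integral lborel (\<lambda>t. normal_density \<mu> \<sigma> t * exp (s * (t - c)))
    (exp (s * (\<mu> - c) + s\<^sup>2 * \<sigma>\<^sup>2 / 2))"
proof -
  have "normal_density \<mu> \<sigma> t * exp (s * (t - c))
      = exp (s * (\<mu> - c) + s\<^sup>2 * \<sigma>\<^sup>2 / 2) * normal_density (\<mu> + s * \<sigma>\<^sup>2) \<sigma> t" for t
  proof -
    have "- (t - \<mu>)\<^sup>2 / (2 * \<sigma>\<^sup>2) + s * (t - c)
        = s * (\<mu> - c) + s\<^sup>2 * \<sigma>\<^sup>2 / 2 + - (t - (\<mu> + s * \<sigma>\<^sup>2))\<^sup>2 / (2 * \<sigma>\<^sup>2)"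
      using \<sigma> by (simp add: field_simps power2_eq_square)
    then show ?thesis unfolding normal_density_def by (simp add: exp_add[symmetric])
  qed
  then show ?thesis
    using \<sigma> has_bochner_integral_mult_right[of "exp (s * (\<mu> - c) + s\<^sup>2 * \<sigma>\<^sup>2 / 2)" lborel
      "normal_density (\<mu> + s * \<sigma>\<^sup>2) \<sigma>" 1]
    by (simp add: has_bochner_integral_iff)
qed

context dyadic_index
begin

lemma white_noise_component:
  assumes n: "0 < n" and p: "p \<in> Lam I"
  shows "distr (white_noise I n \<theta>) borel (\<lambda>y. y p) = density lborel (normal_density (\<theta> p) (1 / sqrt (real n)))"
proof -
  let ?N = "\<lambda>p. density lborel (\<lambda>x. ennreal (normal_density (\<theta> p) (1 / sqrt (real n)) x))"
  have "distr (white_noise I n \<theta>) borel (\<lambda>y. y p) = distr (PiM (Lam I) ?N) (?N p) (\<lambda>y. y p)"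
    unfolding white_noise_eq_PiM[OF n] by (rule distr_cong) auto
  also have "\<dots> = ?N p"
    by (rule distr_PiM_component[OF _ p]) (intro prob_space_normal_density, use n in simp)
  finally show ?thesis .
qed

lemma likelihood_eq_prod_cells:
  assumes n: "0 < n" and \<theta>: "\<And>p. p \<notin> cells I n \<Longrightarrow> \<theta> p = 0"
  shows "likelihood I n \<theta> y = (\<Prod>p\<in>cells I n.
    normal_density (\<theta> p) (1 / sqrt (real n)) (y p) / normal_density 0 (1 / sqrt (real n)) (y p))"
  unfolding likelihood_def
proof (intro prod.mono_neutral_left ballI)
  show "{p \<in> Lam I. \<theta> p \<noteq> 0} \<subseteq> cells I n" using \<theta> by blast
next
  fix p assume "p \<in> cells I n - {p \<in> Lam I. \<theta> p \<noteq> 0}"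
  then have "\<theta> p = 0" by (auto simp: cells_def)
  then show "normal_density (\<theta> p) (1 / sqrt (real n)) (y p) / normal_density 0 (1 / sqrt (real n)) (y p) = 1"
    using normal_density_pos[of "1 / sqrt (real n)" 0 "y p"] n by simp
qed simp

lemma likelihood_update:
  assumes n: "0 < n" and \<theta>: "\<And>p. p \<notin> cells I n \<Longrightarrow> \<theta> p = 0" and p: "p \<in> cells I n"
  shows "likelihood I n \<theta> y = exp (real n * (\<theta> p - w) * (y p - (\<theta> p + w) / 2)) * likelihood I n (\<theta>(p := w)) y"
proof -
  let ?s = "1 / sqrt (real n)"
  let ?r = "\<lambda>\<theta> p. normal_density (\<theta> p) ?s (y p) / normal_density 0 ?s (y p)"
  have e: "- (y p - \<theta> p)\<^sup>2 / (2 * ?s\<^sup>2) = real n * (\<theta> p - w) * (y p - (\<theta> p + w) / 2) + - (y p - w)\<^sup>2 / (2 * ?s\<^sup>2)"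
    using n by (simp add: power_divide field_simps power2_eq_square)
  have "normal_density (\<theta> p) ?s (y p) = exp (real n * (\<theta> p - w) * (y p - (\<theta> p + w) / 2)) * normal_density w ?s (y p)"
    unfolding normal_density_def e exp_add by (simp only: mult_ac)
  then have ratio: "?r \<theta> p = exp (real n * (\<theta> p - w) * (y p - (\<theta> p + w) / 2)) * ?r (\<theta>(p := w)) p" by simp
  have "likelihood I n \<theta> y = (\<Prod>p\<in>cells I n. ?r \<theta> p)"
    by (rule likelihood_eq_prod_cells[OF n \<theta>])
  also have "\<dots> = ?r \<theta> p * (\<Prod>p\<in>cells I n - {p}. ?r \<theta> p)"
    by (rule prod.remove[OF finite_cells p])
  also have "(\<Prod>p\<in>cells I n - {p}. ?r \<theta> p) = (\<Prod>q\<in>cells I n - {p}. ?r (\<theta>(p := w)) q)"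
    by (intro prod.cong) auto
  finally have "likelihood I n \<theta> y = exp (real n * (\<theta> p - w) * (y p - (\<theta> p + w) / 2)) *
      (?r (\<theta>(p := w)) p * (\<Prod>q\<in>cells I n - {p}. ?r (\<theta>(p := w)) q))"
    unfolding ratio by (simp only: mult.assoc)
  also have "?r (\<theta>(p := w)) p * (\<Prod>q\<in>cells I n - {p}. ?r (\<theta>(p := w)) q) = (\<Prod>q\<in>cells I n. ?r (\<theta>(p := w)) q)"
    by (rule prod.remove[OF finite_cells p, symmetric])
  also have "\<dots> = likelihood I n (\<theta>(p := w)) y"
    by (rule likelihood_eq_prod_cells[OF n, symmetric]) (use \<theta> p in auto)
  finally show ?thesis .
qed

end

locale sieve = dyadic_index I c1 c2 for I :: "nat \<Rightarrow> 'k set" and c1 c2 +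
  fixes \<phi>0 L :: real and n :: nat
  assumes n_ge_2: "2 \<le> n" and \<phi>0_pos: "0 < \<phi>0" and L_pos: "0 < L"
begin

abbreviation "\<phi> \<equiv> phi \<phi>0 n"
abbreviation "D \<equiv> grid I \<phi>0 L n"
abbreviation "lik \<equiv> likelihood I n"
abbreviation "post \<equiv> posterior I n (sieve_prior I \<phi>0 L n)"

lemma n_pos: "0 < n" using n_ge_2 by simp

lemma finite_D [simp]: "finite D"
  by (rule finite_grid[OF n_ge_2 \<phi>0_pos])

lemma D_nonempty: "D \<noteq> {}"
  using zero_mem_grid[of L] L_pos by fastforce

lemma evidence_pos: "0 < (\<Sum>\<theta>\<in>D. lik \<theta> y)"
  by (intro sum_pos finite_D D_nonempty likelihood_pos n_pos)

lemma post_eq: "post y B = (\<Sum>\<theta>\<in>D \<inter> B. lik \<theta> y) / (\<Sum>\<theta>\<in>D. lik \<theta> y)"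
proof -
  have set: "set_pmf (sieve_prior I \<phi>0 L n) = D"
    unfolding sieve_prior_def by (rule set_pmf_of_set[OF D_nonempty finite_D])
  have pmf: "pmf (sieve_prior I \<phi>0 L n) \<theta> = 1 / real (card D)" if "\<theta> \<in> D" for \<theta>
    unfolding sieve_prior_def using that by (simp add: pmf_of_set[OF D_nonempty finite_D])
  have "post y B = (\<Sum>\<theta>\<in>D. 1 / real (card D) * (indicator B \<theta> * lik \<theta> y)) / (\<Sum>\<theta>\<in>D. 1 / real (card D) * lik \<theta> y)"
    by (subst posterior_eq_sum) (simp_all add: set pmf cong: sum.cong)
  also have "\<dots> = (\<Sum>\<theta>\<in>D. indicator B \<theta> * lik \<theta> y) / (\<Sum>\<theta>\<in>D. lik \<theta> y)"
    unfolding sum_distrib_left[symmetric] using D_nonempty by simp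
  also have "(\<Sum>\<theta>\<in>D. indicator B \<theta> * lik \<theta> y) = (\<Sum>\<theta>\<in>D \<inter> B. lik \<theta> y)"
    unfolding sum.inter_restrict[OF finite_D] by (intro sum.cong) (auto simp: indicator_def)
  finally show ?thesis .
qed

lemma post_nonneg: "0 \<le> post y B"
  unfolding post_eq using evidence_pos[of y] by (intro divide_nonneg_pos sum_nonneg likelihood_nonneg) auto

lemma post_le_1: "post y B \<le> 1"
proof -
  have "(\<Sum>\<theta>\<in>D \<inter> B. lik \<theta> y) \<le> (\<Sum>\<theta>\<in>D. lik \<theta> y)"
    by (intro sum_mono2) (auto simp: likelihood_nonneg)
  then show ?thesis unfolding post_eq using evidence_pos[of y] by simp
qed

lemma post_eq_0: "D \<inter> B = {} \<Longrightarrow> post y B = 0"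
  by (simp add: post_eq)

lemma post_measurable: "(\<lambda>y. post y B) \<in> borel_measurable (white_noise I n \<theta>0)"
proof -
  have "lik \<theta> \<in> borel_measurable (white_noise I n \<theta>0)" for \<theta>
    using likelihood_measurable by (simp cong: measurable_cong_sets add: sets_white_noise)
  then show ?thesis unfolding post_eq by measurable
qed

lemma post_integrable: "integrable (white_noise I n \<theta>0) (\<lambda>y. post y B)"
proof -
  interpret prob_space "white_noise I n \<theta>0" by (rule prob_space_white_noise[OF n_pos])
  show ?thesis
    by (rule integrable_const_bound[of _ 1, OF _ post_measurable])
      (simp add: post_nonneg post_le_1)
qed

lemma post_subadditive:
  assumes "finite A" "D \<inter> B \<subseteq> (\<Union>i\<in>A. E i)"
  shows "post y B \<le> (\<Sum>i\<in>A. post y (E i))"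
proof -
  have "(\<Sum>\<theta>\<in>D \<inter> B. lik \<theta> y) = (\<Sum>\<theta>\<in>D. if \<theta> \<in> B then lik \<theta> y else 0)"
    by (rule sum.inter_restrict[OF finite_D])
  also have "\<dots> \<le> (\<Sum>\<theta>\<in>D. \<Sum>i\<in>A. if \<theta> \<in> E i then lik \<theta> y else 0)"
  proof (rule sum_mono)
    fix \<theta> assume \<theta>: "\<theta> \<in> D"
    have nonneg: "0 \<le> (if \<theta> \<in> E i then lik \<theta> y else 0)" for i by (simp add: likelihood_nonneg)
    show "(if \<theta> \<in> B then lik \<theta> y else 0) \<le> (\<Sum>i\<in>A. if \<theta> \<in> E i then lik \<theta> y else 0)"
    proof (cases "\<theta> \<in> B")
      case True
      then obtain i where i: "i \<in> A" "\<theta> \<in> E i" using assms(2) \<theta> by blast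
      then show ?thesis
        using member_le_sum[of i A "\<lambda>i. if \<theta> \<in> E i then lik \<theta> y else 0"] True nonneg assms(1) by simp
    qed (simp add: sum_nonneg nonneg)
  qed
  also have "\<dots> = (\<Sum>i\<in>A. \<Sum>\<theta>\<in>D. if \<theta> \<in> E i then lik \<theta> y else 0)" by (rule sum.swap)
  also have "\<dots> = (\<Sum>i\<in>A. \<Sum>\<theta>\<in>D \<inter> E i. lik \<theta> y)"
    by (simp only: sum.inter_restrict[OF finite_D])
  finally show ?thesis
    unfolding post_eq sum_divide_distrib[symmetric] using evidence_pos[of y] by (intro divide_right_mono) auto
qed

text \<open>
  Changing the value at \<open>p\<close> from \<open>x\<close> to \<open>\<theta>s p\<close> maps the grid points with value \<open>x\<close> at \<open>p\<close> injectively into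
  the grid and divides every likelihood by the same factor, a function of \<open>y p\<close> alone. Hence the posterior
  probability of \<open>x\<close> is at most that likelihood ratio, and, being at most 1, also at most its square root.
\<close>

lemma post_coordinate_le:
  assumes p: "p \<in> cells I n" and \<theta>s: "\<theta>s \<in> D"
  shows "post y {\<theta>. \<theta> p = x} \<le> exp (real n * (x - \<theta>s p) / 2 * (y p - (x + \<theta>s p) / 2))"
proof -
  let ?w = "\<theta>s p" and ?S = "D \<inter> {\<theta>. \<theta> p = x}"
  let ?e = "real n * (x - ?w) * (y p - (x + ?w) / 2)"
  let ?u = "\<lambda>\<theta>::nat \<times> 'k \<Rightarrow> real. \<theta>(p := ?w)"
  have "(\<Sum>\<theta>\<in>?S. lik \<theta> y) = (\<Sum>\<theta>\<in>?S. exp ?e * lik (?u \<theta>) y)"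
  proof (intro sum.cong refl)
    fix \<theta> assume "\<theta> \<in> ?S"
    then have \<theta>: "\<theta> \<in> D" "\<theta> p = x" by auto
    show "lik \<theta> y = exp ?e * lik (?u \<theta>) y"
      using likelihood_update[OF n_pos grid_outside[OF \<theta>(1)] p, where y = y and w = ?w] \<theta>(2) by simp
  qed
  also have "\<dots> = exp ?e * (\<Sum>\<theta>\<in>?u ` ?S. lik \<theta> y)"
  proof -
    have "inj_on ?u ?S"
    proof (rule inj_onI)
      fix \<theta> \<theta>' assume "\<theta> \<in> ?S" "\<theta>' \<in> ?S" "?u \<theta> = ?u \<theta>'"
      then show "\<theta> = \<theta>'" by (auto simp: fun_eq_iff split: if_splits) metis
    qed
    then show ?thesis by (simp add: sum.reindex sum_distrib_left)
  qed
  also have "\<dots> \<le> exp ?e * (\<Sum>\<theta>\<in>D. lik \<theta> y)"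
  proof (intro mult_left_mono sum_mono2)
    show "?u ` ?S \<subseteq> D"
    proof
      fix \<eta> assume "\<eta> \<in> ?u ` ?S"
      then obtain \<theta> where "\<theta> \<in> D" "\<eta> = ?u \<theta>" by blast
      then show "\<eta> \<in> D" using grid_mix[OF _ \<theta>s, of \<theta> \<eta>] by simp
    qed
  qed (auto simp: likelihood_nonneg)
  finally have le: "post y {\<theta>. \<theta> p = x} \<le> exp ?e"
    unfolding post_eq using evidence_pos[of y] by (simp add: divide_le_eq)
  have "post y {\<theta>. \<theta> p = x} * post y {\<theta>. \<theta> p = x} \<le> exp ?e * 1"
    by (intro mult_mono le post_le_1 post_nonneg) auto
  also have "\<dots> = (exp (?e / 2))\<^sup>2" by (simp add: power2_eq_square exp_add[symmetric])
  finally have "(post y {\<theta>. \<theta> p = x})\<^sup>2 \<le> (exp (?e / 2))\<^sup>2" by (simp add: power2_eq_square)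
  then have "post y {\<theta>. \<theta> p = x} \<le> exp (?e / 2)" by (rule power2_le_imp_le) simp
  then show ?thesis by simp
qed

text \<open>
  For a truth equal to \<open>\<theta>s\<close> at \<open>p\<close> this is the Hellinger affinity of the two normal laws; the second term of the
  exponent accounts for the discretisation error of \<open>\<theta>s\<close>.
\<close>

lemma expected_post_coordinate_le:
  assumes p: "p \<in> cells I n" and \<theta>s: "\<theta>s \<in> D"
  shows "(\<integral>y. post y {\<theta>. \<theta> p = \<theta>s p + \<Delta>} \<partial>white_noise I n \<theta>0)
    \<le> exp (- (real n * \<Delta>\<^sup>2 / 8) + real n * \<Delta> * (\<theta>0 p - \<theta>s p) / 2)"
proof -
  let ?W = "white_noise I n \<theta>0" and ?s = "1 / sqrt (real n)" and ?w = "\<theta>s p"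
  let ?x = "?w + \<Delta>"
  let ?f = "\<lambda>t. exp (real n * (?x - ?w) / 2 * (t - (?x + ?w) / 2))"
  let ?v = "exp (real n * (?x - ?w) / 2 * (\<theta>0 p - (?x + ?w) / 2) + (real n * (?x - ?w) / 2)\<^sup>2 * ?s\<^sup>2 / 2)"
  have pL: "p \<in> Lam I" using p by (simp add: cells_def)
  have s: "0 < ?s" using n_pos by simp
  note moment = normal_exp_moment[OF s, of "\<theta>0 p" "real n * (?x - ?w) / 2" "(?x + ?w) / 2"]
  have comp: "(\<lambda>y. y p) \<in> borel_measurable ?W"
    using measurable_component_singleton[OF pL, of "\<lambda>_. borel"]
    by (simp cong: measurable_cong_sets add: sets_white_noise)
  have f_meas: "?f \<in> borel_measurable borel" by measurable
  have "integrable (density lborel (normal_density (\<theta>0 p) ?s)) ?f"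
    using moment by (subst integrable_density) (auto simp: has_bochner_integral_iff)
  then have int: "integrable ?W (\<lambda>y. ?f (y p))"
    unfolding white_noise_component[OF n_pos pL, symmetric] by (subst (asm) integrable_distr_eq[OF comp f_meas])
  have "(\<integral>y. post y {\<theta>. \<theta> p = ?x} \<partial>?W) \<le> (\<integral>y. ?f (y p) \<partial>?W)"
    by (intro integral_mono post_integrable int post_coordinate_le[OF p \<theta>s])
  also have "\<dots> = (\<integral>t. ?f t \<partial>density lborel (normal_density (\<theta>0 p) ?s))"
    unfolding white_noise_component[OF n_pos pL, symmetric] by (rule integral_distr[OF comp f_meas, symmetric])
  also have "\<dots> = ?v"
    using moment by (subst integral_density) (auto simp: has_bochner_integral_iff)
  also have "real n * (?x - ?w) / 2 * (\<theta>0 p - (?x + ?w) / 2) + (real n * (?x - ?w) / 2)\<^sup>2 * ?s\<^sup>2 / 2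
      = - (real n * \<Delta>\<^sup>2 / 8) + real n * \<Delta> * (\<theta>0 p - ?w) / 2"
    using n_pos by (simp add: field_simps power2_eq_square)
  finally show ?thesis .
qed

end

context sieve
begin

text \<open>
  With \<open>\<Delta> = m \<phi>\<^sub>n\<close> the bound for one value is \<open>exp (- n \<phi>\<^sub>n\<^sup>2 (m\<^sup>2 / 8 - |m| r / 2))\<close>, where \<open>r\<close> is the distance of the truth
  to the reference value in grid steps. Either \<open>r \<le> \<delta>\<close>, or \<open>r \<le> 1/2\<close> and \<open>|m| \<ge> 4\<close>, makes this at most \<open>n\<^bsup>-\<kappa>|m|\<^esup>\<close>.
\<close>

lemma expected_post_shift_le:
  fixes m :: int
  assumes p: "p \<in> cells I n" and \<theta>s: "\<theta>s \<in> D" and \<delta>: "0 < \<delta>" "\<delta> \<le> 1/8" and m: "m \<noteq> 0"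
    and close: "\<bar>\<theta>0 p - \<theta>s p\<bar> \<le> \<delta> * \<phi> \<or> \<bar>\<theta>0 p - \<theta>s p\<bar> \<le> \<phi> / 2 \<and> 4 \<le> \<bar>m\<bar>"
  shows "(\<integral>y. post y {\<theta>. \<theta> p = \<theta>s p + of_int m * \<phi>} \<partial>white_noise I n \<theta>0)
    \<le> exp (- (\<phi>0\<^sup>2 * (1 - 4 * \<delta>) / 8 * ln (real n))) ^ nat \<bar>m\<bar>"
proof -
  define a where "a = (of_int \<bar>m\<bar> :: real)"
  define r where "r = \<bar>\<theta>0 p - \<theta>s p\<bar> / \<phi>"
  have \<phi>: "0 < \<phi>" by (rule phi_pos[OF n_ge_2 \<phi>0_pos])
  have a1: "1 \<le> a" using m unfolding a_def by linarith
  have r0: "0 \<le> r" using \<phi> by (simp add: r_def)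
  have close': "r \<le> \<delta> \<or> r \<le> 1/2 \<and> 4 \<le> a"
  proof (cases "\<bar>\<theta>0 p - \<theta>s p\<bar> \<le> \<delta> * \<phi>")
    case True
    then show ?thesis using \<phi> by (simp add: r_def divide_le_eq)
  next
    case False
    then have "\<bar>\<theta>0 p - \<theta>s p\<bar> \<le> \<phi> / 2" "4 \<le> \<bar>m\<bar>" using close by auto
    moreover have "4 \<le> a" using \<open>4 \<le> \<bar>m\<bar>\<close> unfolding a_def by linarith
    ultimately show ?thesis using \<phi> by (simp add: r_def divide_le_eq)
  qed
  have key: "a * ((1 - 4 * \<delta>) / 8) \<le> a\<^sup>2 / 8 - a * r / 2"
  proof -
    have "1 - 4 * \<delta> \<le> a - 4 * r"
      using close'
    proof
      assume "r \<le> \<delta>"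
      then show ?thesis using a1 by linarith
    next
      assume "r \<le> 1/2 \<and> 4 \<le> a"
      then have "4 * r \<le> 2" "4 \<le> a" by auto
      then show ?thesis using \<delta>(1) by linarith
    qed
    then have "(1 - 4 * \<delta>) / 8 \<le> a / 8 - r / 2" by (simp add: field_simps)
    then have "a * ((1 - 4 * \<delta>) / 8) \<le> a * (a / 8 - r / 2)" using a1 by (intro mult_left_mono) auto
    then show ?thesis by (simp add: power2_eq_square algebra_simps)
  qed
  have "of_int m * \<phi> * (\<theta>0 p - \<theta>s p) \<le> \<bar>of_int m * \<phi> * (\<theta>0 p - \<theta>s p)\<bar>" by (rule abs_ge_self)
  also have "\<dots> = a * r * \<phi>\<^sup>2" using \<phi> by (simp add: abs_mult a_def r_def power2_eq_square)
  finally have cross: "of_int m * \<phi> * (\<theta>0 p - \<theta>s p) \<le> a * r * \<phi>\<^sup>2" .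
  have "- (real n * (of_int m * \<phi>)\<^sup>2 / 8) + real n * (of_int m * \<phi>) * (\<theta>0 p - \<theta>s p) / 2
      = real n * (- (a\<^sup>2 * \<phi>\<^sup>2 / 8) + of_int m * \<phi> * (\<theta>0 p - \<theta>s p) / 2)"
    by (simp add: a_def power_mult_distrib algebra_simps)
  also have "\<dots> \<le> real n * (- (a\<^sup>2 * \<phi>\<^sup>2 / 8) + a * r * \<phi>\<^sup>2 / 2)"
    using cross by (intro mult_left_mono) auto
  also have "\<dots> = - (real n * \<phi>\<^sup>2 * (a\<^sup>2 / 8 - a * r / 2))" by (simp add: algebra_simps)
  also have "\<dots> \<le> - (real n * \<phi>\<^sup>2 * (a * ((1 - 4 * \<delta>) / 8)))"
    using mult_left_mono[OF key, of "real n * \<phi>\<^sup>2"] by simp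
  also have "\<dots> = a * - (\<phi>0\<^sup>2 * (1 - 4 * \<delta>) / 8 * ln (real n))"
    unfolding n_phi_square[OF n_ge_2] by simp
  also have "a = real (nat \<bar>m\<bar>)" by (simp add: a_def)
  finally have e: "- (real n * (of_int m * \<phi>)\<^sup>2 / 8) + real n * (of_int m * \<phi>) * (\<theta>0 p - \<theta>s p) / 2
      \<le> real (nat \<bar>m\<bar>) * - (\<phi>0\<^sup>2 * (1 - 4 * \<delta>) / 8 * ln (real n))" .
  show ?thesis
    unfolding exp_of_nat_mult[symmetric]
    by (rule order_trans[OF expected_post_coordinate_le[OF p \<theta>s]]) (use e in simp)
qed

text \<open>
  Up to the cut-off the truth may lie halfway between two grid points, which the data then cannot tell apart; but few
  steps per coordinate do not leave the ball there, so that only displacements by at least four steps count.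
\<close>

definition displaced :: "int \<Rightarrow> nat \<times> 'k \<Rightarrow> int \<Rightarrow> bool"
  where "displaced J p m \<longleftrightarrow> m \<noteq> 0 \<and> (int (fst p) \<le> J \<longrightarrow> 4 \<le> \<bar>m\<bar>)"

text \<open>
  Union bound over coordinates and displacements: at most \<open>4 c2 n\<close> coordinates, each with a geometric series of
  ratio \<open>n\<^bsup>-\<kappa>\<^esup>\<close>.
\<close>

lemma expected_post_displaced_le:
  assumes near: "near_grid_point I \<phi>0 L n \<theta>0 \<theta>s" and \<delta>: "0 < \<delta>" "\<delta> \<le> 1/8"
    and \<kappa>: "\<kappa> = \<phi>0\<^sup>2 * (1 - 4 * \<delta>) / 8" "1 < \<kappa>"
    and fine: "\<And>p. p \<in> cells I n \<Longrightarrow> int (fst p) > J \<Longrightarrow> \<bar>\<theta>0 p - \<theta>s p\<bar> \<le> \<delta> * \<phi>"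
    and B: "\<And>\<theta>. \<theta> \<in> D \<Longrightarrow> \<theta> \<in> B \<Longrightarrow>
      \<exists>p\<in>cells I n. \<exists>m. displaced J p m \<and> \<theta> p = \<theta>s p + of_int m * \<phi>"
  shows "(\<integral>y. post y B \<partial>white_noise I n \<theta>0) \<le> 16 * c2 * real n powr (1 - \<kappa>)"
proof -
  let ?W = "white_noise I n \<theta>0"
  let ?E = "\<lambda>(p, m::int). {\<theta>. \<theta> p = \<theta>s p + of_int m * \<phi>}"
  have \<phi>: "0 < \<phi>" by (rule phi_pos[OF n_ge_2 \<phi>0_pos])
  have \<theta>s: "\<theta>s \<in> D" "\<And>p. p \<in> Lam I \<Longrightarrow> \<bar>\<theta>0 p - \<theta>s p\<bar> \<le> \<phi> / 2"
    using near by (auto simp: near_grid_point_def)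
  \<comment> \<open>Only finitely many displacements occur in the grid.\<close>
  define V where "V = (\<lambda>(\<theta>, p). \<lfloor>(\<theta> p - \<theta>s p) / \<phi>\<rfloor>) ` (D \<times> cells I n)"
  have V: "finite V" unfolding V_def by (intro finite_imageI finite_cartesian_product finite_D finite_cells)
  define A where "A = (SIGMA p:cells I n. {m \<in> V. displaced J p m})"
  have A: "finite A" unfolding A_def using V by (intro finite_SigmaI) auto
  have cover: "D \<inter> B \<subseteq> (\<Union>i\<in>A. ?E i)"
  proof
    fix \<theta> assume \<theta>: "\<theta> \<in> D \<inter> B"
    then obtain p m where pm: "p \<in> cells I n" "displaced J p m" "\<theta> p = \<theta>s p + of_int m * \<phi>"
      using B by blast
    have "m = \<lfloor>(\<theta> p - \<theta>s p) / \<phi>\<rfloor>" using pm(3) \<phi> by simp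
    then have "m \<in> V" using \<theta> pm(1) unfolding V_def by force
    then have "(p, m) \<in> A" "\<theta> \<in> ?E (p, m)" using pm by (auto simp: A_def)
    then show "\<theta> \<in> (\<Union>i\<in>A. ?E i)" by blast
  qed
  define q where "q = exp (- (\<kappa> * ln (real n)))"
  have q: "0 \<le> q" "q \<le> 1 / 2"
  proof -
    have "ln (real n) \<le> \<kappa> * ln (real n)" using \<kappa>(2) n_ge_2 by simp
    then have "q \<le> exp (- ln (real n))" unfolding q_def by simp
    also have "\<dots> = 1 / real n" using n_ge_2 by (simp add: exp_minus divide_inverse)
    also have "\<dots> \<le> 1 / 2" using n_ge_2 by simp
    finally show "q \<le> 1 / 2" .
  qed (simp add: q_def)
  have one: "(\<integral>y. post y (?E (p, m)) \<partial>?W) \<le> q ^ nat \<bar>m\<bar>" if "(p, m) \<in> A" for p m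
  proof -
    have p: "p \<in> cells I n" and m: "displaced J p m" using that by (auto simp: A_def)
    have "p \<in> Lam I" using p by (simp add: cells_def)
    then have "\<bar>\<theta>0 p - \<theta>s p\<bar> \<le> \<delta> * \<phi> \<or> \<bar>\<theta>0 p - \<theta>s p\<bar> \<le> \<phi> / 2 \<and> 4 \<le> \<bar>m\<bar>"
      using fine[OF p] m \<theta>s(2) unfolding displaced_def by (meson not_le)
    then show ?thesis
      unfolding q_def \<kappa>(1) case_prod_conv using m
      by (intro expected_post_shift_le p \<theta>s(1) \<delta>) (auto simp: displaced_def)
  qed
  have "(\<integral>y. post y B \<partial>?W) \<le> (\<integral>y. (\<Sum>i\<in>A. post y (?E i)) \<partial>?W)"
    by (intro integral_mono Bochner_Integration.integrable_sum post_integrable post_subadditive A cover)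
  also have "\<dots> = (\<Sum>i\<in>A. \<integral>y. post y (?E i) \<partial>?W)"
    by (intro Bochner_Integration.integral_sum post_integrable)
  also have "\<dots> \<le> (\<Sum>i\<in>A. q ^ nat \<bar>snd i\<bar>)"
  proof (rule sum_mono)
    fix i assume i: "i \<in> A"
    obtain p m where "i = (p, m)" by (cases i)
    then show "(\<integral>y. post y (?E i) \<partial>?W) \<le> q ^ nat \<bar>snd i\<bar>" using one i by simp
  qed
  also have "\<dots> = (\<Sum>p\<in>cells I n. \<Sum>m\<in>{m \<in> V. displaced J p m}. q ^ nat \<bar>m\<bar>)"
    unfolding A_def using V by (subst sum.Sigma) (auto simp: case_prod_unfold)
  also have "\<dots> \<le> (\<Sum>p\<in>cells I n. 4 * q)"
    using V q by (intro sum_mono sum_power_abs_le) (auto simp: displaced_def)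
  also have "\<dots> = real (card (cells I n)) * (4 * q)" by simp
  also have "\<dots> \<le> 4 * c2 * real n * (4 * q)"
    using card_cells_le[of n] n_ge_2 q by (intro mult_right_mono) auto
  also have "\<dots> = 16 * c2 * (exp (ln (real n)) * q)" using n_ge_2 by simp
  also have "exp (ln (real n)) * q = exp ((1 - \<kappa>) * ln (real n))"
    unfolding q_def exp_add[symmetric] by (simp add: algebra_simps)
  also have "\<dots> = real n powr (1 - \<kappa>)" using n_ge_2 by (simp add: powr_def)
  finally show ?thesis .
qed

text \<open>
  If no coordinate is displaced, the grid point stays within a fixed multiple of \<open>\<phi>\<^sub>n\<close> of the truth up to the
  cut-off and vanishes beyond it.
\<close>

lemma expected_post_ball_complement_le:
  assumes \<beta>: "0 < \<beta>" "\<theta>0 \<in> hoelder I \<beta> L" and near: "near_grid_point I \<phi>0 L n \<theta>0 \<theta>s"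
    and \<delta>: "0 < \<delta>" "\<delta> \<le> 1/8" and \<kappa>: "\<kappa> = \<phi>0\<^sup>2 * (1 - 4 * \<delta>) / 8" "1 < \<kappa>"
    and J: "2 powr real_of_int J \<le> b0 * (real n / ln (real n)) powr (1 / (2 * \<beta> + 1))"
    and small: "\<And>j k. k \<in> I j \<Longrightarrow> int j > J \<Longrightarrow> \<bar>\<theta>0 (j, k)\<bar> \<le> \<delta> * \<phi>"
    and tail: "(\<Sum>j. if int j > J then 2 powr (real j / 2) * (MAX k\<in>I j. \<bar>\<theta>0 (j, k)\<bar>) else 0) \<le> rate \<beta> n"
    and M: "14 * \<phi>0 * sqrt b0 + 1 < M"
  shows "(\<integral>y. post y {\<theta>. ell_inf I \<theta> \<theta>0 \<ge> M * rate \<beta> n} \<partial>white_noise I n \<theta>0) \<le> 16 * c2 * real n powr (1 - \<kappa>)"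
proof -
  have \<phi>: "0 < \<phi>" by (rule phi_pos[OF n_ge_2 \<phi>0_pos])
  have \<theta>s: "\<theta>s \<in> D" "\<And>p. p \<in> Lam I \<Longrightarrow> \<bar>\<theta>0 p - \<theta>s p\<bar> \<le> \<phi> / 2"
    using near by (auto simp: near_grid_point_def)
  have \<theta>s_0: "\<theta>s (j, k) = 0" if "k \<in> I j" "int j > J" for j k
  proof -
    obtain b where b: "\<theta>s (j, k) = of_int b * \<phi>" using grid_multiple[OF \<theta>s(1)] by metis
    have "\<delta> * \<phi> \<le> 1/8 * \<phi>" using \<delta> \<phi> by (intro mult_right_mono) auto
    then have "\<bar>\<theta>0 (j, k)\<bar> \<le> 1/8 * \<phi>" using small[OF that] by linarith
    moreover have "\<bar>\<theta>0 (j, k) - of_int b * \<phi>\<bar> \<le> \<phi> / 2" using \<theta>s(2)[of "(j, k)"] that by (simp add: Lam_def b)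
    ultimately have "\<bar>of_int b * \<phi> - of_int 0 * \<phi>\<bar> < \<phi>" using \<phi> unfolding of_int_0 by linarith
    then have "b = 0" by (rule int_multiple_abs_less[OF _ \<phi>])
    then show ?thesis by (simp add: b)
  qed
  show ?thesis
  proof (rule expected_post_displaced_le[OF near \<delta> \<kappa>])
    fix p assume p: "p \<in> cells I n" "J < int (fst p)"
    then have "snd p \<in> I (fst p)" by (auto simp: cells_def Lam_def)
    then show "\<bar>\<theta>0 p - \<theta>s p\<bar> \<le> \<delta> * \<phi>"
      using small[of "snd p" "fst p"] \<theta>s_0[of "snd p" "fst p"] p(2) by simp
  next
    fix \<theta> assume \<theta>: "\<theta> \<in> D" "\<theta> \<in> {\<theta>. ell_inf I \<theta> \<theta>0 \<ge> M * rate \<beta> n}"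
    show "\<exists>p\<in>cells I n. \<exists>m. displaced J p m \<and> \<theta> p = \<theta>s p + of_int m * \<phi>"
    proof (rule ccontr)
      assume none: "\<not> ?thesis"
      have not_displaced: "\<theta> p = \<theta>s p \<or> int (fst p) \<le> J \<and> \<bar>\<theta> p - \<theta>s p\<bar> \<le> 3 * \<phi>" for p
      proof (cases "p \<in> cells I n")
        case True
        obtain a b where ab: "\<theta> p = of_int a * \<phi>" "\<theta>s p = of_int b * \<phi>"
          using grid_multiple \<theta>(1) \<theta>s(1) by metis
        then have diff: "\<theta> p = \<theta>s p + of_int (a - b) * \<phi>" by (simp add: algebra_simps)
        then have "\<not> displaced J p (a - b)" using none True by blast
        then consider "a - b = 0" | "int (fst p) \<le> J" "\<bar>a - b\<bar> \<le> 3" unfolding displaced_def by linarith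
        then show ?thesis
        proof cases
          case 2
          have "\<bar>\<theta> p - \<theta>s p\<bar> = of_int \<bar>a - b\<bar> * \<phi>" unfolding diff using \<phi> by (simp add: abs_mult)
          also have "\<dots> \<le> 3 * \<phi>" using 2(2) \<phi> by (intro mult_right_mono) auto
          finally show ?thesis using 2(1) by blast
        qed (use ab in simp)
      next
        case False
        then show ?thesis using grid_outside[OF \<theta>(1)] grid_outside[OF \<theta>s(1)] by simp
      qed
      have "ell_inf I \<theta> \<theta>0 \<le> (4 * (7/2) * \<phi>0 * sqrt b0 + 1) * rate \<beta> n"
      proof (rule ell_inf_le_rate[OF n_ge_2 \<beta> _ _ J tail])
        fix j k assume k: "k \<in> I j"
        then have near: "\<bar>\<theta>0 (j, k) - \<theta>s (j, k)\<bar> \<le> \<phi> / 2" by (intro \<theta>s(2)) (simp add: Lam_def)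
        show "\<bar>\<theta> (j, k) - \<theta>0 (j, k)\<bar> \<le> 7/2 * \<phi>"
          using not_displaced[of "(j, k)"] near \<phi> by (elim disjE conjE) linarith+
        show "\<theta> (j, k) = 0" if "J < int j"
          using not_displaced[of "(j, k)"] \<theta>s_0[OF k that] that by simp
      qed (use \<phi>0_pos in auto)
      also have "\<dots> < M * rate \<beta> n"
        using M rate_pos[OF n_ge_2, of \<beta>] by (intro mult_strict_right_mono) auto
      finally show False using \<theta>(2) by simp
    qed
  qed
qed

lemma grid_ell_inf_bounded:
  assumes "0 < \<beta>1"
  shows "\<exists>R. \<forall>\<beta>\<ge>\<beta>1. \<forall>\<theta>0\<in>hoelder I \<beta> L. \<forall>\<theta>\<in>D. ell_inf I \<theta> \<theta>0 \<le> R"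
proof -
  define g where "g = (\<lambda>j. (if j \<in> {..Jmax n} then 2 powr (real j / 2) * (L + 1) else 0) + L * (2 powr - \<beta>1) ^ j)"
  have g: "summable g"
    unfolding g_def
  proof (rule summable_add)
    show "summable (\<lambda>j. L * (2 powr - \<beta>1) ^ j)"
      using two_powr_minus_less_1[OF assms] by (intro summable_mult summable_geometric) simp
  qed (rule summable_If_finite_set, simp)
  have "ell_inf I \<theta> \<theta>0 \<le> suminf g" if "\<beta>1 \<le> \<beta>" "\<theta>0 \<in> hoelder I \<beta> L" "\<theta> \<in> D" for \<beta> \<theta>0 \<theta>
  proof (rule ell_inf_le_suminf(1)[OF _ g])
    fix j k assume k: "k \<in> I j"
    have mem: "\<theta>0 \<in> hoelder I \<beta>1 L" using hoelder_antimono[OF that(1), of L] that(2) L_pos by auto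
    have "\<bar>\<theta> (j, k)\<bar> \<le> (if j \<in> {..Jmax n} then L + 1 else 0)"
      using grid_abs_le[OF that(3), of "(j, k)"] grid_outside[OF that(3), of "(j, k)"] L_pos
      by (auto simp: cells_def)
    then have "2 powr (real j / 2) * \<bar>\<theta> (j, k)\<bar> \<le> 2 powr (real j / 2) * (if j \<in> {..Jmax n} then L + 1 else 0)"
      by (rule mult_left_mono) simp
    also have "\<dots> = (if j \<in> {..Jmax n} then 2 powr (real j / 2) * (L + 1) else 0)" by simp
    finally have "2 powr (real j / 2) * \<bar>\<theta> (j, k)\<bar>
        \<le> (if j \<in> {..Jmax n} then 2 powr (real j / 2) * (L + 1) else 0)" .
    moreover have "2 powr (real j / 2) * \<bar>\<theta>0 (j, k)\<bar> \<le> L * (2 powr - \<beta>1) ^ j"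
      unfolding hoelder_powr_power[symmetric] by (intro mult_left_mono hoelder_coeff_le[OF mem k]) auto
    moreover have "2 powr (real j / 2) * \<bar>\<theta> (j, k) - \<theta>0 (j, k)\<bar>
        \<le> 2 powr (real j / 2) * \<bar>\<theta> (j, k)\<bar> + 2 powr (real j / 2) * \<bar>\<theta>0 (j, k)\<bar>"
      unfolding distrib_left[symmetric] by (intro mult_left_mono abs_triangle_ineq4) auto
    ultimately show "2 powr (real j / 2) * \<bar>\<theta> (j, k) - \<theta>0 (j, k)\<bar> \<le> g j"
      unfolding g_def by linarith
  qed
  then show ?thesis by blast
qed

end

context dyadic_index
begin

text \<open>
  For fixed \<open>n\<close> the grid has bounded sup-type distance to the Hoelder balls, so that a large radius leaves no grid
  point outside the ball.
\<close>

lemma posterior_vanishes: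
  assumes "0 < \<phi>0" "0 < \<beta>1" "0 < L" "2 \<le> n"
  shows "\<exists>M0>0. \<forall>M\<ge>M0. \<forall>\<beta>\<ge>\<beta>1. \<forall>\<theta>0\<in>hoelder I \<beta> L. \<forall>y.
    posterior I n (sieve_prior I \<phi>0 L n) y {\<theta>. ell_inf I \<theta> \<theta>0 \<ge> M * rate \<beta> n} = 0"
proof -
  interpret sieve I c1 c2 \<phi>0 L n by unfold_locales (use assms in auto)
  obtain R where R: "\<And>\<beta> \<theta>0 \<theta>. \<beta>1 \<le> \<beta> \<Longrightarrow> \<theta>0 \<in> hoelder I \<beta> L \<Longrightarrow> \<theta> \<in> D \<Longrightarrow> ell_inf I \<theta> \<theta>0 \<le> R"
    using grid_ell_inf_bounded[OF assms(2)] by blast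
  define r where "r = (real n / ln (real n)) powr (- 1 / 2)"
  have r: "0 < r" unfolding r_def using n_div_ln_gt_1[OF n_ge_2] by (subst powr_gt_zero) linarith
  define M0 where "M0 = (\<bar>R\<bar> + 1) / r"
  have M0: "0 < M0" using r by (simp add: M0_def)
  have "post y {\<theta>. ell_inf I \<theta> \<theta>0 \<ge> M * rate \<beta> n} = 0"
    if M: "M0 \<le> M" and \<beta>: "\<beta>1 \<le> \<beta>" and \<theta>0: "\<theta>0 \<in> hoelder I \<beta> L" for M \<beta> \<theta>0 y
  proof (rule post_eq_0)
    have "R < \<bar>R\<bar> + 1" by simp
    also have "\<dots> = M0 * r" using r by (simp add: M0_def)
    also have "\<dots> \<le> M * rate \<beta> n"
      using M M0 r rate_lower[OF n_ge_2, of \<beta>] \<beta> assms(2) unfolding r_def[symmetric] by (intro mult_mono) auto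
    finally show "D \<inter> {\<theta>. ell_inf I \<theta> \<theta>0 \<ge> M * rate \<beta> n} = {}"
      using R[OF \<beta> \<theta>0] by fastforce
  qed
  then show ?thesis using M0 by blast
qed

text \<open>
  For all large \<open>n\<close> the truth can be rounded to the grid and the constant \<open>16 c2\<close> absorbed into a power of \<open>n\<close>;
  the radius is then enlarged to cover each of the finitely many remaining \<open>n\<close>.
\<close>

lemma posterior_contraction:
  assumes \<phi>0: "2 * sqrt 2 < \<phi>0" and pos: "0 < \<beta>1" "0 < L"
  shows "\<exists>M>0. \<exists>B>0. \<forall>n\<ge>2. \<forall>\<beta>\<in>{\<beta>1..\<beta>2}. \<forall>\<theta>0\<in>hoelder I \<beta> L.
    (\<integral>y. posterior I n (sieve_prior I \<phi>0 L n) y {\<theta>. ell_inf I \<theta> \<theta>0 \<ge> M * rate \<beta> n} \<partial>white_noise I n \<theta>0)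
      \<le> real n powr (- B)"
proof -
  have \<phi>0_pos: "0 < \<phi>0" using \<phi>0 real_sqrt_gt_zero[of 2] by linarith
  have "(2 * sqrt 2)\<^sup>2 < \<phi>0\<^sup>2" using \<phi>0 by (intro power_strict_mono) auto
  then have \<phi>0_sq: "8 < \<phi>0\<^sup>2" by (simp add: power_mult_distrib)
  \<comment> \<open>The choice of \<open>\<delta>\<close> puts \<open>\<kappa>\<close> halfway between 1 and \<open>\<phi>0\<^sup>2 / 8\<close>.\<close>
  define \<delta> where "\<delta> = (1 - 8 / \<phi>0\<^sup>2) / 8"
  have "8 / \<phi>0\<^sup>2 < 1" "0 < 8 / \<phi>0\<^sup>2" using \<phi>0_sq \<phi>0_pos by (simp_all add: divide_less_eq)
  then have \<delta>: "0 < \<delta>" "\<delta> \<le> 1/8" by (auto simp: \<delta>_def)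
  define \<kappa> where "\<kappa> = \<phi>0\<^sup>2 * (1 - 4 * \<delta>) / 8"
  have "\<phi>0\<^sup>2 * (1 - 4 * \<delta>) = (\<phi>0\<^sup>2 + 8) / 2" using \<phi>0_pos by (simp add: \<delta>_def field_simps)
  then have \<kappa>: "1 < \<kappa>" using \<phi>0_sq by (simp add: \<kappa>_def)
  define B where "B = (\<kappa> - 1) / 2"
  have B: "0 < B" using \<kappa> by (simp add: B_def)
  \<comment> \<open>The cut-off for the threshold \<open>4 \<delta> \<phi>0\<close> makes coefficients beyond it smaller than \<open>\<delta> \<phi>\<^sub>n\<close>.\<close>
  obtain b0 J where b0: "0 < b0" and cutoff: "tail_cutoff I (4 * \<delta> * \<phi>0) \<beta>1 \<beta>2 L b0 J"
    using tail_cutoff_exists[of "4 * \<delta> * \<phi>0" \<beta>1 L \<beta>2] \<phi>0_pos \<delta> pos by auto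
  define M1 where "M1 = 14 * \<phi>0 * sqrt b0 + 2"
  have M1: "0 < M1" using \<phi>0_pos b0 by (simp add: M1_def add_pos_pos)
  have "filterlim (\<lambda>n::nat. real n powr B) at_top sequentially" using B by real_asymp
  then have "\<forall>\<^sub>F n in sequentially. 16 * c2 \<le> real n powr B" by (simp add: filterlim_at_top)
  moreover have "\<forall>\<^sub>F n in sequentially. \<forall>\<theta>0\<in>hoelder I \<beta>1 L. \<exists>\<theta>s. near_grid_point I \<phi>0 L n \<theta>0 \<theta>s"
    by (rule eventually_near_grid_point[OF \<phi>0_pos pos])
  ultimately obtain N where N: "\<And>n. N \<le> n \<Longrightarrow> 16 * c2 \<le> real n powr B"
      "\<And>n \<theta>0. N \<le> n \<Longrightarrow> \<theta>0 \<in> hoelder I \<beta>1 L \<Longrightarrow> \<exists>\<theta>s. near_grid_point I \<phi>0 L n \<theta>0 \<theta>s"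
    unfolding eventually_sequentially by (metis (no_types, lifting) max.bounded_iff)
  have large: "(\<integral>y. posterior I n (sieve_prior I \<phi>0 L n) y {\<theta>. ell_inf I \<theta> \<theta>0 \<ge> M * rate \<beta> n} \<partial>white_noise I n \<theta>0)
      \<le> real n powr (- B)"
    if n: "2 \<le> n" "N \<le> n" and \<beta>: "\<beta> \<in> {\<beta>1..\<beta>2}" and \<theta>0: "\<theta>0 \<in> hoelder I \<beta> L" and M: "M1 \<le> M" for n \<beta> \<theta>0 M
  proof -
    interpret sieve I c1 c2 \<phi>0 L n by unfold_locales (use n \<phi>0_pos pos in auto)
    have \<beta>_pos: "0 < \<beta>" using \<beta> pos by auto
    have "\<theta>0 \<in> hoelder I \<beta>1 L" using hoelder_antimono[of \<beta>1 \<beta> L] \<beta> \<theta>0 pos by auto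
    then obtain \<theta>s where near: "near_grid_point I \<phi>0 L n \<theta>0 \<theta>s" using N(2) n by blast
    have cut: "2 powr real_of_int (J n \<beta>) \<le> b0 * (real n / ln (real n)) powr (1 / (2 * \<beta> + 1))"
      "\<And>j k. k \<in> I j \<Longrightarrow> int j > J n \<beta> \<Longrightarrow> \<bar>\<theta>0 (j, k)\<bar> \<le> phi (4 * \<delta> * \<phi>0) n / 4"
      "(\<Sum>j. if int j > J n \<beta> then 2 powr (real j / 2) * (MAX k\<in>I j. \<bar>\<theta>0 (j, k)\<bar>) else 0) \<le> rate \<beta> n"
      using cutoff n(1) \<beta> \<theta>0 unfolding tail_cutoff_def Lam_def by blast+
    have "phi (4 * \<delta> * \<phi>0) n / 4 = \<delta> * \<phi>" by (simp add: phi_def)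
    then have small: "\<And>j k. k \<in> I j \<Longrightarrow> int j > J n \<beta> \<Longrightarrow> \<bar>\<theta>0 (j, k)\<bar> \<le> \<delta> * \<phi>" using cut(2) by simp
    have "(\<integral>y. post y {\<theta>. ell_inf I \<theta> \<theta>0 \<ge> M * rate \<beta> n} \<partial>white_noise I n \<theta>0) \<le> 16 * c2 * real n powr (1 - \<kappa>)"
      by (rule expected_post_ball_complement_le[OF \<beta>_pos \<theta>0 near \<delta> \<kappa>_def \<kappa> cut(1) small cut(3)])
        (use M in \<open>simp_all add: M1_def\<close>)
    also have "\<dots> \<le> real n powr B * real n powr (1 - \<kappa>)" by (intro mult_right_mono N(1) n(2)) auto
    also have "\<dots> = real n powr (B + (1 - \<kappa>))" by (rule powr_add[symmetric])
    also have "B + (1 - \<kappa>) = - B" by (simp add: B_def field_simps)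
    finally show ?thesis .
  qed
  have "\<exists>M0>0. \<forall>M\<ge>M0. \<forall>\<beta>\<ge>\<beta>1. \<forall>\<theta>0\<in>hoelder I \<beta> L. \<forall>y.
    posterior I n (sieve_prior I \<phi>0 L n) y {\<theta>. ell_inf I \<theta> \<theta>0 \<ge> M * rate \<beta> n} = 0" if "2 \<le> n" for n
    by (rule posterior_vanishes[OF \<phi>0_pos pos that])
  then obtain M2 where M2: "\<And>n. 2 \<le> n \<Longrightarrow> 0 < M2 n" "\<And>n M \<beta> \<theta>0 y. 2 \<le> n \<Longrightarrow> M2 n \<le> M \<Longrightarrow> \<beta>1 \<le> \<beta> \<Longrightarrow>
      \<theta>0 \<in> hoelder I \<beta> L \<Longrightarrow> posterior I n (sieve_prior I \<phi>0 L n) y {\<theta>. ell_inf I \<theta> \<theta>0 \<ge> M * rate \<beta> n} = 0"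
    by metis
  define M where "M = M1 + (\<Sum>n\<in>{2..<N}. M2 n)"
  have sum_nonneg: "0 \<le> (\<Sum>n\<in>{2..<N}. M2 n)" using M2(1) by (intro sum_nonneg) (auto intro: less_imp_le)
  have M_ge: "M1 \<le> M" using sum_nonneg by (simp add: M_def)
  have "(\<integral>y. posterior I n (sieve_prior I \<phi>0 L n) y {\<theta>. ell_inf I \<theta> \<theta>0 \<ge> M * rate \<beta> n} \<partial>white_noise I n \<theta>0)
      \<le> real n powr (- B)"
    if n: "2 \<le> n" and \<beta>: "\<beta> \<in> {\<beta>1..\<beta>2}" and \<theta>0: "\<theta>0 \<in> hoelder I \<beta> L" for n \<beta> \<theta>0
  proof (cases "N \<le> n")
    case True
    show ?thesis by (rule large[OF n True \<beta> \<theta>0 M_ge])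
  next
    case False
    have "M2 n \<le> (\<Sum>n\<in>{2..<N}. M2 n)"
      by (rule member_le_sum) (use n False M2(1) in \<open>auto intro: less_imp_le\<close>)
    then have "M2 n \<le> M" using M1 by (simp add: M_def)
    then have "posterior I n (sieve_prior I \<phi>0 L n) y {\<theta>. ell_inf I \<theta> \<theta>0 \<ge> M * rate \<beta> n} = 0" for y
      using M2(2) n \<beta> \<theta>0 by auto
    then show ?thesis by simp
  qed
  moreover have "0 < M" using M1 M_ge by linarith
  ultimately show ?thesis using B by blast
qed

end

theorem proposition1:
  fixes I :: "nat \<Rightarrow> 'k set" and c1 c2 :: real
  assumes I_finite: "\<And>j. finite (I j)"
    and c_pos: "0 < c1" "0 < c2"
    and I_order: "\<And>j. c1 * 2 ^ j \<le> real (card (I j)) \<and> real (card (I j)) \<le> c2 * 2 ^ j"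
  shows
    "(\<forall>\<phi>0 \<beta>1 \<beta>2 L index. 0 < \<phi>0 \<and> 0 < \<beta>1 \<and> \<beta>1 \<le> \<beta>2 \<and> 0 < L \<and>
      (\<forall>\<theta>\<in>hoelder_union I \<beta>1 \<beta>2 L. index \<theta> \<in> {\<beta>1..\<beta>2} \<and> \<theta> \<in> hoelder I (index \<theta>) L) \<longrightarrow>
      (let \<Theta> = hoelder_union I \<beta>1 \<beta>2 L; \<epsilon> = (\<lambda>n \<theta>. rate (index \<theta>) n) in
        \<Theta> = hoelder I \<beta>1 L \<and>
        (\<forall>\<^sub>F n in sequentially. \<forall>\<theta>0\<in>\<Theta>.
           (\<exists>\<theta>s. near_grid_point I \<phi>0 L n \<theta>0 \<theta>s) \<and> separated I \<Theta> (\<epsilon> n) \<theta>0 \<noteq> {}) \<and>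
        (\<exists>b0>0. \<exists>J. tail_cutoff I \<phi>0 \<beta>1 \<beta>2 L b0 J) \<and>
        (\<forall>b0>0. \<forall>J A. tail_cutoff I \<phi>0 \<beta>1 \<beta>2 L b0 J \<and> A \<ge> 4 * (3 * \<phi>0 * sqrt b0 + 1) \<longrightarrow>
          (\<exists>C0>0. \<exists>K0>0. \<exists>K1>0. \<forall>n\<ge>2. \<forall>\<theta>0\<in>\<Theta>. \<forall>\<theta>s. near_grid_point I \<phi>0 L n \<theta>0 \<theta>s \<longrightarrow>
            (let B0 = block0 I \<phi>0 L n \<theta>0 (A * \<epsilon> n \<theta>0);
                 \<B> = blocks I \<phi>0 L n \<theta>0 \<theta>s (A * \<epsilon> n \<theta>0) in
              equiv (grid I \<phi>0 L n) (d1_rel I \<phi>0 L n \<theta>0) \<and>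
              admissible I (grid I \<phi>0 L n) \<theta>0 A (\<epsilon> n \<theta>0) B0 \<B> \<and>
              (separated I \<Theta> (\<epsilon> n) \<theta>0 \<noteq> {} \<longrightarrow>
                (\<exists>f. (\<forall>S\<in>\<B>. inj_on (f S) S \<and> f S ` S \<subseteq> B0) \<and>
                  (\<Sum>S\<in>\<B>. exp (- K0 * real n * (MIN \<theta>\<in>S. ell2 I \<theta> (f S \<theta>))\<^sup>2))
                    \<le> C0 * exp (- K1 * real n * (modulus I \<Theta> (\<epsilon> n) \<theta>0)\<^sup>2))))))))
     \<and>
     (\<forall>\<phi>0 > 2 * sqrt 2. \<forall>\<beta>1 \<beta>2 L. 0 < \<beta>1 \<and> \<beta>1 \<le> \<beta>2 \<and> 0 < L \<longrightarrow>
      (\<exists>M>0. \<exists>B>0. \<forall>n\<ge>2. \<forall>\<beta>\<in>{\<beta>1..\<beta>2}. \<forall>\<theta>0\<in>hoelder I \<beta> L.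
        (\<integral>y. posterior I n (sieve_prior I \<phi>0 L n) y
            {\<theta>. ell_inf I \<theta> \<theta>0 \<ge> M * (real n / ln (real n)) powr (- \<beta> / (2 * \<beta> + 1))}
          \<partial>white_noise I n \<theta>0) \<le> real n powr (- B)))"
proof -
  interpret dyadic_index I c1 c2 by unfold_locales (use assms in auto)
  show ?thesis
  proof (intro conjI allI impI, goal_cases)
    case (1 \<phi>0 \<beta>1 \<beta>2 L index)
    then have pos: "0 < \<phi>0" "0 < \<beta>1" "0 < L" and \<beta>: "\<beta>1 \<le> \<beta>2" by auto
    have \<Theta>: "hoelder_union I \<beta>1 \<beta>2 L = hoelder I \<beta>1 L"
      using \<beta> pos by (intro hoelder_union_eq) auto
    have index: "index \<theta> \<in> {\<beta>1..\<beta>2} \<and> \<theta> \<in> hoelder I (index \<theta>) L" if "\<theta> \<in> hoelder I \<beta>1 L" for \<theta>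
      using 1 that unfolding \<Theta> by blast
    then have index_ge: "\<beta>1 \<le> index \<theta>" if "\<theta> \<in> hoelder I \<beta>1 L" for \<theta>
      using that by auto
    show ?case
      unfolding \<Theta> Let_def
    proof (intro conjI allI impI, goal_cases)
      case 1
      show ?case by (rule refl)
    next
      case 2
      show ?case
        by (intro eventually_conj[OF eventually_near_grid_point[OF pos]
              eventually_separated[OF pos(2,3), of index], THEN eventually_mono] index_ge) auto
    next
      case 3
      show ?case by (rule tail_cutoff_exists[OF pos])
    next
      case (4 b0 J A)
      then show ?case
        by (intro partition_bound[unfolded Let_def, OF pos _ index]) auto
    qed
  next
    case (2 \<phi>0 \<beta>1 \<beta>2 L)
    then show ?case
      by (intro posterior_contraction[unfolded rate_def]) auto
  qed
qed

end
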